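(* Let $G$ be a finite simple bipartite graph. Then the following are equivalent: (1) $G$ is a vertex decomposable graph; (2) $J(G)^k$ has linear quotients for all $k\ge 1$; (3) $J(G)^k$ is a componentwise linear ideal for all $k\ge 1$; (4) $J(G)^k$ is a componentwise linear ideal for some $k>1$.
   Context: Let $V(G)=\{x_1,\dots,x_n\}$ and $R=\mathbb{K}[x_1,\dots,x_n]$, $\mathbb{K}$ a field. The cover ideal is $J(G)=\bigcap_{\{x_i,x_j\}\in E(G)}(x_i,x_j)$; $J(G)^k$ is its ordinary $k$-th power. A homogeneous ideal $I$ is componentwise linear if for each $\ell$ the ideal generated by all degree $\ell$ elements of $I$ has a linear resolution. A monomial ideal $I$ has linear quotients if its minimal monomial generators can be ordered $u_1,\dots,u_m$ so that for every $2\le i\le m$ the ideal $(u_1,\dots,u_{i-1}):(u_i)$ is generated by a subset of the variables. $N_G[x]$ is the set consisting of $x$ and its neighbors; $G\setminus U$ is the induced subgraph on $V(G)\setminus U$. A vertex $x$ of $G$ is a shedding vertex if no independent set of $G\setminus N_G[x]$ is a maximal independent set of $G\setminus x$. $G$ is (recursively) vertex decomposable if it has no edges, or it has a shedding vertex $x$ such that $G\setminus x$ and $G\setminus N_G[x]$ are both vertex decomposable. *)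

theory Defs
  imports "HOL-Library.Poly_Mapping" "Jordan_Normal_Form.Matrix_Kernel"
begin

section \<open>Finite simple graphs\<close>

text \<open>A graph is given by a vertex set \<open>V\<close> and a set \<open>E\<close> of two-element subsets of \<open>V\<close>.\<close>

definition simple_graph :: "'v set \<Rightarrow> 'v set set \<Rightarrow> bool" where
  "simple_graph V E \<longleftrightarrow> finite V \<and> (\<forall>e\<in>E. e \<subseteq> V \<and> card e = 2)"

definition bipartite :: "'v set \<Rightarrow> 'v set set \<Rightarrow> bool" where
  "bipartite V E \<longleftrightarrow>
     (\<exists>A B. A \<union> B = V \<and> A \<inter> B = {} \<and> (\<forall>e\<in>E. \<exists>a\<in>A. \<exists>b\<in>B. e = {a, b}))"

definition closed_nbhd :: "'v set set \<Rightarrow> 'v \<Rightarrow> 'v set" where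
  "closed_nbhd E x = insert x {y. {x, y} \<in> E}"

text \<open>The graph \<open>G \<setminus> U\<close> is the pair \<open>(V - U, del_edges E U)\<close>.\<close>

definition del_edges :: "'v set set \<Rightarrow> 'v set \<Rightarrow> 'v set set" where
  "del_edges E U = {e \<in> E. e \<inter> U = {}}"

definition independent_set :: "'v set \<Rightarrow> 'v set set \<Rightarrow> 'v set \<Rightarrow> bool" where
  "independent_set V E S \<longleftrightarrow> S \<subseteq> V \<and> (\<forall>e\<in>E. \<not> e \<subseteq> S)"

definition maximal_independent_set :: "'v set \<Rightarrow> 'v set set \<Rightarrow> 'v set \<Rightarrow> bool" where
  "maximal_independent_set V E S \<longleftrightarrow>
     independent_set V E S \<and> (\<forall>T. independent_set V E T \<and> S \<subseteq> T \<longrightarrow> T = S)"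

definition shedding_vertex :: "'v set \<Rightarrow> 'v set set \<Rightarrow> 'v \<Rightarrow> bool" where
  "shedding_vertex V E x \<longleftrightarrow> x \<in> V \<and>
     \<not> (\<exists>S. independent_set (V - closed_nbhd E x) (del_edges E (closed_nbhd E x)) S \<and>
            maximal_independent_set (V - {x}) (del_edges E {x}) S)"

inductive vertex_decomposable :: "'v set \<Rightarrow> 'v set set \<Rightarrow> bool" where
  no_edges: "vertex_decomposable V {}"
| shedding: "shedding_vertex V E x \<Longrightarrow>
     vertex_decomposable (V - {x}) (del_edges E {x}) \<Longrightarrow>
     vertex_decomposable (V - closed_nbhd E x) (del_edges E (closed_nbhd E x)) \<Longrightarrow>
     vertex_decomposable V E"


section \<open>Ideals of a commutative ring\<close>

lemma module_mult: "Modules.module ((*) :: 'a::comm_ring_1 \<Rightarrow> 'a \<Rightarrow> 'a)"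
  by unfold_locales (simp_all add: algebra_simps)

text \<open>Ideals are the submodules of the ring regarded as a module over itself.\<close>

definition ideal_gen :: "'a::comm_ring_1 set \<Rightarrow> 'a set" where
  "ideal_gen S = Modules.module.span (*) S"

definition ideal_mult :: "'a::comm_ring_1 set \<Rightarrow> 'a set \<Rightarrow> 'a set" where
  "ideal_mult I J = ideal_gen {f * g | f g. f \<in> I \<and> g \<in> J}"

primrec ideal_power :: "'a::comm_ring_1 set \<Rightarrow> nat \<Rightarrow> 'a set" where
  "ideal_power I 0 = UNIV"
| "ideal_power I (Suc k) = ideal_mult I (ideal_power I k)"

definition ideal_colon :: "'a::comm_ring_1 set \<Rightarrow> 'a set \<Rightarrow> 'a set" where
  "ideal_colon I J = {f. \<forall>g\<in>J. f * g \<in> I}"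


section \<open>The polynomial ring\<close>

text \<open>
  Polynomials over \<open>'k\<close> with one variable for each element of \<open>'v\<close>: a polynomial maps an
  exponent vector \<open>'v \<Rightarrow>\<^sub>0 nat\<close> to its coefficient.
\<close>

type_synonym ('v, 'k) mpoly = "('v \<Rightarrow>\<^sub>0 nat) \<Rightarrow>\<^sub>0 'k"

definition var :: "'v \<Rightarrow> ('v, 'k::field) mpoly" where
  "var v = Poly_Mapping.single (Poly_Mapping.single v 1) 1"

definition is_monomial :: "('v, 'k::field) mpoly \<Rightarrow> bool" where
  "is_monomial u \<longleftrightarrow> (\<exists>m. u = Poly_Mapping.single m 1)"

definition mon_degree :: "('v \<Rightarrow>\<^sub>0 nat) \<Rightarrow> nat" where
  "mon_degree m = (\<Sum>v\<in>Poly_Mapping.keys m. Poly_Mapping.lookup m v)"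

text \<open>The zero polynomial is homogeneous of every degree.\<close>

definition homogeneous :: "nat \<Rightarrow> ('v, 'k::field) mpoly \<Rightarrow> bool" where
  "homogeneous d p \<longleftrightarrow> (\<forall>m\<in>Poly_Mapping.keys p. mon_degree m = d)"

definition homogeneous_ideal :: "('v, 'k::field) mpoly set \<Rightarrow> bool" where
  "homogeneous_ideal I \<longleftrightarrow> (\<exists>S. (\<forall>p\<in>S. \<exists>d. homogeneous d p) \<and> I = ideal_gen S)"

text \<open>For an edgeless graph the intersection is empty, so the cover ideal is the unit ideal.\<close>

definition cover_ideal :: "'v set set \<Rightarrow> ('v, 'k::field) mpoly set" where
  "cover_ideal E = (\<Inter>e\<in>E. ideal_gen (var ` e))"


section \<open>Linear quotients\<close>

definition minimal_monomial_generators ::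
    "('v, 'k::field) mpoly set \<Rightarrow> ('v, 'k) mpoly set \<Rightarrow> bool" where
  "minimal_monomial_generators I S \<longleftrightarrow>
     (\<forall>u\<in>S. is_monomial u) \<and> ideal_gen S = I \<and> (\<forall>T. T \<subset> S \<longrightarrow> ideal_gen T \<noteq> I)"

definition linear_quotients :: "('v, 'k::field) mpoly set \<Rightarrow> bool" where
  "linear_quotients I \<longleftrightarrow>
     (\<exists>us. distinct us \<and> minimal_monomial_generators I (set us) \<and>
        (\<forall>i. 1 \<le> i \<and> i < length us \<longrightarrow>
           (\<exists>X. ideal_colon (ideal_gen (set (take i us))) (ideal_gen {us ! i})
                  = ideal_gen (var ` X))))"


section \<open>Linear resolutions and componentwise linear ideals\<close>

text \<open>
  A graded free resolution \<open>\<dots> \<rightarrow> F\<^sub>2 \<rightarrow> F\<^sub>1 \<rightarrow> F\<^sub>0 \<rightarrow> I \<rightarrow> 0\<close> of an ideal \<open>I\<close> by free modules of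
  finite rank. The list \<open>a i\<close> contains the degrees of the basis elements of \<open>F\<^sub>i\<close>, so \<open>F\<^sub>i\<close> is
  the direct sum of the \<open>R(-s)\<close> for \<open>s\<close> in \<open>a i\<close>. The one-row matrix \<open>D 0\<close> represents the
  map from \<open>F\<^sub>0\<close> onto \<open>I\<close>, composed with the inclusion of \<open>I\<close> in \<open>R\<close>; the matrix \<open>D (Suc i)\<close>
  represents the differential from \<open>F\<close> at \<open>i + 1\<close> to \<open>F\<close> at \<open>i\<close>. The differentials preserve degrees,
  so the \<open>(r, c)\<close> entry of \<open>D (Suc i)\<close> is homogeneous of degree \<open>a (Suc i) ! c - a i ! r\<close>, and zero
  if this number is negative.
\<close>

definition mat_image :: "'a::comm_ring_1 mat \<Rightarrow> 'a vec set" where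
  "mat_image A = (\<lambda>v. A *\<^sub>v v) ` carrier_vec (dim_col A)"

definition graded_free_resolution ::
    "('v, 'k::field) mpoly set \<Rightarrow> (nat \<Rightarrow> nat list) \<Rightarrow> (nat \<Rightarrow> ('v, 'k) mpoly mat) \<Rightarrow> bool" where
  "graded_free_resolution I a D \<longleftrightarrow>
     D 0 \<in> carrier_mat 1 (length (a 0)) \<and>
     (\<forall>i. D (Suc i) \<in> carrier_mat (length (a i)) (length (a (Suc i)))) \<and>
     (\<forall>c < length (a 0). homogeneous (a 0 ! c) (D 0 $$ (0, c))) \<and>
     (\<forall>i. \<forall>r < length (a i). \<forall>c < length (a (Suc i)).
        \<forall>m \<in> Poly_Mapping.keys (D (Suc i) $$ (r, c)).
          a i ! r + mon_degree m = a (Suc i) ! c) \<and>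
     (\<lambda>w. w $ 0) ` mat_image (D 0) = I \<and>
     (\<forall>i. mat_kernel (D i) = mat_image (D (Suc i)))"

text \<open>
  A resolution is minimal if the image of each \<open>D (Suc i)\<close> lies in \<open>m F\<^sub>i\<close>,
  where \<open>m\<close> is the ideal generated by the variables, that is, the set of
  polynomials without constant term.
\<close>

definition minimal_graded_free_resolution ::
    "('v, 'k::field) mpoly set \<Rightarrow> (nat \<Rightarrow> nat list) \<Rightarrow> (nat \<Rightarrow> ('v, 'k) mpoly mat) \<Rightarrow> bool" where
  "minimal_graded_free_resolution I a D \<longleftrightarrow>
     graded_free_resolution I a D \<and>
     (\<forall>i. \<forall>r < length (a i). \<forall>c < length (a (Suc i)).
        Poly_Mapping.lookup (D (Suc i) $$ (r, c)) 0 = 0)"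

text \<open>
  In a linear resolution every summand of \<open>F\<^sub>i\<close> is \<open>R(-d-i)\<close>, for one fixed \<open>d\<close>. The zero ideal
  has a linear resolution, with all \<open>F\<^sub>i = 0\<close>.
\<close>

definition has_linear_resolution :: "('v, 'k::field) mpoly set \<Rightarrow> bool" where
  "has_linear_resolution I \<longleftrightarrow>
     (\<exists>a D d. minimal_graded_free_resolution I a D \<and> (\<forall>i. \<forall>s\<in>set (a i). s = d + i))"

definition componentwise_linear :: "('v, 'k::field) mpoly set \<Rightarrow> bool" where
  "componentwise_linear I \<longleftrightarrow> homogeneous_ideal I \<and>
     (\<forall>l. has_linear_resolution (ideal_gen {f \<in> I. homogeneous l f}))"

end

theory Submission
  imports Defs "HOL-Library.Function_Algebras"
begin

text \<open>
  All conditions are equivalent to a property \<open>leafy\<close>: for every independent set \<open>S\<close>, the graph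
  \<open>G \<setminus> N[S]\<close> has a vertex of degree one unless it has no edges. Deleting the neighbour of a leaf
  shows that \<open>leafy\<close> graphs are vertex decomposable. Conversely, vertex decomposability, linear
  quotients of \<open>J(G)\<close>, and linear first syzygies of the components of \<open>J(G)^k\<close> all yield an exchange
  step between the two covers \<open>N(S) \<union> A'\<close> and \<open>N(S) \<union> B'\<close>, where \<open>A'\<close>, \<open>B'\<close> are the non-isolated
  vertices of the two sides of \<open>G \<setminus> N[S]\<close>, and such a step is only possible at a leaf.

  As \<open>G\<close> is bipartite, \<open>J(G)^k\<close> is spanned by the monomials whose exponents are \<open>k\<close>-covers \<open>w\<close>,
  that is, \<open>w x + w y \<ge> k\<close> on every edge. For a \<open>leafy\<close> graph, both the minimal \<open>k\<close>-covers and all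
  \<open>k\<close>-covers of a fixed degree are put into a linear quotient order by repeatedly splitting a set of
  \<open>k\<close>-covers according to whether \<open>w u\<close> exceeds its lower bound, where \<open>u\<close> is the neighbour of a leaf.
  Linear quotients in a single degree give a linear resolution, because the syzygies of a sequence of
  vectors whose colon ideals are generated by variables have generators with the same property.
\<close>


section \<open>Vertex decomposable bipartite graphs\<close>

text \<open>\<open>leafy\<close> mentions no order, no field and no \<open>k\<close>, which is why
  one property can decide every power at once. Quantifying over all independent \<open>S\<close>
  serves two ends: it makes the property hereditary, and it supplies a leaf in the subgraphs that
  the recursion on \<open>k\<close>-covers meets, where bounds already imposed have made some edges
  automatic. The obstacle in that recursion is to keep both halves of a split of the same shape. For
  minimal \<open>k\<close>-covers an upper bound \<open>c\<close> describes each half, because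
  minimality turns a large value at \<open>u\<close> into a small value at \<open>v\<close>. A whole
  degree component has no upper bounds; there \<open>c\<close> acts only through the lower bounds it
  forces, and a set of frozen coordinates is carried along. The converse cannot assume that a linear
  resolution starts with a monomial basis, so the exchange is read off from a coefficient functional
  on the first free module. The step from quotients to resolutions is stated for vectors rather than
  ideals so that it applies again to its own output.\<close>

definition nbhd :: "'v set set \<Rightarrow> 'v set \<Rightarrow> 'v set" where
  "nbhd E S = {y. \<exists>s\<in>S. {s, y} \<in> E}"

definition residual :: "'v set set \<Rightarrow> 'v set \<Rightarrow> 'v set set" where
  "residual E S = del_edges E (S \<union> nbhd E S)"

definition leafy :: "'v set set \<Rightarrow> bool" where
  "leafy E \<longleftrightarrow> (\<forall>S. (\<forall>e\<in>E. \<not> e \<subseteq> S) \<longrightarrow> residual E S \<noteq> {} \<longrightarrow>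
     (\<exists>u v. {u, v} \<in> residual E S \<and> (\<forall>z. {v, z} \<in> residual E S \<longrightarrow> z = u)))"

text \<open>Minimality is expressed by a private edge for each vertex. This can be checked edge by
  edge in subgraphs and keeps isolated vertices out of \<open>C\<close>.\<close>

definition min_cover :: "'v set set \<Rightarrow> 'v set \<Rightarrow> bool" where
  "min_cover E C \<longleftrightarrow> (\<forall>e\<in>E. \<exists>x\<in>e. x \<in> C) \<and>
     (\<forall>x\<in>C. \<exists>e\<in>E. x \<in> e \<and> (\<forall>y\<in>e. y \<in> C \<longrightarrow> y = x))"

text \<open>Linear quotients of J(G) with the order forgotten. If \<open>C\<close> precedes
  \<open>D\<close>, some variable \<open>t\<close> of \<open>C - D\<close> lies in the colon ideal
  at \<open>D\<close>, witnessed by a generator \<open>M\<close> that divides \<open>t\<close> times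
  the monomial of \<open>D\<close>. The disjunction stands for the unknown order of the
  pair.\<close>

definition cover_exchange :: "'v set set \<Rightarrow> bool" where
  "cover_exchange E \<longleftrightarrow> (\<forall>C D. min_cover E C \<longrightarrow> min_cover E D \<longrightarrow> C \<noteq> D \<longrightarrow>
     (\<exists>M t. min_cover E M \<and> t \<in> M \<and>
        (M \<subseteq> insert t D \<and> t \<in> C - D \<or> M \<subseteq> insert t C \<and> t \<in> D - C)))"

lemma in_del_edges: "e \<in> del_edges E U \<longleftrightarrow> e \<in> E \<and> (\<forall>x\<in>e. x \<notin> U)"
  unfolding del_edges_def by auto

lemma in_residual: "e \<in> residual E S \<longleftrightarrow> e \<in> E \<and> (\<forall>x\<in>e. x \<notin> S \<and> x \<notin> nbhd E S)"
  unfolding residual_def in_del_edges by auto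

lemma nbhdI: "{s, y} \<in> E \<Longrightarrow> s \<in> S \<Longrightarrow> y \<in> nbhd E S"
  unfolding nbhd_def by blast

lemma nbhdE: "y \<in> nbhd E S \<Longrightarrow> (\<And>s. s \<in> S \<Longrightarrow> {s, y} \<in> E \<Longrightarrow> P) \<Longrightarrow> P"
  unfolding nbhd_def by blast

lemma min_coverI:
  assumes "\<And>e. e \<in> E \<Longrightarrow> \<exists>x\<in>e. x \<in> C"
    and "\<And>x. x \<in> C \<Longrightarrow> \<exists>e\<in>E. x \<in> e \<and> (\<forall>y\<in>e. y \<in> C \<longrightarrow> y = x)"
  shows "min_cover E C"
  using assms unfolding min_cover_def by simp

lemma min_cover_hit: "min_cover E C \<Longrightarrow> e \<in> E \<Longrightarrow> \<exists>x\<in>e. x \<in> C"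
  unfolding min_cover_def by simp

lemma min_cover_private:
  assumes "min_cover E C" "x \<in> C"
  obtains e where "e \<in> E" "x \<in> e" "\<And>y. y \<in> e \<Longrightarrow> y \<in> C \<Longrightarrow> y = x"
  using assms unfolding min_cover_def by meson

lemma cover_exchangeE:
  assumes "cover_exchange E" "min_cover E C" "min_cover E D" "C \<noteq> D"
  obtains M t where "min_cover E M" "t \<in> M"
    "M \<subseteq> insert t D \<and> t \<in> C - D \<or> M \<subseteq> insert t C \<and> t \<in> D - C"
  using assms unfolding cover_exchange_def by meson

lemma leafyE:
  assumes "leafy E" "\<forall>e\<in>E. \<not> e \<subseteq> S" "residual E S \<noteq> {}"
  obtains u v where "{u, v} \<in> residual E S" "\<And>z. {v, z} \<in> residual E S \<Longrightarrow> z = u"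
  using assms unfolding leafy_def by meson

lemma simple_graph_edge: "simple_graph V E \<Longrightarrow> e \<in> E \<Longrightarrow> \<exists>x y. e = {x, y} \<and> x \<noteq> y \<and> x \<in> V \<and> y \<in> V"
  unfolding simple_graph_def by (metis card_2_iff insert_subset)

lemma simple_graph_no_loop: "simple_graph V E \<Longrightarrow> {x, y} \<in> E \<Longrightarrow> x \<noteq> y"
  unfolding simple_graph_def by fastforce

lemma simple_graph_edge_at:
  assumes "simple_graph V E" "e \<in> E" "x \<in> e"
  obtains y where "e = {x, y}" "y \<noteq> x"
  using simple_graph_edge[OF assms(1,2)] assms(3) by (auto simp: insert_commute)

lemma simple_graph_del_edges: "simple_graph V E \<Longrightarrow> simple_graph (V - U) (del_edges E U)"
  unfolding simple_graph_def del_edges_def by auto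

lemma finite_edges: "simple_graph V E \<Longrightarrow> finite E"
  unfolding simple_graph_def by (meson PowI finite_Pow_iff finite_subset subsetI)

lemma min_cover_antichain:
  assumes "min_cover E C" "min_cover E D" "C \<subseteq> D"
  shows "C = D"
proof
  show "D \<subseteq> C"
  proof
    fix y assume "y \<in> D"
    then obtain e where e: "e \<in> E" "\<And>z. z \<in> e \<Longrightarrow> z \<in> D \<Longrightarrow> z = y"
      using min_cover_private[OF assms(2)] by metis
    obtain z where "z \<in> e" "z \<in> C" using min_cover_hit[OF assms(1) e(1)] by blast
    then show "y \<in> C" using e(2) assms(3) by blast
  qed
qed fact

lemma min_cover_exists:
  assumes "simple_graph V E" and c: "\<And>e. e \<in> E \<Longrightarrow> \<exists>x\<in>e. x \<in> D"
  shows "\<exists>C\<subseteq>D. min_cover E C"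
proof -
  define P where "P C \<longleftrightarrow> C \<subseteq> D \<inter> V \<and> (\<forall>e\<in>E. \<exists>x\<in>e. x \<in> C)" for C
  have "P (D \<inter> V)" using c assms(1) unfolding P_def simple_graph_def by blast
  from arg_min_nat_lemma[of P, OF this, of card] obtain C
    where C: "P C" and least: "\<And>C'. P C' \<Longrightarrow> card C \<le> card C'" by blast
  have "finite C" using C assms(1) finite_subset unfolding P_def simple_graph_def by blast
  have "min_cover E C"
  proof (rule min_coverI)
    show "\<exists>x\<in>e. x \<in> C" if "e \<in> E" for e using C that unfolding P_def by blast
    fix x assume x: "x \<in> C"
    have "\<not> P (C - {x})" using least card_Diff1_less[OF \<open>finite C\<close> x] by (meson not_less)
    then obtain e where "e \<in> E" "\<forall>y\<in>e. y \<notin> C - {x}" using C unfolding P_def by blast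
    moreover then have "x \<in> e" using C unfolding P_def by blast
    ultimately show "\<exists>e\<in>E. x \<in> e \<and> (\<forall>y\<in>e. y \<in> C \<longrightarrow> y = x)" by blast
  qed
  then show ?thesis using C unfolding P_def by blast
qed

text \<open>The minimal covers of \<open>G\<close> that contain a shedding vertex \<open>x\<close> are the \<open>insert x M\<close> with
  \<open>M\<close> a minimal cover of \<open>G \<setminus> x\<close>; those that avoid \<open>x\<close> are the \<open>N(x) \<union> M\<close> with \<open>M\<close> a
  minimal cover of \<open>G \<setminus> N[x]\<close>.\<close>

lemma shedding_min_cover:
  assumes G: "simple_graph V E" and sh: "shedding_vertex V E x"
    and M: "min_cover (del_edges E {x}) M"
  shows "min_cover E (insert x M)"
proof -
  let ?E1 = "del_edges E {x}" and ?S = "V - {x} - M"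
  have G1: "simple_graph (V - {x}) ?E1" using G by (rule simple_graph_del_edges)
  have hit: "\<not> e \<subseteq> ?S" if "e \<in> ?E1" for e using min_cover_hit[OF M that] by blast
  \<comment> \<open>The complement of a minimal cover is maximal independent: adding a vertex of
    \<open>M\<close> completes the private edge of that vertex.\<close>
  have "maximal_independent_set (V - {x}) ?E1 ?S"
    unfolding maximal_independent_set_def independent_set_def
  proof (intro conjI ballI allI impI)
    show "?S \<subseteq> V - {x}" by blast
    show "\<not> e \<subseteq> ?S" if "e \<in> ?E1" for e using that by (rule hit)
    fix T assume T: "(T \<subseteq> V - {x} \<and> (\<forall>e\<in>?E1. \<not> e \<subseteq> T)) \<and> ?S \<subseteq> T"
    have "y \<notin> M" if "y \<in> T" for y
    proof
      assume "y \<in> M"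
      then obtain e where e: "e \<in> ?E1" "\<And>z. z \<in> e \<Longrightarrow> z \<in> M \<Longrightarrow> z = y"
        using min_cover_private[OF M] by metis
      have "e \<subseteq> V - {x}" using G1 e(1) unfolding simple_graph_def by blast
      then have "e \<subseteq> T" using e(2) T that by blast
      then show False using T e(1) by blast
    qed
    then show "T = ?S" using T by blast
  qed
  then have "\<not> independent_set (V - closed_nbhd E x) (del_edges E (closed_nbhd E x)) ?S"
    using sh unfolding shedding_vertex_def by blast
  moreover have "\<not> e \<subseteq> ?S" if "e \<in> del_edges E (closed_nbhd E x)" for e
    using that hit[of e] unfolding in_del_edges closed_nbhd_def by blast
  \<comment> \<open>The complement contains no edge, so it can fail to be independent in G - N[x]
    only by meeting N(x). The edge to such a \<open>z\<close> is a private edge of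
    \<open>x\<close>.\<close>
  ultimately obtain z where z: "{x, z} \<in> E" "z \<notin> M"
    unfolding independent_set_def closed_nbhd_def by blast
  show ?thesis
  proof (rule min_coverI)
    show "\<exists>y\<in>e. y \<in> insert x M" if "e \<in> E" for e
      using that min_cover_hit[OF M, of e] unfolding in_del_edges by blast
    fix y assume y: "y \<in> insert x M"
    show "\<exists>e\<in>E. y \<in> e \<and> (\<forall>z\<in>e. z \<in> insert x M \<longrightarrow> z = y)"
    proof (cases "y = x")
      case True
      then show ?thesis using z by (intro bexI[of _ "{x, z}"]) auto
    next
      case False
      then obtain e where "e \<in> ?E1" "y \<in> e" "\<And>z. z \<in> e \<Longrightarrow> z \<in> M \<Longrightarrow> z = y"
        using min_cover_private[OF M] y by blast
      then show ?thesis unfolding in_del_edges by blast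
    qed
  qed
qed

text \<open>A vertex of N(S) has its edge into \<open>S\<close> as private edge, because
  independence keeps \<open>S\<close> out of the cover. A general \<open>S\<close> is allowed since
  the two covers compared at a residual graph have this form.\<close>

lemma min_cover_Un_nbhd:
  assumes M: "min_cover (residual E S) M" and S: "\<forall>e\<in>E. \<not> e \<subseteq> S" and G: "simple_graph V E"
  shows "min_cover E (nbhd E S \<union> M)" and "S \<inter> (nbhd E S \<union> M) = {}"
proof -
  have MS: "y \<notin> S \<and> y \<notin> nbhd E S" if "y \<in> M" for y
    using min_cover_private[OF M that] unfolding in_residual by metis
  have NS: "y \<notin> S" if "y \<in> nbhd E S" for y
  proof -
    obtain s where "s \<in> S" "{s, y} \<in> E" using \<open>y \<in> nbhd E S\<close> by (rule nbhdE)
    then show ?thesis using bspec[OF S, of "{s, y}"] by simp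
  qed
  show disj: "S \<inter> (nbhd E S \<union> M) = {}" using MS NS by blast
  show "min_cover E (nbhd E S \<union> M)"
  proof (rule min_coverI)
    fix e assume e: "e \<in> E"
    show "\<exists>x\<in>e. x \<in> nbhd E S \<union> M"
    proof (cases "e \<in> residual E S")
      case True
      then show ?thesis using min_cover_hit[OF M] by blast
    next
      case False
      then obtain x where x: "x \<in> e" "x \<in> S \<or> x \<in> nbhd E S" using e unfolding in_residual by blast
      obtain y where "e = {x, y}" using simple_graph_edge_at[OF G e x(1)] by metis
      then show ?thesis using x e nbhdI[of x y E S] by blast
    qed
  next
    fix y assume y: "y \<in> nbhd E S \<union> M"
    show "\<exists>e\<in>E. y \<in> e \<and> (\<forall>z\<in>e. z \<in> nbhd E S \<union> M \<longrightarrow> z = y)"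
    proof (cases "y \<in> M")
      case True
      then obtain e where "e \<in> residual E S" "y \<in> e" "\<And>z. z \<in> e \<Longrightarrow> z \<in> M \<Longrightarrow> z = y"
        using min_cover_private[OF M] by metis
      then show ?thesis unfolding in_residual by blast
    next
      case False
      then obtain s where "s \<in> S" "{s, y} \<in> E" using y by (blast elim: nbhdE)
      then show ?thesis using disj by (intro bexI[of _ "{s, y}"]) auto
    qed
  qed
qed

lemma min_cover_Diff_nbhd:
  assumes C: "min_cover E C" and G: "simple_graph V E" and xC: "x \<notin> C"
  shows "min_cover (residual E {x}) (C - nbhd E {x})" and "nbhd E {x} \<subseteq> C"
proof -
  show sub: "nbhd E {x} \<subseteq> C"
  proof
    fix y assume "y \<in> nbhd E {x}"
    then have "{x, y} \<in> E" by (auto elim: nbhdE)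
    then show "y \<in> C" using min_cover_hit[OF C] xC by blast
  qed
  show "min_cover (residual E {x}) (C - nbhd E {x})"
  proof (rule min_coverI)
    show "\<exists>y\<in>e. y \<in> C - nbhd E {x}" if "e \<in> residual E {x}" for e
      using that min_cover_hit[OF C, of e] unfolding in_residual by blast
    fix y assume y: "y \<in> C - nbhd E {x}"
    then obtain e where e: "e \<in> E" "y \<in> e" "\<And>z. z \<in> e \<Longrightarrow> z \<in> C \<Longrightarrow> z = y"
      using min_cover_private[OF C] by blast
    have "x \<notin> e"
    proof
      assume "x \<in> e"
      then obtain z where "e = {x, z}" using simple_graph_edge_at[OF G e(1)] by metis
      then have "e = {x, y}" using e(2) y xC by blast
      then show False using e(1) y nbhdI by fast
    qed
    then have "e \<in> residual E {x}" using e y sub unfolding in_residual by blast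
    then show "\<exists>e\<in>residual E {x}. y \<in> e \<and> (\<forall>z\<in>e. z \<in> C - nbhd E {x} \<longrightarrow> z = y)" using e by blast
  qed
qed

lemma min_cover_del_edges:
  assumes C: "min_cover E C" and xC: "x \<in> C"
  shows "min_cover (del_edges E {x}) (C - {x})"
proof (rule min_coverI)
  show "\<exists>y\<in>e. y \<in> C - {x}" if "e \<in> del_edges E {x}" for e
    using that min_cover_hit[OF C, of e] unfolding in_del_edges by blast
  fix y assume y: "y \<in> C - {x}"
  then obtain e where e: "e \<in> E" "y \<in> e" "\<And>z. z \<in> e \<Longrightarrow> z \<in> C \<Longrightarrow> z = y"
    using min_cover_private[OF C] by blast
  then have "x \<notin> e" using xC y by blast
  then have "e \<in> del_edges E {x}" using e(1) unfolding in_del_edges by blast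
  then show "\<exists>e\<in>del_edges E {x}. y \<in> e \<and> (\<forall>z\<in>e. z \<in> C - {x} \<longrightarrow> z = y)"
    using e by blast
qed

lemma closed_nbhd_residual: "del_edges E (closed_nbhd E x) = residual E {x}"
  unfolding residual_def closed_nbhd_def nbhd_def by simp

text \<open>Implicitly, covers containing the shedding vertex \<open>x\<close> come first. Pairs
  that agree on \<open>x\<close> are handled by induction in G - x or G - N[x]. For a mixed pair the
  exchange happens at \<open>t = x\<close>: the cover avoiding \<open>x\<close> contains a minimal
  cover of G - x, which becomes a minimal cover of G once \<open>x\<close> is inserted.\<close>

lemma vertex_decomposable_cover_exchange:
  assumes "vertex_decomposable V E" and "simple_graph V E"
  shows "cover_exchange E"
  using assms
proof induction
  case (no_edges V)
  then show ?case unfolding cover_exchange_def min_cover_def by auto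
next
  case (shedding V E x)
  let ?E1 = "del_edges E {x}"
  note G = \<open>simple_graph V E\<close>
  note G1 = simple_graph_del_edges[OF G, of "{x}"]
  have Y1: "cover_exchange ?E1" using shedding.IH(1) G1 by blast
  have Y2: "cover_exchange (residual E {x})"
    using shedding.IH(2) simple_graph_del_edges[OF G, of "closed_nbhd E x"]
    unfolding closed_nbhd_residual by blast
  have loop: "\<forall>e\<in>E. \<not> e \<subseteq> {x}"
    using simple_graph_edge[OF G] by fastforce
  note ins = shedding_min_cover[OF G shedding.hyps(1)]
  have mixed: "\<exists>M t. min_cover E M \<and> t \<in> M \<and> M \<subseteq> insert t D \<and> t \<in> C - D"
    if CD: "min_cover E C" "min_cover E D" "x \<in> C" "x \<notin> D" for C D
  proof -
    have "\<exists>y\<in>e. y \<in> D" if "e \<in> ?E1" for e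
      using that min_cover_hit[OF CD(2), of e] unfolding in_del_edges by blast
    then obtain M where "M \<subseteq> D" "min_cover ?E1 M" using min_cover_exists[OF G1] by metis
    then show ?thesis using ins[of M] CD by blast
  qed
  show ?case unfolding cover_exchange_def
  proof (intro allI impI)
    fix C D assume C: "min_cover E C" and D: "min_cover E D" and ne: "C \<noteq> D"
    consider "x \<in> C" "x \<in> D" | "x \<notin> C" "x \<notin> D" | "x \<in> C" "x \<notin> D" | "x \<notin> C" "x \<in> D" by blast
    then show "\<exists>M t. min_cover E M \<and> t \<in> M \<and>
        (M \<subseteq> insert t D \<and> t \<in> C - D \<or> M \<subseteq> insert t C \<and> t \<in> D - C)"
    proof cases
      case 1
      note C1 = min_cover_del_edges[OF C 1(1)] and D1 = min_cover_del_edges[OF D 1(2)]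
      have "C - {x} \<noteq> D - {x}" using 1 ne by blast
      then obtain M t where M: "min_cover ?E1 M" "t \<in> M"
        "M \<subseteq> insert t (D - {x}) \<and> t \<in> C - {x} - (D - {x}) \<or>
         M \<subseteq> insert t (C - {x}) \<and> t \<in> D - {x} - (C - {x})"
        by (rule cover_exchangeE[OF Y1 C1 D1])
      show ?thesis using ins[OF M(1)] M(2,3) 1
        by (intro exI[of _ "insert x M"] exI[of _ t]) auto
    next
      case 2
      note C2 = min_cover_Diff_nbhd[OF C G 2(1)] and D2 = min_cover_Diff_nbhd[OF D G 2(2)]
      have "C - nbhd E {x} \<noteq> D - nbhd E {x}" using C2(2) D2(2) ne by blast
      then obtain M t where M: "min_cover (residual E {x}) M" "t \<in> M"
        "M \<subseteq> insert t (D - nbhd E {x}) \<and> t \<in> C - nbhd E {x} - (D - nbhd E {x}) \<or>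
         M \<subseteq> insert t (C - nbhd E {x}) \<and> t \<in> D - nbhd E {x} - (C - nbhd E {x})"
        by (rule cover_exchangeE[OF Y2 C2(1) D2(1)])
      show ?thesis using min_cover_Un_nbhd(1)[OF M(1) loop G] M(2,3) C2(2) D2(2)
        by (intro exI[of _ "nbhd E {x} \<union> M"] exI[of _ t]) auto
    next
      case 3
      then show ?thesis using mixed[OF C D] by blast
    next
      case 4
      then show ?thesis using mixed[OF D C] by blast
    qed
  qed
qed

section \<open>Bipartite graphs: an exchange between opposite covers exposes a leaf\<close>

locale bipartite_graph =
  fixes E :: "'v set set" and A B V :: "'v set"
  assumes simple: "simple_graph V E"
    and V_eq: "V = A \<union> B" and disj: "A \<inter> B = {}"
    and edge: "e \<in> E \<Longrightarrow> \<exists>a\<in>A. \<exists>b\<in>B. e = {a, b}"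
begin

text \<open>Lets every statement that singles out \<open>A\<close> be reused for \<open>B\<close>,
  through the interpretation \<open>sw\<close>.\<close>

lemma swap: "bipartite_graph E B A V"
  using simple V_eq disj edge by unfold_locales (auto simp: insert_commute, metis insert_commute)

lemma edge_AB: "{a, y} \<in> E \<Longrightarrow> a \<in> A \<Longrightarrow> y \<in> B"
  using edge[of "{a, y}"] disj by (auto simp: doubleton_eq_iff)

lemma edge_BA: "{b, y} \<in> E \<Longrightarrow> b \<in> B \<Longrightarrow> y \<in> A"
  using edge[of "{b, y}"] disj by (auto simp: doubleton_eq_iff)

lemma residual_edge: "e \<in> residual E S \<Longrightarrow> \<exists>a\<in>A. \<exists>b\<in>B. e = {a, b}"
  using edge unfolding in_residual by blast

text \<open>This is A' of the overview; \<open>sw.side S\<close> is B'.\<close>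

definition side :: "'v set \<Rightarrow> 'v set" where
  "side S = {a\<in>A. \<exists>b. {a, b} \<in> residual E S}"

lemma min_cover_side: "min_cover (residual E S) (side S)"
proof (rule min_coverI)
  show "\<exists>x\<in>e. x \<in> side S" if "e \<in> residual E S" for e
    using that residual_edge[OF that] unfolding side_def by blast
  fix a assume "a \<in> side S"
  then obtain b where ab: "a \<in> A" "{a, b} \<in> residual E S" unfolding side_def by blast
  then have "b \<in> B" using edge_AB unfolding in_residual by blast
  then show "\<exists>e\<in>residual E S. a \<in> e \<and> (\<forall>y\<in>e. y \<in> side S \<longrightarrow> y = a)"
    using ab disj unfolding side_def by (intro bexI[of _ "{a, b}"]) auto
qed

lemma side_disj: "a \<in> side S \<Longrightarrow> a \<notin> S \<and> a \<notin> nbhd E S \<and> a \<notin> B"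
  using disj unfolding side_def in_residual by auto

end

context bipartite_graph
begin

interpretation sw: bipartite_graph E B A V by (rule swap)

text \<open>\<open>M\<close> avoids \<open>S\<close>, hence keeps all of N(S); being a minimal cover
  different from N(S) \<union> B', it cannot contain that cover, so it drops some \<open>b\<close>
  of B'. All residual neighbours of \<open>b\<close> must then lie in \<open>M\<close>, and outside
  N(S) the only vertex of \<open>M\<close> in \<open>A\<close> is \<open>t\<close>.\<close>

lemma residual_leaf_if_exchange:
  assumes S: "\<forall>e\<in>E. \<not> e \<subseteq> S" and t: "t \<in> side S"
    and M: "min_cover E M" "t \<in> M" "M \<subseteq> insert t (nbhd E S \<union> sw.side S)"
  shows "\<exists>u v. {u, v} \<in> residual E S \<and> (\<forall>z. {v, z} \<in> residual E S \<longrightarrow> z = u)"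
proof -
  have D: "min_cover E (nbhd E S \<union> sw.side S)" "S \<inter> (nbhd E S \<union> sw.side S) = {}"
    using min_cover_Un_nbhd[OF sw.min_cover_side S simple] by blast+
  have tD: "t \<notin> S" "t \<notin> nbhd E S" "t \<notin> sw.side S" using side_disj[OF t] t disj
    unfolding sw.side_def by auto
  have NM: "nbhd E S \<subseteq> M"
  proof
    fix y assume "y \<in> nbhd E S"
    then obtain s where s: "s \<in> S" "{s, y} \<in> E" by (rule nbhdE)
    then have "s \<notin> M" using M(3) D(2) tD by blast
    then show "y \<in> M" using min_cover_hit[OF M(1) s(2)] by blast
  qed
  have "\<not> nbhd E S \<union> sw.side S \<subseteq> M" using min_cover_antichain[OF D(1) M(1)] tD M(2) by blast
  then obtain b where b: "b \<in> sw.side S" "b \<notin> M" using NM by blast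
  then obtain a where a: "b \<in> B" "{b, a} \<in> residual E S" unfolding sw.side_def by blast
  have "z = t" if "{b, z} \<in> residual E S" for z
  proof -
    have z: "{b, z} \<in> E" "z \<notin> nbhd E S" using that unfolding in_residual by auto
    then have "z \<in> M" using b(2) min_cover_hit[OF M(1)] by blast
    moreover have "z \<in> A" using edge_BA z(1) a(1) .
    ultimately show ?thesis using z M(3) disj unfolding sw.side_def by blast
  qed
  then show ?thesis using a(2) insert_commute by metis
qed

end

context bipartite_graph
begin

interpretation sw: bipartite_graph E B A V by (rule swap)

lemma cover_exchange_leafy:
  assumes Y: "cover_exchange E"
  shows "leafy E"
  unfolding leafy_def
proof (intro allI impI)
  fix S assume S: "\<forall>e\<in>E. \<not> e \<subseteq> S" and ne: "residual E S \<noteq> {}"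
  have C: "min_cover E (nbhd E S \<union> side S)" using min_cover_Un_nbhd[OF min_cover_side S simple] by blast
  have D: "min_cover E (nbhd E S \<union> sw.side S)"
    using min_cover_Un_nbhd[OF sw.min_cover_side S simple] by blast
  obtain a b where ab: "{a, b} \<in> residual E S" "a \<in> A" using ne residual_edge by blast
  then have "a \<in> side S" unfolding side_def by blast
  then have "a \<notin> nbhd E S \<union> sw.side S" "a \<in> nbhd E S \<union> side S"
    using side_disj[of a S] unfolding sw.side_def by auto
  then have "nbhd E S \<union> side S \<noteq> nbhd E S \<union> sw.side S" by metis
  then obtain M t where M: "min_cover E M" "t \<in> M"
    and cases: "M \<subseteq> insert t (nbhd E S \<union> sw.side S) \<and> t \<in> nbhd E S \<union> side S - (nbhd E S \<union> sw.side S) \<or>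
      M \<subseteq> insert t (nbhd E S \<union> side S) \<and> t \<in> nbhd E S \<union> sw.side S - (nbhd E S \<union> side S)"
    by (rule cover_exchangeE[OF Y C D])
  from cases show "\<exists>u v. {u, v} \<in> residual E S \<and> (\<forall>z. {v, z} \<in> residual E S \<longrightarrow> z = u)"
  proof
    assume "M \<subseteq> insert t (nbhd E S \<union> sw.side S) \<and> t \<in> nbhd E S \<union> side S - (nbhd E S \<union> sw.side S)"
    then show ?thesis using residual_leaf_if_exchange[OF S _ M] by blast
  next
    assume "M \<subseteq> insert t (nbhd E S \<union> side S) \<and> t \<in> nbhd E S \<union> sw.side S - (nbhd E S \<union> side S)"
    then show ?thesis using sw.residual_leaf_if_exchange[OF S _ M] by blast
  qed
qed

end

text \<open>Members of \<open>S\<close> inside N[y] are no longer incident with any edge of the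
  first residual graph, so discarding them changes nothing. They have to be discarded, because a
  neighbour of \<open>y\<close> would spoil the independence of the combined set.\<close>

lemma residual_residual:
  "residual (residual E {y}) S = residual E (insert y (S - ({y} \<union> nbhd E {y})))"
proof -
  let ?T = "S - ({y} \<union> nbhd E {y})"
  have nb: "z \<in> nbhd (residual E {y}) S \<longleftrightarrow> z \<in> nbhd E ?T" if "z \<noteq> y" "z \<notin> nbhd E {y}" for z
    using that unfolding nbhd_def in_residual by auto
  have ins: "z \<in> nbhd E (insert y ?T) \<longleftrightarrow> z \<in> nbhd E {y} \<or> z \<in> nbhd E ?T" for z
    unfolding nbhd_def by auto
  have "z \<notin> {y} \<and> z \<notin> nbhd E {y} \<and> z \<notin> S \<and> z \<notin> nbhd (residual E {y}) S \<longleftrightarrow>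
      z \<notin> insert y ?T \<and> z \<notin> nbhd E (insert y ?T)" for z
    using nb ins by blast
  then have "e \<in> residual (residual E {y}) S \<longleftrightarrow> e \<in> residual E (insert y ?T)" for e
    unfolding in_residual by meson
  then show ?thesis by blast
qed

lemma leafy_residual:
  assumes L: "leafy E" and G: "simple_graph V E"
  shows "leafy (residual E {y})"
  unfolding leafy_def residual_residual
proof (intro allI impI)
  fix S
  let ?T = "insert y (S - ({y} \<union> nbhd E {y}))"
  assume S: "\<forall>e\<in>residual E {y}. \<not> e \<subseteq> S" and ne: "residual E ?T \<noteq> {}"
  have "\<not> e \<subseteq> ?T" if e: "e \<in> E" for e
  proof
    assume sub: "e \<subseteq> ?T"
    show False
    proof (cases "y \<in> e")
      case True
      then obtain z where "e = {y, z}" "z \<noteq> y" using simple_graph_edge_at[OF G e] by metis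
      then show False using sub e nbhdI[of y z E "{y}"] by auto
    next
      case False
      then have "e \<in> residual E {y}" using e sub unfolding in_residual by blast
      then show False using S sub False by blast
    qed
  qed
  then have "\<forall>e\<in>E. \<not> e \<subseteq> ?T" by blast
  from leafyE[OF L this ne]
  show "\<exists>u v. {u, v} \<in> residual E ?T \<and> (\<forall>z. {v, z} \<in> residual E ?T \<longrightarrow> z = u)"
    by metis
qed

text \<open>The neighbour \<open>u\<close> of a leaf \<open>v\<close> is shedding: an independent
  set of G - N[u] misses \<open>v\<close>, yet \<open>v\<close> is isolated in G - u and could
  always be added. Both smaller graphs have the edge set of some G - N[y], so heredity of
  \<open>leafy\<close> feeds the induction.\<close>

lemma leafy_vertex_decomposable:
  assumes "leafy E" and "simple_graph V E"
  shows "vertex_decomposable V E"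
  using assms
proof (induction "card E" arbitrary: V E rule: less_induct)
  case less
  note G = \<open>simple_graph V E\<close>
  show ?case
  proof (cases "E = {}")
    case True
    then show ?thesis by (simp add: vertex_decomposable.no_edges)
  next
    case False
    have r0: "residual E {} = E" unfolding residual_def del_edges_def nbhd_def by auto
    have "\<forall>e\<in>E. \<not> e \<subseteq> {}" using simple_graph_edge[OF G] by fastforce
    then obtain u v where uv: "{u, v} \<in> E" and leaf: "\<And>z. {v, z} \<in> E \<Longrightarrow> z = u"
      using leafyE[OF less.prems(1), of "{}"] False unfolding r0 by metis
    have neq: "u \<noteq> v" using G uv by (rule simple_graph_no_loop)
    have inV: "u \<in> V" "v \<in> V" using G uv unfolding simple_graph_def by auto
    have v_iso: "v \<notin> e" if "e \<in> del_edges E {u}" for e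
    proof
      assume "v \<in> e"
      have e: "e \<in> E" "u \<notin> e" using that unfolding del_edges_def by auto
      obtain z where "e = {v, z}" using simple_graph_edge_at[OF G e(1) \<open>v \<in> e\<close>] by metis
      then show False using e leaf by blast
    qed
    \<comment> \<open>As N(v) = {u}, deleting \<open>u\<close> and deleting N[v] differ only in the
      isolated vertex \<open>v\<close>; the induction therefore measures edges and leaves the vertex
      set arbitrary.\<close>
    have E1: "del_edges E {u} = residual E {v}"
    proof -
      have "nbhd E {v} = {u}" using leaf uv unfolding nbhd_def by (auto simp: insert_commute)
      then show ?thesis using v_iso unfolding residual_def del_edges_def by auto
    qed
    have smaller: "card (residual E {x}) < card E" if "x \<in> {u, v}" for x
    proof (rule psubset_card_mono)
      show "finite E" using G by (rule finite_edges)
      show "residual E {x} \<subset> E" using that uv unfolding residual_def del_edges_def by auto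
    qed
    show ?thesis
    proof (rule vertex_decomposable.shedding)
      show "shedding_vertex V E u"
        unfolding shedding_vertex_def
      proof (intro conjI notI)
        show "u \<in> V" by fact
        assume "\<exists>S. independent_set (V - closed_nbhd E u) (del_edges E (closed_nbhd E u)) S \<and>
            maximal_independent_set (V - {u}) (del_edges E {u}) S"
        then obtain S where S: "S \<subseteq> V - closed_nbhd E u"
          and mx: "maximal_independent_set (V - {u}) (del_edges E {u}) S"
          unfolding independent_set_def by blast
        have "v \<notin> S" using S uv unfolding closed_nbhd_def by auto
        moreover have "independent_set (V - {u}) (del_edges E {u}) (insert v S)"
        proof -
          have ind: "S \<subseteq> V - {u}" "\<forall>e\<in>del_edges E {u}. \<not> e \<subseteq> S"
            using mx unfolding maximal_independent_set_def independent_set_def by simp_all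
          have "\<not> e \<subseteq> insert v S" if "e \<in> del_edges E {u}" for e
            using v_iso[OF that] bspec[OF ind(2) that] by (simp add: subset_insert)
          then show ?thesis using ind(1) inV neq unfolding independent_set_def by simp
        qed
        ultimately show False using mx unfolding maximal_independent_set_def by blast
      qed
      show "vertex_decomposable (V - {u}) (del_edges E {u})"
        using less.hyps[of "residual E {v}" "V - {u}"] smaller[of v] leafy_residual[OF less.prems(1) G]
          simple_graph_del_edges[OF G, of "{u}"] unfolding E1 by blast
      show "vertex_decomposable (V - closed_nbhd E u) (del_edges E (closed_nbhd E u))"
        using less.hyps[of "residual E {u}" "V - closed_nbhd E u"] smaller[of u]
          leafy_residual[OF less.prems(1) G] simple_graph_del_edges[OF G, of "closed_nbhd E u"]
        unfolding closed_nbhd_residual by blast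
    qed
  qed
qed


section \<open>Linear quotient orders on sets of covers\<close>

text \<open>Linear quotients on exponent vectors: the generator of the colon ideal contributed by an
  earlier \<open>w\<close> is divisible by a variable \<open>t\<close>, and \<open>t\<close> itself
  lies in the colon ideal because the earlier monomial \<open>w'\<close> divides \<open>t\<close>
  times the current one. The vectors need not form an antichain.\<close>

definition lq_order :: "('v \<Rightarrow> nat) list \<Rightarrow> bool" where
  "lq_order ws \<longleftrightarrow> (\<forall>i<length ws. \<forall>w\<in>set (take i ws). \<exists>w'\<in>set (take i ws). \<exists>t.
     (ws ! i) t < w t \<and> w' \<le> (ws ! i)(t := Suc ((ws ! i) t)))"

definition lq_set :: "('v \<Rightarrow> nat) set \<Rightarrow> bool" where
  "lq_set S \<longleftrightarrow> (\<exists>ws. distinct ws \<and> set ws = S \<and> lq_order ws)"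

lemma lq_append:
  assumes "lq_order xs" "lq_order ys"
    and "\<And>x y. x \<in> set xs \<Longrightarrow> y \<in> set ys \<Longrightarrow> \<exists>x'\<in>set xs. \<exists>t. y t < x t \<and> x' \<le> y(t := Suc (y t))"
  shows "lq_order (xs @ ys)"
  unfolding lq_order_def
proof (intro allI impI ballI)
  fix i w assume i: "i < length (xs @ ys)" and w: "w \<in> set (take i (xs @ ys))"
  let ?z = "(xs @ ys) ! i"
  show "\<exists>w'\<in>set (take i (xs @ ys)). \<exists>t. ?z t < w t \<and> w' \<le> ?z(t := Suc (?z t))"
  proof (cases "i < length xs")
    case True
    then show ?thesis using assms(1) w unfolding lq_order_def by (simp add: nth_append)
  next
    case False
    define j where "j = i - length xs"
    have j: "j < length ys" "?z = ys ! j" "take i (xs @ ys) = xs @ take j ys"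
      using False i unfolding j_def by (auto simp: nth_append)
    show ?thesis
    proof (cases "w \<in> set xs")
      case True
      then show ?thesis using assms(3)[OF True, of "ys ! j"] j by (auto simp del: fun_upd_apply)
    next
      case False
      then have "w \<in> set (take j ys)" using w by (simp add: j(3) del: take_append)
      then show ?thesis using assms(2) j unfolding lq_order_def by (metis UnCI set_append)
    qed
  qed
qed

text \<open>The part satisfying \<open>P\<close> is listed first, so a recursion needs a single
  exchange argument per split, always from the first part into the second.\<close>

lemma lq_set_split:
  assumes "lq_set {w \<in> S. P w}" "lq_set {w \<in> S. \<not> P w}"
    and "\<And>x y. x \<in> S \<Longrightarrow> P x \<Longrightarrow> y \<in> S \<Longrightarrow> \<not> P y \<Longrightarrow>
      \<exists>x'\<in>S. P x' \<and> (\<exists>t. y t < x t \<and> x' \<le> y(t := Suc (y t)))"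
  shows "lq_set S"
proof -
  obtain xs where xs: "distinct xs" "set xs = {w \<in> S. P w}" "lq_order xs"
    using assms(1) unfolding lq_set_def by blast
  obtain ys where ys: "distinct ys" "set ys = {w \<in> S. \<not> P w}" "lq_order ys"
    using assms(2) unfolding lq_set_def by blast
  have "lq_order (xs @ ys)"
  proof (rule lq_append[OF xs(3) ys(3)])
    fix x y assume "x \<in> set xs" "y \<in> set ys"
    then show "\<exists>x'\<in>set xs. \<exists>t. y t < x t \<and> x' \<le> y(t := Suc (y t))"
      using assms(3)[of x y] unfolding xs(2) ys(2) by blast
  qed
  moreover have "distinct (xs @ ys)" "set (xs @ ys) = S" using xs ys by auto
  ultimately show ?thesis unfolding lq_set_def by blast
qed

lemma lq_set_subsingleton:
  assumes "S \<subseteq> {m}"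
  shows "lq_set S"
proof -
  have "lq_order []" "lq_order [m]" unfolding lq_order_def by auto
  then have "lq_set {}" "lq_set {m}" unfolding lq_set_def
    by (metis distinct.simps(1) empty_set, metis distinct_singleton empty_set list.simps(15))
  then show ?thesis using assms by (metis subset_singletonD)
qed

lemma sum_upd_Suc: "sum (w(u := Suc (w u))) UNIV = Suc (sum w UNIV)" for w :: "'v::finite \<Rightarrow> nat"
proof -
  have "sum (w(u := Suc (w u))) (UNIV - {u}) = sum w (UNIV - {u})" by (intro sum.cong) auto
  then show ?thesis by (simp add: sum.remove[of UNIV u])
qed

lemma sum_transfer:
  fixes w :: "'v::finite \<Rightarrow> nat"
  assumes "u \<noteq> v" "0 < w v"
  shows "sum (w(u := Suc (w u), v := w v - 1)) UNIV = sum w UNIV"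
proof -
  let ?w = "w(v := w v - 1)"
  have "w(u := Suc (w u), v := w v - 1) = ?w(u := Suc (?w u))" "w = ?w(v := Suc (?w v))"
    using assms by auto
  then show ?thesis using sum_upd_Suc[of ?w u] sum_upd_Suc[of ?w v] by metis
qed

text \<open>Up to the factor with exponent \<open>m\<close>, these are the monomials of a power of
  the ideal generated by the variables outside \<open>F\<close>. This is where the recursion on a
  degree component of \<open>k\<close>-covers ends.\<close>

lemma lq_box:
  fixes m :: "'v::finite \<Rightarrow> nat"
  shows "lq_set {w. sum w UNIV = l \<and> m \<le> w \<and> (\<forall>z\<in>F. w z = m z)}"
\<comment> \<open>\<open>Suc l\<close> instead of \<open>l\<close> makes the measure drop also when
  \<open>m\<close> already has degree \<open>l\<close> and is raised once more.\<close>
proof (induction "Suc l - sum m UNIV + card (- F)" arbitrary: m F rule: less_induct)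
  case less
  let ?S = "\<lambda>m F. {w. sum w UNIV = l \<and> m \<le> w \<and> (\<forall>z\<in>F. w z = m z)}"
  show ?case
  proof (cases "l < sum m UNIV \<or> F = UNIV")
    case True
    have "?S m F \<subseteq> {m}"
    proof
      fix w assume w: "w \<in> ?S m F"
      then have "sum m UNIV \<le> sum w UNIV" by (intro sum_mono) (simp add: le_fun_def)
      then show "w \<in> {m}" using w True by auto
    qed
    then show ?thesis by (rule lq_set_subsingleton)
  next
    case False
    then obtain u where u: "u \<notin> F" by blast
    show ?thesis
    proof (rule lq_set_split[where P = "\<lambda>w. m u < w u"])
      have "{w \<in> ?S m F. m u < w u} = ?S (m(u := Suc (m u))) F"
        using u by (auto simp: le_fun_def intro: less_imp_le)
      moreover have "lq_set (?S (m(u := Suc (m u))) F)"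
      proof (rule less.hyps)
        show "Suc l - sum (m(u := Suc (m u))) UNIV + card (- F) < Suc l - sum m UNIV + card (- F)"
          using False unfolding sum_upd_Suc by linarith
      qed
      ultimately show "lq_set {w \<in> ?S m F. m u < w u}" by simp
    next
      have "{w \<in> ?S m F. \<not> m u < w u} = ?S m (insert u F)"
        by (auto simp: le_fun_def intro: antisym)
      moreover have "card (- insert u F) < card (- F)" using u by (intro psubset_card_mono) auto
      then have "lq_set (?S m (insert u F))" by (intro less.hyps) simp
      ultimately show "lq_set {w \<in> ?S m F. \<not> m u < w u}" by simp
    next
      fix x y assume x: "x \<in> ?S m F" "m u < x u" and y: "y \<in> ?S m F" "\<not> m u < y u"
      \<comment> \<open>Equal degrees and a larger value of \<open>x\<close> at \<open>u\<close>
        force a smaller value at some \<open>j\<close>; moving one unit of \<open>y\<close> from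
        \<open>j\<close> to \<open>u\<close> stays in the box.\<close>
      have "\<exists>j. x j < y j"
      proof (rule ccontr)
        assume "\<not> ?thesis"
        then have "sum y UNIV < sum x UNIV"
          using x y by (intro sum_strict_mono_ex1) (auto simp: not_less intro: le_less_trans)
        then show False using x y by simp
      qed
      then obtain j where j: "x j < y j" by blast
      let ?z = "y(u := Suc (y u), j := y j - 1)"
      have yu: "y u = m u" using y by (auto simp: le_fun_def not_less intro: antisym)
      have ju: "u \<noteq> j" using j x(2) yu by auto
      have mx: "m j \<le> x j" "\<And>z. m z \<le> y z" using x y by (auto simp: le_fun_def)
      have "j \<notin> F" using j x y by auto
      then have "?z \<in> ?S m F"
        using y u ju j mx sum_transfer[OF ju, of y] by (auto simp: le_fun_def le_SucI)
      moreover have "m u < ?z u" using ju yu by simp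
      moreover have "?z \<le> y(u := Suc (y u))" by (auto simp: le_fun_def)
      moreover have "y u < x u" using yu x by simp
      ultimately show "\<exists>x'\<in>?S m F. m u < x' u \<and> (\<exists>t. y t < x t \<and> x' \<le> y(t := Suc (y t)))" by blast
    qed
  qed
qed

section \<open>k-covers and the lower bounds forced by upper bounds\<close>

definition kcover :: "'v set set \<Rightarrow> nat \<Rightarrow> ('v \<Rightarrow> nat) \<Rightarrow> bool" where
  "kcover E k w \<longleftrightarrow> (\<forall>x y. {x, y} \<in> E \<longrightarrow> k \<le> w x + w y)"

definition min_kcover :: "'v set set \<Rightarrow> nat \<Rightarrow> ('v \<Rightarrow> nat) \<Rightarrow> bool" where
  "min_kcover E k w \<longleftrightarrow> kcover E k w \<and> (\<forall>w'. kcover E k w' \<longrightarrow> w' \<le> w \<longrightarrow> w' = w)"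

lemma kcoverD: "kcover E k w \<Longrightarrow> {x, y} \<in> E \<Longrightarrow> k \<le> w x + w y"
  unfolding kcover_def by blast

lemma kcover_mono: "kcover E k w \<Longrightarrow> w \<le> w' \<Longrightarrow> kcover E k w'"
  unfolding kcover_def le_fun_def by (meson add_mono le_trans)

lemma min_kcover_exists:
  fixes w :: "'v::finite \<Rightarrow> nat"
  assumes "kcover E k w"
  shows "\<exists>f. min_kcover E k f \<and> f \<le> w"
proof -
  define P where "P f \<longleftrightarrow> kcover E k f \<and> f \<le> w" for f
  have "P w" using assms unfolding P_def by simp
  from arg_min_nat_lemma[of P, OF this, of "\<lambda>f. sum f UNIV"] obtain f
    where f: "P f" and least: "\<And>g. P g \<Longrightarrow> sum f UNIV \<le> sum g UNIV" by blast
  have "min_kcover E k f"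
    unfolding min_kcover_def
  proof (intro conjI allI impI)
    show "kcover E k f" using f unfolding P_def by blast
    fix g assume g: "kcover E k g" "g \<le> f"
    then have "P g" using f unfolding P_def by (metis order_trans)
    then have "sum f UNIV \<le> sum g UNIV" by (rule least)
    show "g = f"
    proof (rule ccontr)
      assume "g \<noteq> f"
      then obtain z where "g z \<noteq> f z" by blast
      then have "g z < f z" using g(2) by (simp add: le_fun_def order.not_eq_order_implies_strict)
      then have "sum g UNIV < sum f UNIV"
        using g(2) by (intro sum_strict_mono_ex1) (auto simp: le_fun_def)
      then show False using \<open>sum f UNIV \<le> sum g UNIV\<close> by simp
    qed
  qed
  then show ?thesis using f unfolding P_def by blast
qed

text \<open>The bound \<open>w \<le> c\<close> forces \<open>lower E k c \<le> w\<close> on every \<open>k\<close>-cover \<open>w\<close>.\<close>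

definition lower :: "'v set set \<Rightarrow> nat \<Rightarrow> ('v \<Rightarrow> nat) \<Rightarrow> 'v \<Rightarrow> nat" where
  "lower E k c z = (LEAST n. \<forall>y. {z, y} \<in> E \<longrightarrow> k \<le> c y + n)"

lemma lower_le_iff: "lower E k c z \<le> n \<longleftrightarrow> (\<forall>y. {z, y} \<in> E \<longrightarrow> k \<le> c y + n)"
proof
  have "\<forall>y. {z, y} \<in> E \<longrightarrow> k \<le> c y + k" by simp
  then have "\<forall>y. {z, y} \<in> E \<longrightarrow> k \<le> c y + lower E k c z"
    unfolding lower_def by (rule LeastI)
  then show "\<forall>y. {z, y} \<in> E \<longrightarrow> k \<le> c y + n" if "lower E k c z \<le> n"
    using that by (meson add_left_mono le_trans)
  show "lower E k c z \<le> n" if "\<forall>y. {z, y} \<in> E \<longrightarrow> k \<le> c y + n"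
    unfolding lower_def using that by (rule Least_le)
qed

lemma lower_edge: "{z, y} \<in> E \<Longrightarrow> k \<le> c y + lower E k c z"
  using lower_le_iff[of E k c z "lower E k c z"] by blast

lemma lower_le_kcover: "kcover E k w \<Longrightarrow> w \<le> c \<Longrightarrow> lower E k c z \<le> w z"
  unfolding lower_le_iff by (metis add.commute add_right_mono kcoverD le_fun_def le_trans)

lemma lower_upd:
  assumes "b \<le> c v"
  shows "lower E k (c(v := b)) z = (if {z, v} \<in> E then max (lower E k c z) (k - b) else lower E k c z)"
proof (rule antisym)
  let ?r = "if {z, v} \<in> E then max (lower E k c z) (k - b) else lower E k c z"
  have "k \<le> (c(v := b)) y + ?r" if "{z, y} \<in> E" for y
    using lower_edge[OF that, of k c] that by (cases "y = v") auto
  then show "lower E k (c(v := b)) z \<le> ?r" unfolding lower_le_iff by blast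
  have le: "lower E k c z \<le> lower E k (c(v := b)) z"
    unfolding lower_le_iff
  proof (intro allI impI)
    fix y assume "{z, y} \<in> E"
    then show "k \<le> c y + lower E k (c(v := b)) z"
      using lower_edge[of z y E k "c(v := b)"] assms by (cases "y = v") auto
  qed
  moreover have "k - b \<le> lower E k (c(v := b)) z" if "{z, v} \<in> E"
    using lower_edge[OF that, of k "c(v := b)"] by simp
  ultimately show "?r \<le> lower E k (c(v := b)) z" by simp
qed

lemma kcover_upd:
  assumes "kcover E k c" and "\<And>z. {v, z} \<in> E \<Longrightarrow> z \<noteq> v \<and> k \<le> b + c z"
  shows "kcover E k (c(v := b))"
  unfolding kcover_def
proof (intro allI impI)
  fix x y assume xy: "{x, y} \<in> E"
  then have "{y, x} \<in> E" by (simp add: insert_commute)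
  then show "k \<le> (c(v := b)) x + (c(v := b)) y"
    using xy kcoverD[OF assms(1) xy] assms(2)[of x] assms(2)[of y] by (auto simp: add.commute)
qed

text \<open>The thresholds \<open>t\<close> on \<open>A\<close> and \<open>k + 1 - t\<close> on \<open>B\<close> cut out the induced subgraph
  \<open>G \<setminus> N[S]\<close> with \<open>S = {z. c z < s z}\<close>; one of its leaves is the required \<open>v\<close>.\<close>

lemma (in bipartite_graph) leafy_unique_lower:
  assumes L: "leafy E" and c: "kcover E k c"
    and xy: "{x, y} \<in> E" "lower E k c x + lower E k c y < k"
  obtains u v where "{u, v} \<in> E" "lower E k c u + lower E k c v < k"
    "\<And>z. {v, z} \<in> E \<Longrightarrow> z \<noteq> u \<Longrightarrow> lower E k c u < lower E k c z"
proof -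
  let ?m = "lower E k c"
  obtain a b where "a \<in> A" "b \<in> B" and eq: "{x, y} = {a, b}" using edge[OF xy(1)] by blast
  moreover have "?m a + ?m b < k" using eq xy(2) by (auto simp: doubleton_eq_iff)
  ultimately have ab: "a \<in> A" "b \<in> B" "{a, b} \<in> E" "?m a + ?m b < k" using xy(1) by auto
  \<comment> \<open>On \<open>A\<close> this is the least threshold above the lower bound of
    \<open>a\<close>. The complementary threshold on \<open>B\<close> exceeds the lower bound of
    \<open>b\<close> exactly because the two lower bounds add up to less than \<open>k\<close>, so
    the edge {a, b} survives.\<close>
  define s where "s z = (if z \<in> A then Suc (?m a) else k - ?m a)" for z
  have s: "s u + s v = Suc k" if "{u, v} \<in> E" for u v
    using edge[OF that] disj ab(4) unfolding s_def by (auto simp: doubleton_eq_iff)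
  have s_pos: "0 < s z" for z using ab(4) unfolding s_def by auto
  define S where "S = {z. c z < s z}"
  have inS: "z \<in> S \<longleftrightarrow> c z < s z" for z unfolding S_def by simp
  have S: "\<forall>e\<in>E. \<not> e \<subseteq> S"
  proof
    fix e assume e: "e \<in> E"
    obtain u v where uv: "e = {u, v}" using edge[OF e] by blast
    show "\<not> e \<subseteq> S" using s[of u v] kcoverD[OF c, of u v] e unfolding uv S_def by auto
  qed
  \<comment> \<open>Thresholds of adjacent vertices add up to \<open>k + 1\<close>, so a neighbour
    \<open>y\<close> with \<open>c y < s y\<close> is the same as one forcing the lower bound of
    \<open>z\<close> up to at least \<open>s z\<close>.\<close>
  have nb: "z \<in> nbhd E S \<longleftrightarrow> s z \<le> ?m z" for z
  proof -
    have "z \<notin> nbhd E S \<longleftrightarrow> (\<forall>y. {z, y} \<in> E \<longrightarrow> s y \<le> c y)"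
      unfolding nbhd_def S_def by (auto simp: insert_commute not_less)
    also have "\<dots> \<longleftrightarrow> (\<forall>y. {z, y} \<in> E \<longrightarrow> k \<le> c y + (s z - 1))"
      using s[of z] s_pos[of z] by (smt (verit) Suc_diff_1 add_Suc_right add_le_cancel_right add.commute not_less_eq_eq)
    also have "\<dots> \<longleftrightarrow> ?m z \<le> s z - 1" unfolding lower_le_iff ..
    finally show ?thesis using s_pos[of z] by linarith
  qed
  have res: "{u, v} \<in> residual E S \<longleftrightarrow> {u, v} \<in> E \<and> ?m u < s u \<and> ?m v < s v" for u v
  proof -
    \<comment> \<open>A lower bound below the threshold at one end already keeps the other end out
      of \<open>S\<close>, so only the two conditions on lower bounds remain.\<close>
    have up: "s u \<le> c u" if "{u, v} \<in> E" "?m v < s v" for u v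
      using s[OF that(1)] lower_edge[of v u E k c] that by (simp add: insert_commute)
    have "{u, v} \<in> residual E S \<longleftrightarrow>
        {u, v} \<in> E \<and> s u \<le> c u \<and> s v \<le> c v \<and> ?m u < s u \<and> ?m v < s v"
      unfolding in_residual nb by (auto simp: inS not_less not_le)
    then show ?thesis using up[of u v] up[of v u] by (auto simp: insert_commute)
  qed
  have "{a, b} \<in> residual E S"
    using ab disj unfolding res s_def by auto
  then obtain u v where uv: "{u, v} \<in> residual E S" "\<And>z. {v, z} \<in> residual E S \<Longrightarrow> z = u"
    using leafyE[OF L S] by blast
  have E: "{u, v} \<in> E" "?m u < s u" "?m v < s v" using uv(1) res by auto
  show thesis
  proof
    show "{u, v} \<in> E" by fact
    show "?m u + ?m v < k" using E s[of u v] by simp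
    \<comment> \<open>A further neighbour \<open>z\<close> of \<open>v\<close> shares the threshold
      of \<open>u\<close>. As {v, z} is not residual, the lower bound of \<open>z\<close> reaches
      that threshold while the one of \<open>u\<close> stays below it.\<close>
    fix z assume z: "{v, z} \<in> E" "z \<noteq> u"
    then have "\<not> ?m z < s z" using uv(2)[of z] E(3) unfolding res by auto
    then have "s z \<le> ?m z" by simp
    moreover have "s z = s u" using s[OF z(1)] s[OF E(1)] by simp
    ultimately show "?m u < ?m z" using E(2) by simp
  qed
qed

section \<open>The splitting recursion on k-covers of a leafy graph\<close>

locale leafy_graph = bipartite_graph E A B UNIV
  for E :: "'v::finite set set" and A B :: "'v set" +
  assumes leafy: "leafy E"
begin

lemma no_loop: "{x, y} \<in> E \<Longrightarrow> x \<noteq> y"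
  using simple by (rule simple_graph_no_loop)

lemma inactive_kcover:
  assumes "\<And>x y. {x, y} \<in> E \<Longrightarrow> k \<le> lower E k c x + lower E k c y"
  shows "kcover E k (lower E k c)"
  using assms unfolding kcover_def by blast

text \<open>The edge to \<open>u\<close> keeps its weight. Every other neighbour \<open>z\<close> of
  \<open>v\<close> satisfies \<open>w u < w z\<close>, so its edge still weighs at least
  \<open>w u + w v\<close> after \<open>v\<close> loses one unit.\<close>

lemma kcover_transfer:
  assumes w: "kcover E k w" and uv: "{u, v} \<in> E" and wv: "0 < w v"
    and z: "\<And>z. {v, z} \<in> E \<Longrightarrow> z \<noteq> u \<Longrightarrow> w u < w z"
  shows "kcover E k (w(u := Suc (w u), v := w v - 1))"
proof -
  have "kcover E k (w(u := Suc (w u)))" using w by (rule kcover_mono) (simp add: le_fun_def)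
  moreover have "z \<noteq> v \<and> k \<le> w v - 1 + (w(u := Suc (w u))) z" if "{v, z} \<in> E" for z
    using z[OF that] no_loop[OF that] kcoverD[OF w uv] wv by auto
  ultimately show ?thesis by (rule kcover_upd)
qed

text \<open>One step of the recursion: with \<open>v\<close> as in \<open>leafy_unique_lower\<close>, the condition
  \<open>w u > lower E k c u\<close> corresponds to the smaller bound at \<open>v\<close>, and \<open>w u = lower E k c u\<close> to
  the smaller bound at \<open>u\<close>.\<close>

lemma bound_step:
  assumes c: "kcover E k c" and act: "{x, y} \<in> E" "lower E k c x + lower E k c y < k"
  obtains u v where "{u, v} \<in> E" "lower E k c u + lower E k c v < k"
    "\<And>z. {v, z} \<in> E \<Longrightarrow> z \<noteq> u \<Longrightarrow> lower E k c u < lower E k c z"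
    "k \<le> c v + lower E k c u" "lower E k c u < c u"
    "kcover E k (c(v := k - Suc (lower E k c u)))" "kcover E k (c(u := lower E k c u))"
    "lower E k (c(v := k - Suc (lower E k c u))) = (lower E k c)(u := Suc (lower E k c u))"
    "\<And>z. lower E k (c(u := lower E k c u)) z =
       (if {z, u} \<in> E then max (lower E k c z) (k - lower E k c u) else lower E k c z)"
    "sum (c(v := k - Suc (lower E k c u))) UNIV < sum c UNIV"
    "sum (c(u := lower E k c u)) UNIV < sum c UNIV"
proof -
  let ?m = "lower E k c"
  obtain u v where uv: "{u, v} \<in> E" "?m u + ?m v < k"
    and leaf: "\<And>z. {v, z} \<in> E \<Longrightarrow> z \<noteq> u \<Longrightarrow> ?m u < ?m z"
    using leafy_unique_lower[OF leafy c act] by blast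
  have vu: "{v, u} \<in> E" using uv(1) by (simp add: insert_commute)
  have cv: "k \<le> c v + ?m u" and cu: "k \<le> c u + ?m v" using uv(1) vu by (auto intro: lower_edge)
  have mc: "?m z \<le> c z" for z using c by (rule lower_le_kcover) simp
  show thesis
  proof (rule that[OF uv leaf cv])
    show "?m u < c u" using cu uv(2) by simp
    show "kcover E k (c(v := k - Suc (?m u)))"
    proof (rule kcover_upd[OF c])
      fix z assume z: "{v, z} \<in> E"
      have "?m u < c z" using leaf[OF z] mc[of z] cu uv(2) by (cases "z = u") auto
      then show "z \<noteq> v \<and> k \<le> k - Suc (?m u) + c z" using no_loop[OF z] by auto
    qed
    show "kcover E k (c(u := ?m u))"
      using kcover_upd[OF c] no_loop lower_edge by (metis add.commute)
    \<comment> \<open>The smaller bound at \<open>v\<close> raises the lower bounds of its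
      neighbours to at least one more than that of \<open>u\<close>. All neighbours except
      \<open>u\<close> have reached this already, so exactly one coordinate moves.\<close>
    show "lower E k (c(v := k - Suc (?m u))) = ?m(u := Suc (?m u))"
    proof
      fix z
      have "k - Suc (?m u) \<le> c v" using cv by simp
      moreover have "k - (k - Suc (?m u)) = Suc (?m u)" using uv(2) by simp
      ultimately show "lower E k (c(v := k - Suc (?m u))) z = (?m(u := Suc (?m u))) z"
        using leaf[of z] uv(1) by (auto simp: lower_upd insert_commute)
    qed
    show "lower E k (c(u := ?m u)) z = (if {z, u} \<in> E then max (?m z) (k - ?m u) else ?m z)" for z
      by (rule lower_upd) (rule mc)
    show "sum (c(v := k - Suc (?m u))) UNIV < sum c UNIV"
      using cv uv(2) by (intro sum_strict_mono_ex1) auto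
    show "sum (c(u := ?m u)) UNIV < sum c UNIV"
      using cu uv(2) mc by (intro sum_strict_mono_ex1) auto
  qed
qed

text \<open>Each half of the split is again given by a smaller upper bound, at \<open>v\<close> or
  at \<open>u\<close>. If every edge is satisfied by the lower bounds, they form a
  \<open>k\<close>-cover below all candidates, and minimality leaves at most one.\<close>

lemma lq_min_kcovers_bounded:
  assumes "kcover E k c"
  shows "lq_set {w. min_kcover E k w \<and> w \<le> c}"
  using assms
proof (induction "sum c UNIV" arbitrary: c rule: less_induct)
  case less
  let ?m = "lower E k c" and ?S = "\<lambda>c. {w. min_kcover E k w \<and> w \<le> c}"
  have low: "?m z \<le> w z" if "w \<in> ?S c" for w z
  proof (rule lower_le_kcover)
    show "kcover E k w" "w \<le> c" using that unfolding min_kcover_def by simp_all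
  qed
  show ?case
  proof (cases "\<exists>x y. {x, y} \<in> E \<and> ?m x + ?m y < k")
    case False
    then have "kcover E k ?m" by (intro inactive_kcover) (auto simp: not_less)
    moreover have "?m \<le> w" if "w \<in> ?S c" for w using low[OF that] by (simp add: le_fun_def)
    ultimately have "?S c \<subseteq> {?m}" unfolding min_kcover_def by fast
    then show ?thesis by (rule lq_set_subsingleton)
  next
    case True
    then obtain x y where "{x, y} \<in> E" "?m x + ?m y < k" by blast
    from bound_step[OF less.prems this] obtain u v where uv: "{u, v} \<in> E" "?m u + ?m v < k"
      and leaf: "\<And>z. {v, z} \<in> E \<Longrightarrow> z \<noteq> u \<Longrightarrow> ?m u < ?m z"
      and cv: "k \<le> c v + ?m u" and cu: "?m u < c u"
      and c1: "kcover E k (c(v := k - Suc (?m u)))" and c2: "kcover E k (c(u := ?m u))"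
      and s1: "sum (c(v := k - Suc (?m u))) UNIV < sum c UNIV"
      and s2: "sum (c(u := ?m u)) UNIV < sum c UNIV" by metis
    show ?thesis
    proof (rule lq_set_split[where P = "\<lambda>w. ?m u < w u"])
      have "{w \<in> ?S c. ?m u < w u} = ?S (c(v := k - Suc (?m u)))"
      proof (intro equalityI subsetI)
        fix w assume w: "w \<in> {w \<in> ?S c. ?m u < w u}"
        \<comment> \<open>Here minimality enters: all neighbours of \<open>v\<close> have value
          above \<open>?m u\<close>, so a larger value at \<open>v\<close> could be
          decreased.\<close>
        have "w v \<le> k - Suc (?m u)"
        proof (rule ccontr)
          assume n: "\<not> ?thesis"
          have "z \<noteq> v \<and> k \<le> w v - 1 + w z" if "{v, z} \<in> E" for z
          proof (cases "z = u")
            case True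
            have "?m u < w u" using w by simp
            then show ?thesis using n True no_loop[OF that] by auto
          next
            case False
            have "?m z \<le> w z" using w by (intro low) simp
            then show ?thesis using n leaf[OF that False] no_loop[OF that] by simp
          qed
          then have "kcover E k (w(v := w v - 1))"
            using w unfolding min_kcover_def by (intro kcover_upd) simp_all
          moreover have "w(v := w v - 1) \<le> w" by (simp add: le_fun_def)
          ultimately have "w(v := w v - 1) = w" using w unfolding min_kcover_def by blast
          from fun_cong[OF this, of v] show False using n by simp
        qed
        then show "w \<in> ?S (c(v := k - Suc (?m u)))" using w by (auto simp: le_fun_def)
      next
        fix w assume w: "w \<in> ?S (c(v := k - Suc (?m u)))"
        have le: "k - Suc (?m u) \<le> c v" using cv by simp
        have wv: "w v \<le> k - Suc (?m u)" using w by (auto simp: le_fun_def split: if_splits)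
        have "w \<le> c"
        proof (rule le_funI)
          fix z show "w z \<le> c z" using w wv le by (cases "z = v") (auto simp: le_fun_def split: if_splits)
        qed
        moreover have "k \<le> w u + w v" using w uv(1) unfolding min_kcover_def by (blast intro: kcoverD)
        then have "?m u < w u" using wv uv(2) by simp
        ultimately show "w \<in> {w \<in> ?S c. ?m u < w u}" using w by simp
      qed
      then show "lq_set {w \<in> ?S c. ?m u < w u}" using less.hyps[OF s1 c1] by simp
    next
      have "{w \<in> ?S c. \<not> ?m u < w u} = ?S (c(u := ?m u))"
      proof (intro equalityI subsetI)
        fix w assume w: "w \<in> {w \<in> ?S c. \<not> ?m u < w u}"
        then show "w \<in> ?S (c(u := ?m u))" by (simp add: le_fun_def not_less)
      next
        fix w assume w: "w \<in> ?S (c(u := ?m u))"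
        then have le: "w z \<le> (c(u := ?m u)) z" for z by (simp add: le_fun_def)
        have "w z \<le> c z" for z using le[of z] cu by (cases "z = u") auto
        moreover have "w u \<le> ?m u" using le[of u] by simp
        ultimately show "w \<in> {w \<in> ?S c. \<not> ?m u < w u}" using w by (simp add: le_fun_def not_less)
      qed
      then show "lq_set {w \<in> ?S c. \<not> ?m u < w u}" using less.hyps[OF s2 c2] by simp
    next
      fix x w assume x: "x \<in> ?S c" "?m u < x u" and w: "w \<in> ?S c" "\<not> ?m u < w u"
      have wu: "w u = ?m u" using low[OF w(1), of u] w(2) by simp
      let ?w = "w(u := Suc (w u), v := w v - 1)"
      have kw: "kcover E k w" using w unfolding min_kcover_def by blast
      have wv: "0 < w v" using kcoverD[OF kw uv(1)] wu uv(2) by simp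
      have uv': "u \<noteq> v" using uv(1) by (rule no_loop)
      have "kcover E k ?w"
      proof (rule kcover_transfer[OF kw uv(1) wv])
        show "w u < w z" if "{v, z} \<in> E" "z \<noteq> u" for z
          using leaf[OF that] low[OF w(1), of z] wu by simp
      qed
      then obtain f where fm: "min_kcover E k f" and "f \<le> ?w" using min_kcover_exists by blast
      then have fw: "f z \<le> ?w z" for z by (simp add: le_fun_def)
      \<comment> \<open>Passing to a minimal \<open>f\<close> must not lose the unit gained at
        \<open>u\<close>. If it did, \<open>f\<close> would lie below \<open>w\<close> and be
        strictly smaller at \<open>v\<close>, against the minimality of \<open>w\<close>.\<close>
      have "?m u < f u"
      proof (rule ccontr)
        assume "\<not> ?thesis"
        then have le: "f z \<le> (w(v := w v - 1)) z" for z
          using fw[of z] wu uv' by (cases "z = u") auto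
        have "f z \<le> w z" for z using le[of z] by (cases "z = v") auto
        then have "f \<le> w" by (simp add: le_fun_def)
        then have "f = w" using w(1) fm unfolding min_kcover_def by blast
        then show False using le[of v] wv by simp
      qed
      moreover have "f z \<le> c z" for z
      proof -
        have "w z \<le> c z" using w(1) by (simp add: le_fun_def)
        then show ?thesis using fw[of z] wu cu uv' by (auto split: if_splits)
      qed
      then have "f \<in> ?S c" using fm by (simp add: le_fun_def)
      moreover have "f \<le> w(u := Suc (w u))"
      proof (rule le_funI)
        fix z show "f z \<le> (w(u := Suc (w u))) z" using fw[of z] uv' by (auto split: if_splits)
      qed
      moreover have "w u < x u" using x(2) wu by simp
      ultimately show "\<exists>x'\<in>?S c. ?m u < x' u \<and> (\<exists>t. w t < x t \<and> x' \<le> w(t := Suc (w t)))" by blast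
    qed
  qed
qed

text \<open>The half with \<open>w u\<close> above its bound raises the lower bound at
  \<open>u\<close>; the other half freezes \<open>u\<close> and raises the lower bounds of its
  neighbours. Once the lower bounds themselves form a \<open>k\<close>-cover, the cover condition is
  automatic and \<open>lq_box\<close> applies. The hypothesis on \<open>F\<close> says that frozen
  vertices have no slack left between bound and forced value.\<close>

lemma lq_kcovers_bounded:
  assumes "kcover E k c" and "\<And>z. z \<in> F \<Longrightarrow> c z \<le> lower E k c z"
  shows "lq_set {w. kcover E k w \<and> sum w UNIV = l \<and> lower E k c \<le> w \<and>
    (\<forall>z\<in>F. w z = lower E k c z)}"
  using assms
proof (induction "sum c UNIV" arbitrary: c F rule: less_induct)
  case less
  let ?S = "\<lambda>c F. {w. kcover E k w \<and> sum w UNIV = l \<and> lower E k c \<le> w \<and>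
    (\<forall>z\<in>F. w z = lower E k c z)}"
  let ?m = "lower E k c"
  show ?case
  proof (cases "\<exists>x y. {x, y} \<in> E \<and> ?m x + ?m y < k")
    case False
    then have "kcover E k ?m" by (intro inactive_kcover) (auto simp: not_less)
    then have "?S c F = {w. sum w UNIV = l \<and> ?m \<le> w \<and> (\<forall>z\<in>F. w z = ?m z)}"
      using kcover_mono by blast
    then show ?thesis using lq_box by simp
  next
    case True
    then obtain x y where "{x, y} \<in> E" "?m x + ?m y < k" by blast
    from bound_step[OF less.prems(1) this] obtain u v where uv: "{u, v} \<in> E" "?m u + ?m v < k"
      and leaf: "\<And>z. {v, z} \<in> E \<Longrightarrow> z \<noteq> u \<Longrightarrow> ?m u < ?m z"
      and cv: "k \<le> c v + ?m u" and cu: "?m u < c u"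
      and c1: "kcover E k (c(v := k - Suc (?m u)))" and c2: "kcover E k (c(u := ?m u))"
      and m1: "lower E k (c(v := k - Suc (?m u))) = ?m(u := Suc (?m u))"
      and m2: "\<And>z. lower E k (c(u := ?m u)) z =
        (if {z, u} \<in> E then max (?m z) (k - ?m u) else ?m z)"
      and s1: "sum (c(v := k - Suc (?m u))) UNIV < sum c UNIV"
      and s2: "sum (c(u := ?m u)) UNIV < sum c UNIV" by metis
    \<comment> \<open>Both ends of the chosen edge have slack, so neither is frozen and moving a
      unit from \<open>v\<close> to \<open>u\<close> respects \<open>F\<close>.\<close>
    have uF: "u \<notin> F" using cu less.prems(2)[of u] by auto
    have vF: "v \<notin> F" using cv uv(2) less.prems(2)[of v] by auto
    have uu: "{u, u} \<notin> E" using no_loop by blast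
    show ?thesis
    proof (rule lq_set_split[where P = "\<lambda>w. ?m u < w u"])
      have "{w \<in> ?S c F. ?m u < w u} = ?S (c(v := k - Suc (?m u))) F"
        unfolding m1 using uF by (auto simp: le_fun_def intro: less_imp_le)
      moreover have "lq_set (?S (c(v := k - Suc (?m u))) F)"
      proof (rule less.hyps[OF s1 c1])
        show "(c(v := k - Suc (?m u))) z \<le> lower E k (c(v := k - Suc (?m u))) z" if "z \<in> F" for z
          using less.prems(2)[OF that] that uF vF unfolding m1 by auto
      qed
      ultimately show "lq_set {w \<in> ?S c F. ?m u < w u}" by simp
    next
      \<comment> \<open>Freezing \<open>u\<close> affects no frozen neighbour \<open>z\<close>: the
        lower bound of \<open>u\<close> already accounts for \<open>c z\<close>, which is at most
        the lower bound of \<open>z\<close>.\<close>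
      have mF: "lower E k (c(u := ?m u)) z = ?m z" if "z \<in> F" for z
      proof -
        have "k - ?m u \<le> ?m z" if "{z, u} \<in> E"
          using lower_edge[of u z E k c] that less.prems(2)[OF \<open>z \<in> F\<close>] by (simp add: insert_commute)
        then show ?thesis unfolding m2 by simp
      qed
      have mu: "lower E k (c(u := ?m u)) u = ?m u" unfolding m2 using uu by simp
      have "{w \<in> ?S c F. \<not> ?m u < w u} = ?S (c(u := ?m u)) (insert u F)"
      proof (intro equalityI subsetI)
        fix w assume w: "w \<in> {w \<in> ?S c F. \<not> ?m u < w u}"
        then have low: "?m z \<le> w z" for z by (simp add: le_fun_def)
        have wu: "w u = ?m u" using low[of u] w by simp
        have "lower E k (c(u := ?m u)) z \<le> w z" for z
          using kcoverD[of E k w z u] w wu low[of z] unfolding m2 by auto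
        then show "w \<in> ?S (c(u := ?m u)) (insert u F)" using w wu mu mF by (simp add: le_fun_def)
      next
        fix w assume w: "w \<in> ?S (c(u := ?m u)) (insert u F)"
        have "?m z \<le> w z" for z
        proof -
          have "?m z \<le> lower E k (c(u := ?m u)) z" unfolding m2 by simp
          also have "\<dots> \<le> w z" using w by (simp add: le_fun_def)
          finally show ?thesis .
        qed
        then show "w \<in> {w \<in> ?S c F. \<not> ?m u < w u}" using w mu mF by (simp add: le_fun_def)
      qed
      moreover have "lq_set (?S (c(u := ?m u)) (insert u F))"
      proof (rule less.hyps[OF s2 c2])
        show "(c(u := ?m u)) z \<le> lower E k (c(u := ?m u)) z" if "z \<in> insert u F" for z
          using that mu mF[of z] less.prems(2)[of z] uF by auto
      qed
      ultimately show "lq_set {w \<in> ?S c F. \<not> ?m u < w u}" by simp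
    next
      fix x w assume x: "x \<in> ?S c F" "?m u < x u" and w: "w \<in> ?S c F" "\<not> ?m u < w u"
      have low: "?m z \<le> w z" for z using w by (simp add: le_fun_def)
      have wu: "w u = ?m u" using low[of u] w(2) by simp
      let ?w = "w(u := Suc (w u), v := w v - 1)"
      have kw: "kcover E k w" using w by blast
      have wv: "?m v < w v" using kcoverD[OF kw uv(1)] wu uv(2) by simp
      have uv': "u \<noteq> v" using uv(1) by (rule no_loop)
      have "kcover E k ?w"
      proof (rule kcover_transfer[OF kw uv(1)])
        show "0 < w v" using wv by simp
        show "w u < w z" if "{v, z} \<in> E" "z \<noteq> u" for z using leaf[OF that] low[of z] wu by simp
      qed
      moreover have "sum ?w UNIV = l" using sum_transfer[OF uv', of w] w wv by simp
      moreover have "?m \<le> ?w"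
      proof (rule le_funI)
        fix z show "?m z \<le> ?w z" using low[of z] wv by auto
      qed
      moreover have "\<forall>z\<in>F. ?w z = ?m z" using w uF vF by auto
      ultimately have "?w \<in> ?S c F" by blast
      moreover have "?m u < ?w u" using uv' wu by simp
      moreover have "?w \<le> w(u := Suc (w u))" by (auto simp: le_fun_def)
      moreover have "w u < x u" using x(2) wu by simp
      ultimately show "\<exists>x'\<in>?S c F. ?m u < x' u \<and> (\<exists>t. w t < x t \<and> x' \<le> w(t := Suc (w t)))" by blast
    qed
  qed
qed

lemma lq_min_kcovers: "lq_set {w. min_kcover E k w}"
proof -
  have "w \<le> (\<lambda>_. k)" if w: "min_kcover E k w" for w
  proof -
    have "kcover E k (\<lambda>z. min (w z) k)" unfolding kcover_def
    proof (intro allI impI)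
      fix x y assume "{x, y} \<in> E"
      then have "k \<le> w x + w y" using w unfolding min_kcover_def by (blast intro: kcoverD)
      then show "k \<le> min (w x) k + min (w y) k" by simp
    qed
    moreover have "(\<lambda>z. min (w z) k) \<le> w" by (simp add: le_fun_def)
    ultimately have "(\<lambda>z. min (w z) k) = w" using w unfolding min_kcover_def by blast
    then show ?thesis by (metis le_funI min.cobounded2)
  qed
  then have "{w. min_kcover E k w} = {w. min_kcover E k w \<and> w \<le> (\<lambda>_. k)}" by blast
  then show ?thesis using lq_min_kcovers_bounded[of k "\<lambda>_. k"] by (simp add: kcover_def)
qed

lemma lq_kcovers: "lq_set {w. kcover E k w \<and> sum w UNIV = l}"
proof -
  have "lower E k (\<lambda>_. k) z \<le> 0" for z unfolding lower_le_iff by simp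
  then have "lower E k (\<lambda>_. k) \<le> w" for w by (simp add: le_fun_def)
  then show ?thesis using lq_kcovers_bounded[of k "\<lambda>_. k" "{}" l] by (simp add: kcover_def)
qed

end

section \<open>Exchange steps between k-covers of equal degree force leaves\<close>

locale finite_bipartite_graph = bipartite_graph E A B UNIV
  for E :: "'v::finite set set" and A B :: "'v set"
begin

interpretation sw: bipartite_graph E B A UNIV by (rule swap)

lemma sum_indicator_cover:
  fixes N T :: "'v set"
  assumes "T \<inter> N = {}"
  shows "(\<Sum>z\<in>UNIV. if z \<in> N \<union> T then k else 0) = k * card N + k * card T"
proof -
  have "(\<Sum>z\<in>UNIV. if z \<in> N \<union> T then k else 0) = (\<Sum>z\<in>N \<union> T. k)"
    by (rule sum.mono_neutral_cong_right) auto
  also have "\<dots> = k * (card N + card T)"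
    using assms by (simp add: card_Un_disjoint Int_commute)
  finally show ?thesis by (simp add: distrib_left)
qed

text \<open>Between the \<open>k\<close>-covers \<open>k\<close> times \<open>N(S) \<union> A'\<close> (padded at one vertex of \<open>A'\<close> to equal degree)
  and \<open>k\<close> times \<open>N(S) \<union> B'\<close>, where \<open>A'\<close> and \<open>B'\<close> are the non-isolated vertices of the two sides of
  \<open>G \<setminus> N[S]\<close>, the first exchange step is only possible at a leaf in \<open>B'\<close>.\<close>

lemma residual_leaf_if_linear:
  assumes k: "0 < k"
    and lin: "\<And>u v. kcover E k u \<Longrightarrow> kcover E k v \<Longrightarrow> sum u UNIV = sum v UNIV \<Longrightarrow> u \<noteq> v \<Longrightarrow>
      \<exists>i j. i \<noteq> j \<and> v i < u i \<and> 0 < v j \<and> kcover E k (v(i := Suc (v i), j := v j - 1))"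
    and S: "\<forall>e\<in>E. \<not> e \<subseteq> S" and ne: "residual E S \<noteq> {}"
    and card: "card (side S) \<le> card (sw.side S)"
  shows "\<exists>u v. {u, v} \<in> residual E S \<and> (\<forall>z. {v, z} \<in> residual E S \<longrightarrow> z = u)"
proof -
  let ?N = "nbhd E S"
  obtain a0 b0 where "a0 \<in> A" "{a0, b0} \<in> residual E S" using ne residual_edge by blast
  then have a0: "a0 \<in> side S" unfolding side_def by blast
  define g where "g T z = (if z \<in> ?N \<union> T then k else 0)" for T z
  \<comment> \<open>The padding sits inside A', so \<open>u\<close> exceeds the other cover only at
    vertices of A'. The subtraction is exact because A' is the smaller side.\<close>
  define u where "u = (g (side S))(a0 := k + k * (card (sw.side S) - card (side S)))"
  have C: "min_cover E (?N \<union> side S)" using min_cover_Un_nbhd[OF min_cover_side S simple] by blast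
  have D: "min_cover E (?N \<union> sw.side S)" "S \<inter> (?N \<union> sw.side S) = {}"
    using min_cover_Un_nbhd[OF sw.min_cover_side S simple] by blast+
  have cover: "kcover E k (g T)" if "min_cover E (?N \<union> T)" for T
    unfolding kcover_def g_def using min_cover_hit[OF that] by fastforce
  have gu: "g (side S) \<le> u" using a0 unfolding u_def g_def by (auto simp: le_fun_def)
  have ku: "kcover E k u" using cover[OF C] gu by (rule kcover_mono)
  have kv: "kcover E k (g (sw.side S))" by (rule cover[OF D(1)])
  have sum_g: "sum (g T) UNIV = k * card ?N + k * card T" if "T \<inter> ?N = {}" for T
    using sum_indicator_cover[OF that, of k] unfolding g_def .
  have disj1: "side S \<inter> ?N = {}" "sw.side S \<inter> ?N = {}" using side_disj sw.side_disj by blast+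
  have "sum u UNIV = sum (g (side S)) UNIV + k * (card (sw.side S) - card (side S))"
  proof -
    have "sum u (UNIV - {a0}) = sum (g (side S)) (UNIV - {a0})"
      unfolding u_def by (intro sum.cong) auto
    then show ?thesis using a0 by (simp add: sum.remove[of UNIV a0] u_def g_def)
  qed
  also have "\<dots> = sum (g (sw.side S)) UNIV"
    using card by (simp add: sum_g[OF disj1(1)] sum_g[OF disj1(2)] flip: distrib_left)
  finally have sums: "sum u UNIV = sum (g (sw.side S)) UNIV" .
  have a0': "a0 \<notin> ?N" "a0 \<notin> sw.side S" using side_disj[OF a0] unfolding sw.side_def by auto
  have "u a0 \<noteq> g (sw.side S) a0" using k a0' unfolding u_def g_def by simp
  then have "u \<noteq> g (sw.side S)" by blast
  then obtain i j where ij: "i \<noteq> j" "g (sw.side S) i < u i" "0 < g (sw.side S) j"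
    and kw: "kcover E k ((g (sw.side S))(i := Suc (g (sw.side S) i), j := g (sw.side S) j - 1))"
    using lin[OF ku kv sums] by blast
  let ?w = "(g (sw.side S))(i := Suc (g (sw.side S) i), j := g (sw.side S) j - 1)"
  have i: "i \<in> side S"
  proof (rule ccontr)
    assume n: "i \<notin> side S"
    then have "i \<noteq> a0" using a0 by blast
    then show False using ij(2) n unfolding u_def g_def by (auto split: if_splits)
  qed
  have j: "j \<in> ?N \<union> sw.side S" using ij(3) unfolding g_def by (auto split: if_splits)
  have wj: "?w j = k - 1" using j unfolding g_def by simp
  \<comment> \<open>After the step \<open>j\<close> carries \<open>k - 1\<close>, so each neighbour
    must carry something; outside N(S) \<union> B' only \<open>i\<close> does. This uses
    \<open>0 < k\<close>.\<close>
  have only: "z = i" if z: "{j, z} \<in> E" "z \<notin> ?N \<union> sw.side S" for z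
  proof (rule ccontr)
    assume "z \<noteq> i"
    moreover have "z \<noteq> j" using j z by blast
    ultimately have "?w z = 0" using z(2) unfolding g_def by simp
    then show False using kcoverD[OF kw z(1)] wj k by simp
  qed
  \<comment> \<open>Otherwise a neighbour of \<open>j\<close> in \<open>S\<close> would have to be
    \<open>i\<close>, but A' avoids \<open>S\<close>.\<close>
  have "j \<notin> ?N"
  proof
    assume "j \<in> ?N"
    then obtain s where s: "s \<in> S" "{s, j} \<in> E" by (rule nbhdE)
    then have "s = i" using only[of s] D(2) by (auto simp: insert_commute)
    then show False using s(1) side_disj[OF i] by blast
  qed
  then have jB: "j \<in> sw.side S" using j by blast
  have leaf: "z = i" if "{j, z} \<in> residual E S" for z
  proof (rule only)
    show "{j, z} \<in> E" using that unfolding in_residual by blast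
    then have "z \<in> A" using jB edge_BA unfolding sw.side_def by blast
    then show "z \<notin> ?N \<union> sw.side S" using that disj unfolding in_residual sw.side_def by blast
  qed
  obtain z where "{j, z} \<in> residual E S" using jB unfolding sw.side_def by blast
  then have "{i, j} \<in> residual E S" using leaf by (metis insert_commute)
  then show ?thesis using leaf by blast
qed

end

context finite_bipartite_graph
begin

interpretation sw: finite_bipartite_graph E B A
  using swap unfolding finite_bipartite_graph_def .

lemma linear_leafy:
  assumes k: "0 < k"
    and lin: "\<And>u v. kcover E k u \<Longrightarrow> kcover E k v \<Longrightarrow> sum u UNIV = sum v UNIV \<Longrightarrow> u \<noteq> v \<Longrightarrow>
      \<exists>i j. i \<noteq> j \<and> v i < u i \<and> 0 < v j \<and> kcover E k (v(i := Suc (v i), j := v j - 1))"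
  shows "leafy E"
  unfolding leafy_def
proof (intro allI impI)
  fix S assume S: "\<forall>e\<in>E. \<not> e \<subseteq> S" and ne: "residual E S \<noteq> {}"
  show "\<exists>u v. {u, v} \<in> residual E S \<and> (\<forall>z. {v, z} \<in> residual E S \<longrightarrow> z = u)"
  proof (cases "card (side S) \<le> card (sw.side S)")
    case True
    show ?thesis by (rule residual_leaf_if_linear[OF k lin S ne True])
  next
    case False
    then have le: "card (sw.side S) \<le> card (side S)" by simp
    show ?thesis by (rule sw.residual_leaf_if_linear[OF k lin S ne le])
  qed
qed

end


section \<open>Monomial ideals and powers of the cover ideal\<close>

interpretation ideal: Modules.module "(*) :: 'a::comm_ring_1 \<Rightarrow> 'a \<Rightarrow> 'a"
  by (rule module_mult)

text \<open>This instance of \<open>scale_scale\<close> is associativity read backwards and loops with \<open>mult.assoc\<close>.\<close>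

declare ideal.scale_scale [simp del]

lemma lookup_Abs_finite [simp]: "Poly_Mapping.lookup (Abs_poly_mapping w) = w"
  for w :: "'v::finite \<Rightarrow> 'b::zero"
  by simp

lemma lookup_add_fun: "Poly_Mapping.lookup (a + b) = (\<lambda>z. Poly_Mapping.lookup a z + Poly_Mapping.lookup b z)"
  by (rule ext) (rule lookup_add)

lemma mon_degree_sum: "mon_degree m = sum (Poly_Mapping.lookup m) UNIV" for m :: "'v::finite \<Rightarrow>\<^sub>0 nat"
  unfolding mon_degree_def by (rule sum.mono_neutral_left) (auto simp: in_keys_iff)

lemma mon_degree_add: "mon_degree (a + b) = mon_degree a + mon_degree b" for a :: "'v::finite \<Rightarrow>\<^sub>0 nat"
  unfolding mon_degree_sum lookup_add_fun by (rule sum.distrib)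

definition xpow :: "('v::finite \<Rightarrow> nat) \<Rightarrow> ('v, 'k::field) mpoly" where
  "xpow w = Poly_Mapping.single (Abs_poly_mapping w) 1"

text \<open>Given by supports, so that sums, intersections and colons reduce to statements about
  exponents; it is an ideal for upward closed \<open>U\<close>.\<close>

definition monomial_ideal :: "('v::finite \<Rightarrow> nat) set \<Rightarrow> ('v, 'k::field) mpoly set" where
  "monomial_ideal U = {f. \<forall>m\<in>Poly_Mapping.keys f. Poly_Mapping.lookup m \<in> U}"

definition upclosed :: "('v \<Rightarrow> nat) set \<Rightarrow> bool" where
  "upclosed U \<longleftrightarrow> (\<forall>w w'. w \<in> U \<longrightarrow> w \<le> w' \<longrightarrow> w' \<in> U)"

lemma keys_xpow [simp]: "Poly_Mapping.keys (xpow w :: ('v::finite, 'k::field) mpoly) = {Abs_poly_mapping w}"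
  unfolding xpow_def by simp

lemma xpow_in_monomial_ideal: "xpow w \<in> (monomial_ideal U :: ('v::finite, 'k::field) mpoly set) \<longleftrightarrow> w \<in> U"
  unfolding monomial_ideal_def by simp

lemma xpow_inject: "(xpow w :: ('v::finite, 'k::field) mpoly) = xpow w' \<longleftrightarrow> w = w'"
proof
  assume "(xpow w :: ('v, 'k) mpoly) = xpow w'"
  then have "Poly_Mapping.keys (xpow w :: ('v, 'k) mpoly) = Poly_Mapping.keys (xpow w' :: ('v, 'k) mpoly)"
    by simp
  then have "Abs_poly_mapping w = Abs_poly_mapping w'" by simp
  then show "w = w'" by (metis lookup_Abs_finite)
qed simp

lemma is_monomialE:
  fixes u :: "('v::finite, 'k::field) mpoly"
  assumes "is_monomial u"
  obtains w where "u = xpow w"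
  using assms unfolding is_monomial_def xpow_def by (metis lookup_inverse)

lemma poly_sum_singles: "f = (\<Sum>m\<in>Poly_Mapping.keys f. Poly_Mapping.single m (Poly_Mapping.lookup f m))"
proof (rule poly_mapping_eqI)
  fix k
  have "(\<Sum>m\<in>Poly_Mapping.keys f. Poly_Mapping.lookup (Poly_Mapping.single m (Poly_Mapping.lookup f m)) k) =
    (\<Sum>m\<in>Poly_Mapping.keys f. if m = k then Poly_Mapping.lookup f m else 0)"
    by (intro sum.cong) (auto simp: lookup_single when_def)
  then show "Poly_Mapping.lookup f k =
    Poly_Mapping.lookup (\<Sum>m\<in>Poly_Mapping.keys f. Poly_Mapping.single m (Poly_Mapping.lookup f m)) k"
    by (simp add: lookup_sum sum.delta' in_keys_iff)
qed

lemma lookup_mult_single: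
  fixes f :: "('v, 'k::field) mpoly"
  shows "Poly_Mapping.lookup (f * Poly_Mapping.single n c) (m + n) = Poly_Mapping.lookup f m * c"
proof -
  have "f * Poly_Mapping.single n c =
    (\<Sum>m'\<in>Poly_Mapping.keys f. Poly_Mapping.single (m' + n) (Poly_Mapping.lookup f m' * c))"
    by (subst poly_sum_singles) (simp add: sum_distrib_right mult_single)
  then have "Poly_Mapping.lookup (f * Poly_Mapping.single n c) (m + n) =
    (\<Sum>m'\<in>Poly_Mapping.keys f. if m' = m then Poly_Mapping.lookup f m' * c else 0)"
    by (simp add: lookup_sum lookup_single when_def)
  then show ?thesis by (simp add: sum.delta' in_keys_iff)
qed

lemma monomial_ideal_subspace:
  assumes "upclosed U"
  shows "ideal.subspace (monomial_ideal U :: ('v::finite, 'k::field) mpoly set)"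
proof (rule ideal.subspaceI)
  show "0 \<in> (monomial_ideal U :: ('v, 'k) mpoly set)" unfolding monomial_ideal_def by simp
  fix f g :: "('v, 'k) mpoly"
  show "f + g \<in> monomial_ideal U" if "f \<in> monomial_ideal U" "g \<in> monomial_ideal U"
    unfolding monomial_ideal_def
  proof (intro CollectI ballI)
    fix m assume "m \<in> Poly_Mapping.keys (f + g)"
    then have "m \<in> Poly_Mapping.keys f \<union> Poly_Mapping.keys g" by (rule subsetD[OF keys_add])
    then show "Poly_Mapping.lookup m \<in> U" using that unfolding monomial_ideal_def by auto
  qed
  show "f * g \<in> monomial_ideal U" if g: "g \<in> monomial_ideal U"
    unfolding monomial_ideal_def
  proof (intro CollectI ballI)
    fix m assume "m \<in> Poly_Mapping.keys (f * g)"
    then obtain a b where m: "m = a + b" and b: "b \<in> Poly_Mapping.keys g" using keys_mult by blast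
    have "Poly_Mapping.lookup b \<in> U" using b g unfolding monomial_ideal_def by simp
    moreover have "Poly_Mapping.lookup b \<le> Poly_Mapping.lookup m"
      unfolding m lookup_add_fun by (simp add: le_fun_def)
    ultimately show "Poly_Mapping.lookup m \<in> U" using assms unfolding upclosed_def by blast
  qed
qed

lemma monomial_idealI:
  assumes "ideal.subspace I"
    and "\<And>m c. Poly_Mapping.lookup m \<in> U \<Longrightarrow> Poly_Mapping.single m c \<in> I"
  shows "(monomial_ideal U :: ('v::finite, 'k::field) mpoly set) \<subseteq> I"
proof
  fix f :: "('v, 'k) mpoly" assume f: "f \<in> monomial_ideal U"
  have "(\<Sum>m\<in>Poly_Mapping.keys f. Poly_Mapping.single m (Poly_Mapping.lookup f m)) \<in> I"
    using f assms(2) unfolding monomial_ideal_def by (intro ideal.subspace_sum assms(1)) auto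
  then show "f \<in> I" using poly_sum_singles[of f] by simp
qed

lemma upclosed_above: "upclosed {w. \<exists>a\<in>W. a \<le> w}"
  unfolding upclosed_def by (blast intro: order_trans)

lemma ideal_gen_xpow:
  "ideal_gen (xpow ` W) = (monomial_ideal {w. \<exists>a\<in>W. a \<le> w} :: ('v::finite, 'k::field) mpoly set)"
  unfolding ideal_gen_def
proof
  let ?I = "monomial_ideal {w. \<exists>a\<in>W. a \<le> w} :: ('v, 'k) mpoly set"
  show "ideal.span (xpow ` W) \<subseteq> ?I"
    by (rule ideal.span_minimal[OF _ monomial_ideal_subspace[OF upclosed_above]])
      (auto simp: xpow_in_monomial_ideal)
  show "?I \<subseteq> ideal.span (xpow ` W)"
  proof (rule monomial_idealI)
    fix m and c :: 'k assume "Poly_Mapping.lookup m \<in> {w. \<exists>a\<in>W. a \<le> w}"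
    then obtain a where a: "a \<in> W" "a \<le> Poly_Mapping.lookup m" by blast
    have "m = Abs_poly_mapping (\<lambda>z. Poly_Mapping.lookup m z - a z) + Abs_poly_mapping a"
      using a(2) by (intro poly_mapping_eqI) (simp add: lookup_add le_fun_def)
    then have "Poly_Mapping.single m c =
        Poly_Mapping.single (Abs_poly_mapping (\<lambda>z. Poly_Mapping.lookup m z - a z)) c * xpow a"
      unfolding xpow_def mult_single by simp
    then show "Poly_Mapping.single m c \<in> ideal.span (xpow ` W)"
      using a(1) by (simp add: ideal.span_scale ideal.span_base)
  qed simp
qed

lemma var_xpow: "var v = (xpow (\<lambda>z. if z = v then 1 else 0) :: ('v::finite, 'k::field) mpoly)"
proof -
  have "Poly_Mapping.single v (1::nat) = Abs_poly_mapping (\<lambda>z. if z = v then 1 else 0)"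
    by (rule poly_mapping_eqI) (simp add: lookup_single when_def)
  then show ?thesis unfolding var_def xpow_def by simp
qed

lemma ideal_gen_vars:
  "ideal_gen (var ` X) = (monomial_ideal {w. \<exists>x\<in>X. 0 < w x} :: ('v::finite, 'k::field) mpoly set)"
proof -
  have "(var ` X :: ('v, 'k) mpoly set) = xpow ` (\<lambda>v z. if z = v then 1 else 0) ` X"
    by (simp add: var_xpow image_image)
  moreover have "(\<lambda>z. if z = v then 1 else 0) \<le> w \<longleftrightarrow> 0 < w v" for v and w :: "'v \<Rightarrow> nat"
    by (auto simp: le_fun_def Suc_le_eq)
  ultimately show ?thesis by (simp add: ideal_gen_xpow)
qed

lemma ideal_mult_monomial:
  assumes U: "upclosed U" and W: "upclosed W"
  shows "ideal_mult (monomial_ideal U) (monomial_ideal W) =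
    (monomial_ideal {\<lambda>z. u z + w z | u w. u \<in> U \<and> w \<in> W} :: ('v::finite, 'k::field) mpoly set)"
    (is "_ = monomial_ideal ?UW")
  unfolding ideal_mult_def ideal_gen_def
proof
  have up: "upclosed ?UW" unfolding upclosed_def
  proof (intro allI impI)
    fix f g :: "'v \<Rightarrow> nat" assume "f \<in> ?UW" and fg: "f \<le> g"
    then obtain u w where uw: "f = (\<lambda>z. u z + w z)" "u \<in> U" "w \<in> W" by blast
    have "w z \<le> g z - u z" for z using le_funD[OF fg, of z] uw(1) by simp
    then have "w \<le> (\<lambda>z. g z - u z)" by (simp add: le_fun_def)
    then have "(\<lambda>z. g z - u z) \<in> W" using W uw(3) unfolding upclosed_def by blast
    moreover have "u z \<le> g z" for z using le_funD[OF fg, of z] uw(1) by simp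
    then have "g = (\<lambda>z. u z + (g z - u z))" by simp
    ultimately show "g \<in> ?UW"
      using uw(2) by (intro CollectI exI[of _ u] exI[of _ "\<lambda>z. g z - u z"]) simp
  qed
  show "ideal.span {f * g |f g. f \<in> monomial_ideal U \<and> g \<in> monomial_ideal W} \<subseteq>
      (monomial_ideal ?UW :: ('v, 'k) mpoly set)"
  proof (rule ideal.span_minimal[OF _ monomial_ideal_subspace[OF up]])
    have "f * g \<in> monomial_ideal ?UW" if f: "f \<in> monomial_ideal U" and g: "g \<in> monomial_ideal W"
      for f g :: "('v, 'k) mpoly"
      unfolding monomial_ideal_def
    proof (intro CollectI ballI)
      fix m assume "m \<in> Poly_Mapping.keys (f * g)"
      then obtain a b where m: "m = a + b" "a \<in> Poly_Mapping.keys f" "b \<in> Poly_Mapping.keys g"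
        using keys_mult by blast
      have "Poly_Mapping.lookup a \<in> U" "Poly_Mapping.lookup b \<in> W"
        using f g m(2,3) unfolding monomial_ideal_def by simp_all
      then show "\<exists>u w. Poly_Mapping.lookup m = (\<lambda>z. u z + w z) \<and> u \<in> U \<and> w \<in> W"
        unfolding m(1) lookup_add_fun by blast
    qed
    then show "{f * g |f g. f \<in> monomial_ideal U \<and> g \<in> monomial_ideal W} \<subseteq>
      (monomial_ideal ?UW :: ('v, 'k) mpoly set)" by blast
  qed
  show "(monomial_ideal ?UW :: ('v, 'k) mpoly set) \<subseteq>
      ideal.span {f * g |f g. f \<in> monomial_ideal U \<and> g \<in> monomial_ideal W}"
  proof (rule monomial_idealI)
    fix m and c :: 'k assume "Poly_Mapping.lookup m \<in> ?UW"
    then obtain u w where uw: "Poly_Mapping.lookup m = (\<lambda>z. u z + w z)" "u \<in> U" "w \<in> W" by blast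
    have "m = Abs_poly_mapping u + Abs_poly_mapping w"
      by (intro poly_mapping_eqI) (simp add: lookup_add uw(1))
    then have eq: "Poly_Mapping.single m c = xpow u * Poly_Mapping.single (Abs_poly_mapping w) c"
      unfolding xpow_def mult_single by simp
    have "xpow u \<in> (monomial_ideal U :: ('v, 'k) mpoly set)" using uw(2) by (simp add: xpow_in_monomial_ideal)
    moreover have "Poly_Mapping.single (Abs_poly_mapping w) c \<in> (monomial_ideal W :: ('v, 'k) mpoly set)"
      using uw(3) unfolding monomial_ideal_def by simp
    ultimately have "Poly_Mapping.single m c \<in>
        {f * g |f g. f \<in> (monomial_ideal U :: ('v, 'k) mpoly set) \<and> g \<in> monomial_ideal W}"
      unfolding eq by blast
    then show "Poly_Mapping.single m c \<in>
        ideal.span {f * g |f g. f \<in> (monomial_ideal U :: ('v, 'k) mpoly set) \<and> g \<in> monomial_ideal W}"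
      by (rule ideal.span_base)
  qed simp
qed

lemma upclosed_kcover: "upclosed {w. kcover E k w}"
  unfolding upclosed_def using kcover_mono by blast

section \<open>Ordinary powers of the cover ideal in terms of k-covers\<close>

context finite_bipartite_graph
begin

lemma cover_ideal_kcover:
  "cover_ideal E = (monomial_ideal {w. kcover E 1 w} :: ('v, 'k::field) mpoly set)"
proof -
  have "kcover E 1 w \<longleftrightarrow> (\<forall>e\<in>E. \<exists>x\<in>e. 0 < w x)" for w
  proof
    assume w: "kcover E 1 w"
    show "\<forall>e\<in>E. \<exists>x\<in>e. 0 < w x"
    proof
      fix e assume e: "e \<in> E"
      obtain a b where ab: "e = {a, b}" using edge[OF e] by blast
      have "1 \<le> w a + w b" using kcoverD[OF w] e unfolding ab .
      then show "\<exists>x\<in>e. 0 < w x" unfolding ab by auto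
    qed
  next
    assume w: "\<forall>e\<in>E. \<exists>x\<in>e. 0 < w x"
    show "kcover E 1 w" unfolding kcover_def
    proof (intro allI impI)
      fix x y assume "{x, y} \<in> E"
      then show "1 \<le> w x + w y" using bspec[OF w, of "{x, y}"] by auto
    qed
  qed
  then show ?thesis unfolding cover_ideal_def ideal_gen_vars by (auto simp: monomial_ideal_def)
qed

text \<open>A \<open>(k + 1)\<close>-cover \<open>f\<close> is the sum of a \<open>k\<close>-cover and the indicator function of the cover
  \<open>{a \<in> A. f a > 0} \<union> {b \<in> B. f b > k}\<close>; hence powers and symbolic powers of the cover ideal agree.\<close>

lemma kcover_Suc:
  "{w. kcover E (Suc k) w} = {\<lambda>z. u z + w z | u w. u \<in> {w. kcover E 1 w} \<and> w \<in> {w. kcover E k w}}"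
proof (intro equalityI subsetI)
  fix f assume "f \<in> {w. kcover E (Suc k) w}"
  then have f: "kcover E (Suc k) f" by simp
  define u where "u z = (if z \<in> A \<and> 0 < f z \<or> z \<in> B \<and> k < f z then 1 else 0::nat)" for z
  have u_le: "u z \<le> f z" for z unfolding u_def by auto
  \<comment> \<open>Both ends of an edge may lose a unit, but only if the end in \<open>B\<close>
    carries more than \<open>k\<close>, and what remains there is then at least \<open>k\<close> by
    itself.\<close>
  have AB: "1 \<le> u x + u y \<and> k \<le> (f x - u x) + (f y - u y)" if "{x, y} \<in> E" "x \<in> A" for x y
  proof -
    have "y \<in> B" "y \<notin> A" "x \<notin> B" using edge_AB[OF that] that disj by auto
    then show ?thesis using kcoverD[OF f that(1)] that(2) unfolding u_def by auto
  qed
  have all: "1 \<le> u x + u y \<and> k \<le> (f x - u x) + (f y - u y)" if "{x, y} \<in> E" for x y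
  proof (cases "x \<in> A")
    case True
    then show ?thesis using AB that by blast
  next
    case False
    then have "y \<in> A" using edge[OF that] by (auto simp: doubleton_eq_iff)
    then show ?thesis using AB[of y x] that by (simp add: insert_commute add.commute)
  qed
  then have "kcover E 1 u" "kcover E k (\<lambda>z. f z - u z)" unfolding kcover_def by blast+
  moreover have "f = (\<lambda>z. u z + (f z - u z))" using u_le by simp
  ultimately show "f \<in> {\<lambda>z. u z + w z | u w. u \<in> {w. kcover E 1 w} \<and> w \<in> {w. kcover E k w}}"
    by (intro CollectI exI[of _ u] exI[of _ "\<lambda>z. f z - u z"]) simp
next
  fix f assume "f \<in> {\<lambda>z. u z + w z | u w. u \<in> {w. kcover E 1 w} \<and> w \<in> {w. kcover E k w}}"
  then obtain u w where uw: "f = (\<lambda>z. u z + w z)" "kcover E 1 u" "kcover E k w" by blast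
  have "Suc k \<le> f x + f y" if "{x, y} \<in> E" for x y
    using kcoverD[OF uw(2) that] kcoverD[OF uw(3) that] unfolding uw(1) by simp
  then show "f \<in> {w. kcover E (Suc k) w}" unfolding kcover_def by blast
qed

lemma ideal_power_cover_ideal:
  "ideal_power (cover_ideal E) k = (monomial_ideal {w. kcover E k w} :: ('v, 'k::field) mpoly set)"
proof (induction k)
  case 0
  then show ?case by (simp add: monomial_ideal_def kcover_def)
next
  case (Suc k)
  show ?case by (simp only: ideal_power.simps Suc.IH)
      (simp only: cover_ideal_kcover ideal_mult_monomial[OF upclosed_kcover upclosed_kcover] kcover_Suc)
qed

end

section \<open>Colon ideals of monomial ideals and linear quotients\<close>

lemma ideal_colon_principal:
  assumes "ideal.subspace I"
  shows "ideal_colon I (ideal_gen {u}) = {f. f * u \<in> I}"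
proof (intro equalityI subsetI)
  fix f assume "f \<in> ideal_colon I (ideal_gen {u})"
  moreover have "u \<in> ideal_gen {u}" unfolding ideal_gen_def by (simp add: ideal.span_base)
  ultimately show "f \<in> {f. f * u \<in> I}" unfolding ideal_colon_def by simp
next
  fix f assume f: "f \<in> {f. f * u \<in> I}"
  show "f \<in> ideal_colon I (ideal_gen {u})"
    unfolding ideal_colon_def
  proof (intro CollectI ballI)
    fix g assume "g \<in> ideal_gen {u}"
    then obtain h where g: "g = h * u" unfolding ideal_gen_def ideal.span_singleton by blast
    have "h * (f * u) \<in> I" by (rule ideal.subspace_scale[OF assms]) (use f in simp)
    then show "f * g \<in> I" unfolding g by (simp only: mult.left_commute)
  qed
qed

lemma mult_xpow_in_iff:
  fixes f :: "('v::finite, 'k::field) mpoly"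
  shows "f * xpow w \<in> ideal_gen (xpow ` W) \<longleftrightarrow>
    (\<forall>m\<in>Poly_Mapping.keys f. \<exists>a\<in>W. \<forall>z. a z \<le> Poly_Mapping.lookup m z + w z)"
proof -
  have keys: "Poly_Mapping.keys (f * xpow w) = (\<lambda>m. m + Abs_poly_mapping w) ` Poly_Mapping.keys f"
  proof (intro equalityI subsetI)
    fix m assume "m \<in> Poly_Mapping.keys (f * xpow w)"
    then show "m \<in> (\<lambda>m. m + Abs_poly_mapping w) ` Poly_Mapping.keys f"
      using keys_mult[of f "xpow w"] by auto
  next
    fix m assume "m \<in> (\<lambda>m. m + Abs_poly_mapping w) ` Poly_Mapping.keys f"
    then show "m \<in> Poly_Mapping.keys (f * xpow w)"
      by (auto simp: in_keys_iff xpow_def lookup_mult_single)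
  qed
  show ?thesis unfolding ideal_gen_xpow by (simp add: monomial_ideal_def keys lookup_add le_fun_def)
qed

lemma xpow_in_ideal_gen:
  "(xpow w :: ('v::finite, 'k::field) mpoly) \<in> ideal_gen (xpow ` W) \<longleftrightarrow> (\<exists>a\<in>W. a \<le> w)"
  by (simp add: ideal_gen_xpow xpow_in_monomial_ideal)

text \<open>A monomial of the colon ideal comes from an earlier \<open>a\<close>, and
  \<open>lq_order\<close> replaces \<open>a\<close> by a variable dividing that monomial. The case
  \<open>i = 0\<close>, with both sides zero, is included for later use in
  \<open>linear_colons\<close>.\<close>

lemma lq_colon:
  assumes "lq_order ws" "i < length ws"
  shows "{f. f * xpow (ws ! i) \<in> ideal_gen (xpow ` set (take i ws))} =
    (ideal_gen (var ` {t. \<exists>w'\<in>set (take i ws). w' \<le> (ws ! i)(t := Suc ((ws ! i) t))})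
      :: ('v::finite, 'k::field) mpoly set)"
    (is "_ = ideal_gen (var ` ?X)")
proof -
  have "(\<exists>a\<in>set (take i ws). \<forall>z. a z \<le> g z + (ws ! i) z) \<longleftrightarrow> (\<exists>x\<in>?X. 0 < g x)" for g
  proof
    assume "\<exists>a\<in>set (take i ws). \<forall>z. a z \<le> g z + (ws ! i) z"
    then obtain a where a: "a \<in> set (take i ws)" "\<And>z. a z \<le> g z + (ws ! i) z" by blast
    then obtain w' t where w': "w' \<in> set (take i ws)" "(ws ! i) t < a t"
      "w' \<le> (ws ! i)(t := Suc ((ws ! i) t))"
      using assms unfolding lq_order_def by blast
    then have "0 < g t" using a(2)[of t] by simp
    then show "\<exists>x\<in>?X. 0 < g x" using w' by blast
  next
    assume "\<exists>x\<in>?X. 0 < g x"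
    then obtain t w' where t: "0 < g t" "w' \<in> set (take i ws)" "w' \<le> (ws ! i)(t := Suc ((ws ! i) t))"
      by blast
    have "w' z \<le> g z + (ws ! i) z" for z
      using le_funD[OF t(3), of z] t(1) by (cases "z = t") auto
    then show "\<exists>a\<in>set (take i ws). \<forall>z. a z \<le> g z + (ws ! i) z" using t(2) by blast
  qed
  then show ?thesis unfolding mult_xpow_in_iff ideal_gen_vars
    by (simp add: monomial_ideal_def)
qed

lemma subspace_ideal_gen: "ideal.subspace (ideal_gen S)"
  unfolding ideal_gen_def by (rule ideal.subspace_span)

lemma lq_linear_quotients:
  assumes "lq_set {w. min_kcover E k w}"
  shows "linear_quotients (monomial_ideal {w. kcover E k w} :: ('v::finite, 'k::field) mpoly set)"
proof -
  obtain ws where ws: "distinct ws" "set ws = {w. min_kcover E k w}" "lq_order ws"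
    using assms unfolding lq_set_def by blast
  have gens: "minimal_monomial_generators (monomial_ideal {w. kcover E k w} :: ('v, 'k) mpoly set)
      (xpow ` set ws)"
    unfolding minimal_monomial_generators_def
  proof (intro conjI allI impI ballI)
    show "is_monomial u" if "u \<in> xpow ` set ws" for u :: "('v, 'k) mpoly"
      using that unfolding xpow_def is_monomial_def by blast
    have "{w. kcover E k w} = {w. \<exists>a\<in>set ws. a \<le> w}"
      unfolding ws(2) using min_kcover_exists kcover_mono unfolding min_kcover_def by fast
    then show "ideal_gen (xpow ` set ws) = (monomial_ideal {w. kcover E k w} :: ('v, 'k) mpoly set)"
      unfolding ideal_gen_xpow by simp
    then have I: "ideal_gen (xpow ` set ws) = (monomial_ideal {w. kcover E k w} :: ('v, 'k) mpoly set)" .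
    fix T :: "('v, 'k) mpoly set" assume T: "T \<subset> xpow ` set ws"
    then obtain w where w: "w \<in> set ws" "xpow w \<notin> T" by blast
    obtain W where W: "W \<subseteq> set ws" "T = xpow ` W" using T by (meson psubsetE subset_image_iff)
    show "ideal_gen T \<noteq> (monomial_ideal {w. kcover E k w} :: ('v, 'k) mpoly set)"
    proof
      assume "ideal_gen T = (monomial_ideal {w. kcover E k w} :: ('v, 'k) mpoly set)"
      moreover have "kcover E k w" using w(1) unfolding ws(2) min_kcover_def by blast
      ultimately have "(xpow w :: ('v, 'k) mpoly) \<in> ideal_gen (xpow ` W)"
        unfolding W(2) by (simp add: xpow_in_monomial_ideal)
      then obtain a where a: "a \<in> W" "a \<le> w" unfolding xpow_in_ideal_gen by blast
      have "a = w" using a W(1) w(1) unfolding ws(2) min_kcover_def by blast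
      then show False using a(1) w(2) W(2) by blast
    qed
  qed
  show ?thesis unfolding linear_quotients_def
  proof (intro exI conjI allI impI)
    show "distinct (map xpow ws :: ('v, 'k) mpoly list)"
      using ws(1) by (auto simp: distinct_map inj_on_def xpow_inject)
    show "minimal_monomial_generators (monomial_ideal {w. kcover E k w})
        (set (map xpow ws :: ('v, 'k) mpoly list))"
      using gens by simp
    fix i assume i: "1 \<le> i \<and> i < length (map xpow ws :: ('v, 'k) mpoly list)"
    then show "ideal_colon (ideal_gen (set (take i (map xpow ws)))) (ideal_gen {map xpow ws ! i}) =
        (ideal_gen (var ` {t. \<exists>w'\<in>set (take i ws). w' \<le> (ws ! i)(t := Suc ((ws ! i) t))})
          :: ('v, 'k) mpoly set)"
      by (simp add: ideal_colon_principal[OF subspace_ideal_gen] take_map lq_colon[OF ws(3)])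
  qed
qed

section \<open>From linear quotients of J(G) to exchanges of minimal covers\<close>

definition indic :: "'v set \<Rightarrow> 'v \<Rightarrow> nat" where
  "indic C z = (if z \<in> C then 1 else 0)"

context finite_bipartite_graph
begin

lemma kcover_indic_support:
  assumes "kcover E 1 a"
  shows "\<exists>C. min_cover E C \<and> indic C \<le> a"
proof -
  have "\<exists>x\<in>e. x \<in> {z. 0 < a z}" if e: "e \<in> E" for e
  proof -
    obtain x y where xy: "e = {x, y}" using edge[OF e] by blast
    have "1 \<le> a x + a y" using kcoverD[OF assms] e unfolding xy .
    then show ?thesis unfolding xy by auto
  qed
  then obtain C where "C \<subseteq> {z. 0 < a z}" "min_cover E C"
    using min_cover_exists[OF simple, of "{z. 0 < a z}"] by blast
  then show ?thesis unfolding indic_def by (intro exI[of _ C]) (auto simp: le_fun_def Suc_le_eq)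
qed

lemma kcover_indic:
  assumes "min_cover E C"
  shows "kcover E 1 (indic C)"
  unfolding kcover_def indic_def using min_cover_hit[OF assms] by fastforce

lemma min_kcover_indic:
  assumes C: "min_cover E C"
  shows "min_kcover E 1 (indic C)"
  unfolding min_kcover_def
proof (intro conjI allI impI)
  show "kcover E 1 (indic C)" using C by (rule kcover_indic)
  fix a assume a: "kcover E 1 a" "a \<le> indic C"
  obtain D where D: "min_cover E D" "indic D \<le> a" using kcover_indic_support[OF a(1)] by blast
  have DC: "indic D z \<le> indic C z" for z using D(2) a(2) by (metis le_funD order_trans)
  have "D \<subseteq> C"
  proof
    fix z assume "z \<in> D" then show "z \<in> C" using DC[of z] unfolding indic_def by (auto split: if_splits)
  qed
  then have "D = C" using D(1) C min_cover_antichain by blast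
  then show "a = indic C" using D(2) a(2) by simp
qed

lemma min_kcover_is_indic:
  assumes "min_kcover E 1 a"
  shows "\<exists>C. min_cover E C \<and> a = indic C"
proof -
  obtain C where "min_cover E C" "indic C \<le> a"
    using kcover_indic_support assms unfolding min_kcover_def by blast
  then show ?thesis using assms kcover_indic unfolding min_kcover_def by blast
qed

lemma linear_quotients_cover_exchange:
  assumes "linear_quotients (monomial_ideal {w. kcover E 1 w} :: ('v, 'k::field) mpoly set)"
  shows "cover_exchange E"
proof -
  let ?I = "monomial_ideal {w. kcover E 1 w} :: ('v, 'k) mpoly set"
  obtain us :: "('v, 'k) mpoly list" where us: "distinct us" "minimal_monomial_generators ?I (set us)"
    and colon: "\<And>i. 1 \<le> i \<Longrightarrow> i < length us \<Longrightarrow>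
      \<exists>X. ideal_colon (ideal_gen (set (take i us))) (ideal_gen {us ! i}) = ideal_gen (var ` X)"
    using assms unfolding linear_quotients_def by blast
  have gen: "ideal_gen (set us) = ?I" and min: "\<And>T. T \<subset> set us \<Longrightarrow> ideal_gen T \<noteq> ?I"
    using us(2) unfolding minimal_monomial_generators_def by blast+
  define ws :: "('v \<Rightarrow> nat) list" where "ws = map (\<lambda>u. SOME w. u = xpow w) us"
  have us_ws: "us = map xpow ws"
  proof -
    have "xpow (SOME w. u = xpow w) = u" if u: "u \<in> set us" for u
    proof -
      have "is_monomial u" using u us(2) unfolding minimal_monomial_generators_def by blast
      then have "\<exists>w. u = xpow w" using is_monomialE by metis
      then show ?thesis by (metis (mono_tags, lifting) someI_ex)
    qed
    then show ?thesis unfolding ws_def by (simp add: map_idI comp_def)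
  qed
  have dist: "distinct ws" using us(1) unfolding us_ws by (simp add: distinct_map)
  have set_us: "set us = xpow ` set ws" unfolding us_ws by simp
  have above: "kcover E 1 w \<longleftrightarrow> (\<exists>a\<in>set ws. a \<le> w)" for w
  proof -
    have "(xpow w :: ('v, 'k) mpoly) \<in> ideal_gen (set us) \<longleftrightarrow> kcover E 1 w"
      unfolding gen by (simp add: xpow_in_monomial_ideal)
    then show ?thesis unfolding set_us xpow_in_ideal_gen by blast
  qed
  \<comment> \<open>Comparable exponents would make the generator of the larger one redundant,
    against the minimality of the generating set.\<close>
  have anti: "a = b" if ab: "a \<in> set ws" "b \<in> set ws" "b \<le> a" for a b
  proof (rule ccontr)
    assume ne: "a \<noteq> b"
    let ?T = "xpow ` (set ws - {a}) :: ('v, 'k) mpoly set"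
    have "xpow a \<in> set us" "xpow a \<notin> ?T" "?T \<subseteq> set us"
      unfolding set_us using ab(1) by (auto simp: xpow_inject)
    then have "?T \<subset> set us" by blast
    then have "ideal_gen ?T \<noteq> ideal_gen (set us)" unfolding gen by (rule min)
    moreover have "(\<exists>c\<in>set ws - {a}. c \<le> w) \<longleftrightarrow> (\<exists>c\<in>set ws. c \<le> w)" for w
      using ab ne by (metis DiffE DiffI empty_iff insert_iff order_trans)
    ultimately show False unfolding set_us ideal_gen_xpow by simp
  qed
  have ws_min: "set ws = {w. min_kcover E 1 w}"
  proof (intro equalityI subsetI)
    fix a assume a: "a \<in> set ws"
    show "a \<in> {w. min_kcover E 1 w}" unfolding min_kcover_def
    proof (intro CollectI conjI allI impI)
      show "kcover E 1 a" using a above by blast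
      fix w assume w: "kcover E 1 w" "w \<le> a"
      then obtain b where b: "b \<in> set ws" "b \<le> w" using above by blast
      then have "a = b" using w(2) by (intro anti a) auto
      then show "w = a" using b(2) w(2) by simp
    qed
  next
    fix a assume "a \<in> {w. min_kcover E 1 w}"
    then have a: "kcover E 1 a" "\<And>b. kcover E 1 b \<Longrightarrow> b \<le> a \<Longrightarrow> b = a"
      unfolding min_kcover_def by simp_all
    obtain b where b: "b \<in> set ws" "b \<le> a" using a(1) above by blast
    have "kcover E 1 b" using b(1) above by blast
    then show "a \<in> set ws" using a(2) b by blast
  qed
  have step: "\<exists>M t. min_cover E M \<and> t \<in> M \<and> M \<subseteq> insert t D \<and> t \<in> C - D"
    if D: "min_cover E D" and ij: "j < i" "i < length ws" "ws ! j = indic C" "ws ! i = indic D" for C D i j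
  proof -
    obtain X where X: "ideal_colon (ideal_gen (set (take i us))) (ideal_gen {us ! i}) =
        (ideal_gen (var ` X) :: ('v, 'k) mpoly set)"
      using colon[of i] ij(1,2) us_ws by auto
    have take: "set (take i us) = xpow ` set (take i ws)" unfolding us_ws by (simp add: take_map)
    have in_X: "f \<in> (ideal_gen (var ` X) :: ('v, 'k) mpoly set) \<longleftrightarrow>
        f * xpow (indic D) \<in> ideal_gen (xpow ` set (take i ws))" for f
      unfolding X[symmetric] take ideal_colon_principal[OF subspace_ideal_gen]
      using ij(2,4) us_ws by simp
    have jt: "indic C \<in> set (take i ws)" 
      unfolding in_set_conv_nth using ij by (intro exI[of _ j]) simp
    \<comment> \<open>The product of the variables in \<open>C - D\<close> carries the monomial of
      \<open>D\<close> to a multiple of the earlier monomial of \<open>C\<close>, so it lies in the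
      colon ideal and a variable of \<open>X\<close> divides it.\<close>
    have "xpow (\<lambda>z. indic C z - indic D z) \<in> (ideal_gen (var ` X) :: ('v, 'k) mpoly set)"
      unfolding in_X mult_xpow_in_iff using jt by (auto intro!: bexI[of _ "indic C"])
    then obtain t where t: "t \<in> X" "t \<in> C - D"
      unfolding ideal_gen_vars xpow_in_monomial_ideal by (auto simp: indic_def split: if_splits)
    have "var t \<in> (ideal_gen (var ` X) :: ('v, 'k) mpoly set)"
      using t(1) unfolding ideal_gen_def by (simp add: ideal.span_base)
    then obtain a where a: "a \<in> set (take i ws)" "\<And>z. a z \<le> (if z = t then 1 else 0) + indic D z"
      unfolding in_X mult_xpow_in_iff var_xpow by auto
    have "a \<in> set ws" using a(1) by (rule in_set_takeD)
    then obtain M where M: "min_cover E M" "a = indic M" using ws_min min_kcover_is_indic by blast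
    have sub: "M \<subseteq> insert t D"
    proof
      fix z assume "z \<in> M"
      then show "z \<in> insert t D" using a(2)[of z] unfolding M(2) indic_def by (auto split: if_splits)
    qed
    \<comment> \<open>The generator of \<open>M\<close> occurs before position \<open>i\<close> and
      the list is distinct. By the antichain property \<open>M\<close> then is not inside
      \<open>D\<close>, which leaves \<open>t\<close> as its extra vertex.\<close>
    have "M \<noteq> D"
    proof
      assume "M = D"
      obtain l where l: "l < i" "ws ! l = a" using a(1) by (auto simp: in_set_conv_nth)
      then have "ws ! l = ws ! i" using M(2) \<open>M = D\<close> ij(4) by simp
      then show False using l(1) ij(2) dist by (simp add: nth_eq_iff_index_eq)
    qed
    then have "t \<in> M" using sub min_cover_antichain[OF M(1) D] by blast
    then show ?thesis using M(1) sub t(2) by blast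
  qed
  show ?thesis unfolding cover_exchange_def
  proof (intro allI impI)
    fix C D assume C: "min_cover E C" and D: "min_cover E D" and ne: "C \<noteq> D"
    have "indic C \<in> set ws" "indic D \<in> set ws" using min_kcover_indic C D ws_min by blast+
    then obtain i j where ij: "i < length ws" "ws ! i = indic C" "j < length ws" "ws ! j = indic D"
      by (metis in_set_conv_nth)
    have "indic C \<noteq> indic D"
    proof
      assume "indic C = indic D"
      then have "z \<in> C \<longleftrightarrow> z \<in> D" for z using fun_cong[of "indic C" "indic D" z]
        unfolding indic_def by (auto split: if_splits)
      then show False using ne by blast
    qed
    then have "i \<noteq> j" using ij by auto
    then consider "i < j" | "j < i" by linarith
    then show "\<exists>M t. min_cover E M \<and> t \<in> M \<and>
        (M \<subseteq> insert t D \<and> t \<in> C - D \<or> M \<subseteq> insert t C \<and> t \<in> D - C)"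
    proof cases
      case 1
      then show ?thesis using step[OF D 1 ij(3,2,4)] by blast
    next
      case 2
      then show ?thesis using step[OF C 2 ij(1,4,2)] by blast
    qed
  qed
qed

end


section \<open>Exchange from linear first syzygies\<close>

text \<open>Where this is applied, degrees leave a single way to split the exponent, so a
  coefficient of a product is itself a product.\<close>

lemma lookup_mult_unique:
  fixes f g :: "('v, 'k::field) mpoly"
  assumes "a0 + b0 = k"
    and "\<And>a b. a \<in> Poly_Mapping.keys f \<Longrightarrow> b \<in> Poly_Mapping.keys g \<Longrightarrow> a + b = k \<Longrightarrow> a = a0 \<and> b = b0"
  shows "Poly_Mapping.lookup (f * g) k = Poly_Mapping.lookup f a0 * Poly_Mapping.lookup g b0"
proof -
  have "f * g = (\<Sum>a\<in>Poly_Mapping.keys f. \<Sum>b\<in>Poly_Mapping.keys g.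
      Poly_Mapping.single (a + b) (Poly_Mapping.lookup f a * Poly_Mapping.lookup g b))"
    by (subst poly_sum_singles[of f], subst poly_sum_singles[of g])
      (simp add: sum_product mult_single)
  then have "Poly_Mapping.lookup (f * g) k =
      (\<Sum>a\<in>Poly_Mapping.keys f. \<Sum>b\<in>Poly_Mapping.keys g.
        if a + b = k then Poly_Mapping.lookup f a * Poly_Mapping.lookup g b else 0)"
    by (simp add: lookup_sum lookup_single when_def)
  also have "\<dots> = (\<Sum>a\<in>Poly_Mapping.keys f. \<Sum>b\<in>Poly_Mapping.keys g.
        if b = b0 then (if a = a0 then Poly_Mapping.lookup f a * Poly_Mapping.lookup g b else 0) else 0)"
  proof (intro sum.cong refl)
    fix a b assume "a \<in> Poly_Mapping.keys f" "b \<in> Poly_Mapping.keys g"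
    then show "(if a + b = k then Poly_Mapping.lookup f a * Poly_Mapping.lookup g b else 0) =
        (if b = b0 then (if a = a0 then Poly_Mapping.lookup f a * Poly_Mapping.lookup g b else 0) else 0)"
      using assms(1) assms(2)[of a b] by (cases "a + b = k") auto
  qed
  also have "\<dots> = Poly_Mapping.lookup f a0 * Poly_Mapping.lookup g b0"
    by (cases "Poly_Mapping.lookup g b0 = 0") (auto simp: in_keys_iff sum.delta')
  finally show ?thesis .
qed

lemma lookup_mult_none:
  fixes f g :: "('v, 'k::field) mpoly"
  assumes "\<And>a b. a \<in> Poly_Mapping.keys f \<Longrightarrow> b \<in> Poly_Mapping.keys g \<Longrightarrow> a + b \<noteq> k"
  shows "Poly_Mapping.lookup (f * g) k = 0"
proof (rule ccontr)
  assume "Poly_Mapping.lookup (f * g) k \<noteq> 0"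
  then have "k \<in> Poly_Mapping.keys (f * g)" by (simp add: in_keys_iff)
  then obtain a b where "k = a + b" "a \<in> Poly_Mapping.keys f" "b \<in> Poly_Mapping.keys g"
    using keys_mult by blast
  then show False using assms by blast
qed

lemma mon_degree_eq_0: "mon_degree m = 0 \<longleftrightarrow> m = 0" for m :: "'v::finite \<Rightarrow>\<^sub>0 nat"
  by (auto simp: mon_degree_sum poly_mapping_eq_iff fun_eq_iff)

lemma mon_degree_eq_1:
  fixes m :: "'v::finite \<Rightarrow>\<^sub>0 nat"
  assumes "mon_degree m = 1"
  obtains i where "m = Poly_Mapping.single i 1"
proof -
  have "sum (Poly_Mapping.lookup m) UNIV = Suc 0" using assms by (simp add: mon_degree_sum)
  then obtain i where i: "Poly_Mapping.lookup m i = Suc 0" "\<And>j. j \<noteq> i \<Longrightarrow> Poly_Mapping.lookup m j = 0"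
    using sum_eq_Suc0_iff[of UNIV "Poly_Mapping.lookup m"] by auto
  have "m = Poly_Mapping.single i 1"
    using i by (intro poly_mapping_eqI) (auto simp: lookup_single when_def)
  then show thesis by (rule that)
qed

lemma mon_degree_Abs: "mon_degree (Abs_poly_mapping w) = sum w UNIV" for w :: "'v::finite \<Rightarrow> nat"
  by (simp add: mon_degree_sum)

lemma degree_component:
  "ideal_gen {f \<in> monomial_ideal U. homogeneous l f} =
    (ideal_gen (xpow ` {w \<in> U. sum w UNIV = l}) :: ('v::finite, 'k::field) mpoly set)"
proof
  let ?W = "{w \<in> U. sum w UNIV = l}"
  have "xpow ` ?W \<subseteq> {f \<in> monomial_ideal U. homogeneous l (f :: ('v, 'k) mpoly)}"
    by (auto simp: xpow_in_monomial_ideal homogeneous_def mon_degree_Abs)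
  then show "(ideal_gen (xpow ` ?W) :: ('v, 'k) mpoly set) \<subseteq> ideal_gen {f \<in> monomial_ideal U. homogeneous l f}"
    unfolding ideal_gen_def by (rule ideal.span_mono)
  have "f \<in> ideal_gen (xpow ` ?W)" if f: "f \<in> monomial_ideal U" "homogeneous l f" for f :: "('v, 'k) mpoly"
    unfolding ideal_gen_xpow monomial_ideal_def
  proof (intro CollectI ballI)
    fix m assume m: "m \<in> Poly_Mapping.keys f"
    have "Poly_Mapping.lookup m \<in> U" using f(1) m unfolding monomial_ideal_def by blast
    moreover have "sum (Poly_Mapping.lookup m) UNIV = l"
      using f(2) m unfolding homogeneous_def mon_degree_sum by blast
    ultimately show "\<exists>a\<in>?W. a \<le> Poly_Mapping.lookup m" by blast
  qed
  then show "(ideal_gen {f \<in> monomial_ideal U. homogeneous l f} :: ('v, 'k) mpoly set) \<subseteq> ideal_gen (xpow ` ?W)"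
    unfolding ideal_gen_def[of "{f \<in> monomial_ideal U. homogeneous l f}"]
    by (intro ideal.span_minimal subspace_ideal_gen) blast
qed

lemma homogeneous_monomial_ideal:
  assumes "upclosed U"
  shows "homogeneous_ideal (monomial_ideal U :: ('v::finite, 'k::field) mpoly set)"
  unfolding homogeneous_ideal_def
proof (intro exI conjI ballI)
  have "{w. \<exists>a\<in>U. a \<le> w} = U" using assms unfolding upclosed_def by blast
  then show "(monomial_ideal U :: ('v, 'k) mpoly set) = ideal_gen (xpow ` U)"
    unfolding ideal_gen_xpow by simp
  fix p :: "('v, 'k) mpoly" assume "p \<in> xpow ` U"
  then show "homogeneous (mon_degree (SOME m. m \<in> Poly_Mapping.keys p)) p"
    by (auto simp: homogeneous_def)
qed

lemma mult_mat_vec_sum: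
  assumes "A \<in> carrier_mat n m" "h \<in> carrier_vec m" "r < n"
  shows "(A *\<^sub>v h) $ r = (\<Sum>c<m. A $$ (r, c) * h $ c)"
  using assms by (simp add: scalar_prod_def lessThan_atLeast0)

text \<open>If no such exchange existed, the coefficient at the monomial \<open>lcm(u, v) / v\<close> of the \<open>v\<close>-component
  would vanish on all multiples of the linear syzygies, but not on the syzygy relating \<open>u\<close> and \<open>v\<close>.\<close>

lemma linear_resolution_exchange:
  fixes u v :: "'v::finite \<Rightarrow> nat"
  assumes res: "has_linear_resolution
      (ideal_gen {f \<in> monomial_ideal U. homogeneous l f} :: ('v, 'k::field) mpoly set)"
    and uU: "u \<in> U" "sum u UNIV = l" and vU: "v \<in> U" "sum v UNIV = l" and ne: "u \<noteq> v"
  shows "\<exists>i j. i \<noteq> j \<and> v i < u i \<and> 0 < v j \<and> v(i := Suc (v i), j := v j - 1) \<in> U"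
proof (rule ccontr)
  assume contra: "\<not> ?thesis"
  let ?W = "{w \<in> U. sum w UNIV = l}"
  let ?I = "ideal_gen (xpow ` ?W) :: ('v, 'k) mpoly set"
  obtain a D d where r: "graded_free_resolution ?I a D" and lin: "\<And>i s. s \<in> set (a i) \<Longrightarrow> s = d + i"
    using res unfolding has_linear_resolution_def minimal_graded_free_resolution_def degree_component by blast
  define n where "n = length (a 0)"
  define n1 where "n1 = length (a (Suc 0))"
  define f where "f c = D 0 $$ (0, c)" for c
  define g where "g c s = D (Suc 0) $$ (c, s)" for c s
  have D0: "D 0 \<in> carrier_mat 1 n" and D1: "D (Suc 0) \<in> carrier_mat n n1"
    and hom0: "\<And>c. c < n \<Longrightarrow> homogeneous (a 0 ! c) (f c)"
    and hom1: "\<And>c s m. c < n \<Longrightarrow> s < n1 \<Longrightarrow> m \<in> Poly_Mapping.keys (g c s) \<Longrightarrow>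
      a 0 ! c + mon_degree m = a (Suc 0) ! s"
    and img: "(\<lambda>w. w $ 0) ` mat_image (D 0) = ?I"
    and ker: "mat_kernel (D 0) = mat_image (D (Suc 0))"
    using r unfolding graded_free_resolution_def n_def n1_def f_def g_def by auto
  have deg_f: "mon_degree m = d" if "c < n" "m \<in> Poly_Mapping.keys (f c)" for c m
    using hom0[OF that(1)] that lin[of "a 0 ! c" 0] unfolding homogeneous_def n_def by auto
  have deg_g: "mon_degree m = 1" if "c < n" "s < n1" "m \<in> Poly_Mapping.keys (g c s)" for c s m
    using hom1[OF that] lin[of "a 0 ! c" 0] lin[of "a (Suc 0) ! s" "Suc 0"] that unfolding n_def n1_def by auto
  have fI: "f c \<in> ?I" if c: "c < n" for c
  proof -
    have "(D 0 *\<^sub>v unit_vec n c) $ 0 = (\<Sum>c'<n. f c' * (unit_vec n c $ c'))"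
      unfolding f_def by (rule mult_mat_vec_sum[OF D0]) auto
    also have "\<dots> = (\<Sum>c'<n. if c' = c then f c' else 0)"
      using c by (intro sum.cong) (auto simp: unit_vec_def)
    also have "\<dots> = f c" using c by simp
    finally have "f c = (D 0 *\<^sub>v unit_vec n c) $ 0" ..
    moreover have "D 0 *\<^sub>v unit_vec n c \<in> mat_image (D 0)"
      using D0 unfolding mat_image_def by auto
    ultimately show ?thesis unfolding img[symmetric] by blast
  qed
  have f_above: "\<exists>w\<in>?W. w \<le> Poly_Mapping.lookup m" if "c < n" "m \<in> Poly_Mapping.keys (f c)" for c m
    using fI[OF that(1)] that(2) unfolding ideal_gen_xpow monomial_ideal_def by blast
  have gen: "\<exists>\<beta>. p = (\<Sum>c<n. f c * \<beta> c)" if p: "p \<in> ?I" for p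
  proof -
    obtain h where "h \<in> carrier_vec n" "p = (D 0 *\<^sub>v h) $ 0"
      using p D0 unfolding img[symmetric] mat_image_def by auto
    then have "p = (\<Sum>c<n. f c * (h $ c))" unfolding f_def using mult_mat_vec_sum[OF D0] by simp
    then show ?thesis by blast
  qed
  have col: "(\<Sum>c<n. f c * g c s) = 0" if s: "s < n1" for s
  proof -
    have "D (Suc 0) *\<^sub>v unit_vec n1 s \<in> mat_kernel (D 0)"
      unfolding ker mat_image_def using D1 by auto
    then have "(D 0 *\<^sub>v (D (Suc 0) *\<^sub>v unit_vec n1 s)) $ 0 = 0"
      using D0 unfolding mat_kernel_def by auto
    moreover have "(D 0 *\<^sub>v (D (Suc 0) *\<^sub>v unit_vec n1 s)) $ 0 =
        (\<Sum>c<n. f c * (D (Suc 0) *\<^sub>v unit_vec n1 s) $ c)"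
      unfolding f_def by (rule mult_mat_vec_sum[OF D0]) (use D1 in auto)
    moreover have "(D (Suc 0) *\<^sub>v unit_vec n1 s) $ c = g c s" if c: "c < n" for c
    proof -
      have "(D (Suc 0) *\<^sub>v unit_vec n1 s) $ c = (\<Sum>s'<n1. g c s' * (unit_vec n1 s $ s'))"
        unfolding g_def by (rule mult_mat_vec_sum[OF D1]) (use c in auto)
      also have "\<dots> = (\<Sum>s'<n1. if s' = s then g c s' else 0)"
        using s by (intro sum.cong) (auto simp: unit_vec_def)
      finally show ?thesis using s by simp
    qed
    ultimately show ?thesis by simp
  qed
  define mv where "mv = Abs_poly_mapping v"
  define mu where "mu = Abs_poly_mapping u"
  \<comment> \<open>\<open>Lv\<close> and \<open>Lu\<close> are the exponents of lcm(u, v) / v and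
    lcm(u, v) / u; they define the syzygy relating the two monomials.\<close>
  define Lv where "Lv = Abs_poly_mapping (\<lambda>z. max (u z) (v z) - v z)"
  define Lu where "Lu = Abs_poly_mapping (\<lambda>z. max (u z) (v z) - u z)"
  have L: "Lu + mu = Lv + mv"
    unfolding Lu_def Lv_def mu_def mv_def by (rule poly_mapping_eqI) (simp add: lookup_add)
  have deg_uv: "mon_degree mu = l" "mon_degree mv = l"
    unfolding mu_def mv_def using uU vU by (simp_all add: mon_degree_Abs)
  have deg_L: "mon_degree Lu = mon_degree Lv"
    using arg_cong[OF L, of mon_degree] deg_uv by (simp add: mon_degree_add)
  have "mu \<noteq> mv" using ne unfolding mu_def mv_def by (metis lookup_Abs_finite)
  then have L_ne: "Lu \<noteq> Lv" using L by auto
  have uI: "xpow u \<in> ?I" and vI: "xpow v \<in> ?I" using uU vU unfolding xpow_in_ideal_gen by blast+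
  obtain \<alpha> \<beta> where \<alpha>: "xpow u = (\<Sum>c<n. f c * \<alpha> c)" and \<beta>: "xpow v = (\<Sum>c<n. f c * \<beta> c)"
    using gen[OF uI] gen[OF vI] by blast
  have coeff_v: "Poly_Mapping.lookup (xpow v :: ('v, 'k) mpoly) mv = 1" unfolding xpow_def mv_def by simp
  \<comment> \<open>The monomial of \<open>v\<close> has to occur in some product
    \<open>f c * \<beta> c\<close>, so some \<open>f c\<close> has a term dividing it, while terms
    of elements of the ideal have degree at least \<open>l\<close>.\<close>
  have "d = l"
  proof -
    have "\<exists>c<n. Poly_Mapping.lookup (f c * \<beta> c) mv \<noteq> 0"
    proof (rule ccontr)
      assume "\<not> ?thesis"
      then have "Poly_Mapping.lookup (xpow v :: ('v, 'k) mpoly) mv = 0"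
        unfolding \<beta> lookup_sum by (intro sum.neutral) simp
      then show False using coeff_v by simp
    qed
    then obtain c where c: "c < n" "mv \<in> Poly_Mapping.keys (f c * \<beta> c)" by (auto simp: in_keys_iff)
    then obtain p q where pq: "mv = p + q" "p \<in> Poly_Mapping.keys (f c)" using keys_mult by blast
    obtain w where w: "sum w UNIV = l" "w \<le> Poly_Mapping.lookup p" using f_above[OF c(1) pq(2)] by blast
    have "l \<le> mon_degree p"
      unfolding mon_degree_sum w(1)[symmetric] using w(2) by (intro sum_mono) (simp add: le_fun_def)
    moreover have "mon_degree p + mon_degree q = l" using deg_uv(2) unfolding pq(1) mon_degree_add .
    ultimately show ?thesis using deg_f[OF c(1) pq(2)] by simp
  qed
  \<comment> \<open>The \<open>f c\<close> need not be monomials. \<open>\<phi>\<close> is the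
    functional on the first free module that reads off the \<open>v\<close>-component, as all
    \<open>f c\<close> have degree \<open>l\<close>.\<close>
  define \<phi> where "\<phi> c = Poly_Mapping.lookup (f c) mv" for c
  define h where "h c = \<alpha> c * Poly_Mapping.single Lu 1 - \<beta> c * Poly_Mapping.single Lv 1" for c
  have "(\<Sum>c<n. f c * h c) = xpow u * Poly_Mapping.single Lu 1 - xpow v * Poly_Mapping.single Lv 1"
    unfolding \<alpha> \<beta> h_def by (simp add: sum_distrib_right sum_subtractf right_diff_distrib mult.assoc)
  also have "\<dots> = 0" using L unfolding xpow_def mu_def[symmetric] mv_def[symmetric] mult_single
    by (simp add: add.commute)
  finally have h0: "(\<Sum>c<n. f c * h c) = 0" .
  have "vec n h \<in> mat_kernel (D 0)"
  proof -
    have "(D 0 *\<^sub>v vec n h) $ 0 = (\<Sum>c<n. f c * (vec n h $ c))"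
      unfolding f_def by (rule mult_mat_vec_sum[OF D0]) auto
    then have "(D 0 *\<^sub>v vec n h) $ 0 = 0" using h0 by simp
    then have "D 0 *\<^sub>v vec n h = 0\<^sub>v 1" using D0 by (intro eq_vecI) auto
    then show ?thesis using D0 unfolding mat_kernel_def by auto
  qed
  then obtain t where t: "t \<in> carrier_vec n1" "vec n h = D (Suc 0) *\<^sub>v t"
    using D1 unfolding ker mat_image_def by auto
  have h_eq: "h c = (\<Sum>s<n1. g c s * t $ s)" if c: "c < n" for c
  proof -
    have "h c = (D (Suc 0) *\<^sub>v t) $ c" using c by (simp flip: t(2))
    then show ?thesis unfolding g_def using mult_mat_vec_sum[OF D1 t(1) c] by simp
  qed
  \<comment> \<open>The \<open>\<alpha>\<close> part contributes nothing, since \<open>Lu\<close>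
    and \<open>Lv\<close> are distinct of equal degree and so \<open>Lv\<close> is no multiple of
    \<open>Lu\<close>. The \<open>\<beta>\<close> part leaves constant terms, which add up to the
    coefficient of \<open>xpow v\<close> at its own exponent.\<close>
  have claim1: "(\<Sum>c<n. \<phi> c * Poly_Mapping.lookup (h c) Lv) = - 1"
  proof -
    have "Poly_Mapping.lookup (\<alpha> c * Poly_Mapping.single Lu 1) Lv = 0" for c
    proof (rule lookup_mult_none)
      fix p q assume "q \<in> Poly_Mapping.keys (Poly_Mapping.single Lu (1::'k))"
      then have q: "q = Lu" by simp
      show "p + q \<noteq> Lv"
      proof
        assume "p + q = Lv"
        then have "mon_degree p = 0" using deg_L q mon_degree_add[of p q] by simp
        then show False using \<open>p + q = Lv\<close> q L_ne by (simp add: mon_degree_eq_0)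
      qed
    qed
    moreover have "Poly_Mapping.lookup (\<beta> c * Poly_Mapping.single Lv 1) Lv = Poly_Mapping.lookup (\<beta> c) 0" for c
      using lookup_mult_single[of "\<beta> c" Lv 1 0] by simp
    ultimately have "(\<Sum>c<n. \<phi> c * Poly_Mapping.lookup (h c) Lv) = - (\<Sum>c<n. \<phi> c * Poly_Mapping.lookup (\<beta> c) 0)"
      unfolding h_def by (simp add: lookup_minus sum_negf)
    moreover have "\<phi> c * Poly_Mapping.lookup (\<beta> c) 0 = Poly_Mapping.lookup (f c * \<beta> c) mv" if "c < n" for c
      unfolding \<phi>_def
    proof (rule lookup_mult_unique[symmetric])
      show "mv + 0 = mv" by simp
      fix p q assume p: "p \<in> Poly_Mapping.keys (f c)" and pq: "p + q = mv"
      have "mon_degree p = mon_degree mv" using deg_f[OF that p] deg_uv \<open>d = l\<close> by simp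
      then have "mon_degree q = 0" using mon_degree_add[of p q] pq by simp
      then show "p = mv \<and> q = 0" using pq by (simp add: mon_degree_eq_0)
    qed
    then have "(\<Sum>c<n. \<phi> c * Poly_Mapping.lookup (\<beta> c) 0) = Poly_Mapping.lookup (xpow v :: ('v, 'k) mpoly) mv"
      unfolding \<beta> lookup_sum by simp
    ultimately show ?thesis using coeff_v by simp
  qed
  \<comment> \<open>Compare coefficients at \<open>mv\<close> plus the unit vector of
    \<open>i\<close> in a linear syzygy. A contribution through another variable \<open>j\<close>
    would put the exchanged exponent into \<open>U\<close>, which is excluded; only the
    \<open>v\<close>-component with variable \<open>i\<close> remains.\<close>
  have var_coeff: "(\<Sum>c<n. \<phi> c * Poly_Mapping.lookup (g c s) (Poly_Mapping.single i 1)) = 0"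
    if s: "s < n1" and i: "v i < u i" for s i
  proof -
    let ?e = "Poly_Mapping.single i (1::nat)"
    have "Poly_Mapping.lookup (f c * g c s) (mv + ?e) = \<phi> c * Poly_Mapping.lookup (g c s) ?e" if c: "c < n" for c
      unfolding \<phi>_def
    proof (rule lookup_mult_unique)
      show "mv + ?e = mv + ?e" ..
      fix p q assume p: "p \<in> Poly_Mapping.keys (f c)" and q: "q \<in> Poly_Mapping.keys (g c s)"
        and pq: "p + q = mv + ?e"
      obtain j where j: "q = Poly_Mapping.single j 1" using mon_degree_eq_1 deg_g[OF c s q] by blast
      have look: "Poly_Mapping.lookup p z + (if z = j then 1 else 0) = v z + (if z = i then 1 else 0)" for z
        using arg_cong[OF pq, of "\<lambda>m. Poly_Mapping.lookup m z"]
        by (auto simp: j lookup_add lookup_single when_def mv_def split: if_splits)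
      have "i = j"
      proof (rule ccontr)
        assume ij: "i \<noteq> j"
        have p_eq: "Poly_Mapping.lookup p = v(i := Suc (v i), j := v j - 1)"
        proof
          fix z show "Poly_Mapping.lookup p z = (v(i := Suc (v i), j := v j - 1)) z"
            using look[of z] ij by (auto split: if_splits)
        qed
        obtain w where w: "w \<in> U" "sum w UNIV = l" "w \<le> Poly_Mapping.lookup p" using f_above[OF c p] by blast
        have "w = Poly_Mapping.lookup p"
        proof (rule ccontr)
          assume "w \<noteq> Poly_Mapping.lookup p"
          then obtain z where "w z \<noteq> Poly_Mapping.lookup p z" by blast
          then have "w z < Poly_Mapping.lookup p z"
            using w(3) by (simp add: le_fun_def order.not_eq_order_implies_strict)
          then have "sum w UNIV < sum (Poly_Mapping.lookup p) UNIV"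
            using w(3) by (intro sum_strict_mono_ex1) (auto simp: le_fun_def)
          then show False using w(2) deg_f[OF c p] \<open>d = l\<close> by (simp add: mon_degree_sum)
        qed
        moreover have "0 < v j" using look[of j] ij by auto
        ultimately show False using contra ij i w(1) p_eq by metis
      qed
      then show "p = mv \<and> q = ?e" using pq j by simp
    qed
    then have "(\<Sum>c<n. \<phi> c * Poly_Mapping.lookup (g c s) ?e) = Poly_Mapping.lookup (\<Sum>c<n. f c * g c s) (mv + ?e)"
      unfolding lookup_sum by simp
    then show ?thesis using col[OF s] by simp
  qed
  have "(\<Sum>c<n. \<phi> c * Poly_Mapping.lookup (h c) Lv) = 0"
  proof -
    \<comment> \<open>\<open>q s\<close> is the linear form obtained by applying the functional to
      the syzygy in column \<open>s\<close>. Its variables all have zero coefficient at places where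
      \<open>v i < u i\<close>, and these are the only variables dividing \<open>Lv\<close>.\<close>
    define q where "q s = (\<Sum>c<n. Poly_Mapping.single 0 (\<phi> c) * g c s)" for s
    have scal: "Poly_Mapping.lookup (Poly_Mapping.single 0 x * p) m = x * Poly_Mapping.lookup p m"
      for x :: 'k and p :: "('v, 'k) mpoly" and m
      using lookup_mult_single[of p 0 x m] by (simp add: mult.commute)
    have look_q: "Poly_Mapping.lookup (q s) m = (\<Sum>c<n. \<phi> c * Poly_Mapping.lookup (g c s) m)" for s m
      unfolding q_def lookup_sum scal ..
    have "Poly_Mapping.lookup (q s * t $ s) Lv = 0" if s: "s < n1" for s
    proof (rule lookup_mult_none)
      fix p r assume p: "p \<in> Poly_Mapping.keys (q s)"
      show "p + r \<noteq> Lv"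
      proof
        assume pr: "p + r = Lv"
        have "\<exists>c<n. p \<in> Poly_Mapping.keys (g c s)"
        proof (rule ccontr)
          assume "\<not> ?thesis"
          then have "Poly_Mapping.lookup (q s) p = 0" unfolding look_q
            by (intro sum.neutral) (auto simp: in_keys_iff)
          then show False using p by (simp add: in_keys_iff)
        qed
        then obtain i where i: "p = Poly_Mapping.single i 1" using deg_g s mon_degree_eq_1 by metis
        have "0 < Poly_Mapping.lookup Lv i" unfolding pr[symmetric] i by (simp add: lookup_add)
        then have "v i < u i" unfolding Lv_def by simp
        then have "Poly_Mapping.lookup (q s) p = 0" unfolding look_q i by (rule var_coeff[OF s])
        then show False using p by (simp add: in_keys_iff)
      qed
    qed
    then have "(\<Sum>s<n1. Poly_Mapping.lookup (q s * t $ s) Lv) = 0" by simp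
    moreover have "(\<Sum>s<n1. q s * t $ s) = (\<Sum>c<n. Poly_Mapping.single 0 (\<phi> c) * h c)"
    proof -
      have "(\<Sum>s<n1. q s * t $ s) = (\<Sum>s<n1. \<Sum>c<n. Poly_Mapping.single 0 (\<phi> c) * (g c s * t $ s))"
        unfolding q_def by (simp add: sum_distrib_right mult.assoc)
      also have "\<dots> = (\<Sum>c<n. \<Sum>s<n1. Poly_Mapping.single 0 (\<phi> c) * (g c s * t $ s))" by (rule sum.swap)
      also have "\<dots> = (\<Sum>c<n. Poly_Mapping.single 0 (\<phi> c) * h c)"
        by (intro sum.cong) (auto simp: h_eq sum_distrib_left)
      finally show ?thesis .
    qed
    ultimately have "Poly_Mapping.lookup (\<Sum>c<n. Poly_Mapping.single 0 (\<phi> c) * h c) Lv = 0"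
      by (metis lookup_sum)
    then show ?thesis unfolding lookup_sum scal .
  qed
  then show False using claim1 by simp
qed


section \<open>Linear resolutions from linear quotients\<close>

text \<open>All free modules of the resolution live in this one module of functions on
  \<open>nat\<close>; their ranks are tracked by list lengths.\<close>

lemma module_pointwise: "Modules.module (\<lambda>(c::'a::comm_ring_1) (f :: nat \<Rightarrow> 'a) i. c * f i)"
  by unfold_locales (simp_all add: fun_eq_iff distrib_left distrib_right mult.assoc)

interpretation free: Modules.module "\<lambda>(c::'a::comm_ring_1) (f :: nat \<Rightarrow> 'a) i. c * f i"
  by (rule module_pointwise)

declare free.scale_scale [simp del]

abbreviation scale :: "'a::comm_ring_1 \<Rightarrow> (nat \<Rightarrow> 'a) \<Rightarrow> nat \<Rightarrow> 'a" where
  "scale c f \<equiv> \<lambda>i. c * f i"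

definition lincomb :: "(nat \<Rightarrow> 'a::comm_ring_1) list \<Rightarrow> (nat \<Rightarrow> 'a) \<Rightarrow> nat \<Rightarrow> 'a" where
  "lincomb vs s r = (\<Sum>j<length vs. s j * (vs ! j) r)"

definition syzygies :: "(nat \<Rightarrow> 'a::comm_ring_1) list \<Rightarrow> (nat \<Rightarrow> 'a) set" where
  "syzygies vs = {s. (\<forall>j\<ge>length vs. s j = 0) \<and> (\<forall>r. lincomb vs s r = 0)}"

text \<open>Linear quotients for a sequence of vectors, a form that is inherited by
  syzygies.\<close>

definition linear_colons :: "(nat \<Rightarrow> ('v::finite, 'k::field) mpoly) list \<Rightarrow> bool" where
  "linear_colons vs \<longleftrightarrow> (\<forall>i<length vs. \<exists>X.
     {g. scale g (vs ! i) \<in> free.span (set (take i vs))} = ideal_gen (var ` X))"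

lemma lincomb_snoc: "lincomb (vs @ [v]) s r = lincomb vs s r + s (length vs) * v r"
  unfolding lincomb_def by (simp add: nth_append)

lemma lincomb_cong: "(\<And>j. j < length vs \<Longrightarrow> s j = t j) \<Longrightarrow> lincomb vs s r = lincomb vs t r"
  unfolding lincomb_def by (intro sum.cong) auto

lemma lincomb_add: "lincomb vs (s + t) r = lincomb vs s r + lincomb vs t r"
  unfolding lincomb_def by (simp add: distrib_right sum.distrib)

lemma lincomb_scale: "lincomb vs (scale c s) r = c * lincomb vs s r"
  unfolding lincomb_def by (simp add: sum_distrib_left mult.assoc)

lemma lincomb_in_span: "lincomb vs s \<in> free.span (set vs)"
proof -
  have "(\<Sum>j<length vs. scale (s j) (vs ! j)) \<in> free.span (set vs)"
    by (intro free.span_sum free.span_scale free.span_base) auto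
  moreover have "(\<Sum>j\<in>J. scale (s j) (vs ! j)) r = (\<Sum>j\<in>J. s j * (vs ! j) r)" for J r
    by (induction J rule: infinite_finite_induct) auto
  then have "(\<Sum>j<length vs. scale (s j) (vs ! j)) = lincomb vs s"
    unfolding lincomb_def by (intro ext)
  ultimately show ?thesis by simp
qed

lemma span_lincomb:
  assumes "f \<in> free.span (set vs)"
  obtains s where "f = lincomb vs s"
proof -
  have "free.span (set vs) \<subseteq> Set.range (lincomb vs)"
  proof (rule free.span_minimal)
    show "set vs \<subseteq> Set.range (lincomb vs)"
    proof
      fix v assume "v \<in> set vs"
      then obtain i where i: "i < length vs" "vs ! i = v" by (auto simp: in_set_conv_nth)
      have "(\<Sum>j<length vs. (if j = i then 1 else 0) * (vs ! j) r) = (\<Sum>j<length vs. if j = i then (vs ! j) r else 0)" for r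
        by (intro sum.cong) auto
      then have "v = lincomb vs (\<lambda>j. if j = i then 1 else 0)"
        unfolding lincomb_def using i by (auto simp: fun_eq_iff)
      then show "v \<in> Set.range (lincomb vs)" by blast
    qed
    show "free.subspace (Set.range (lincomb vs))"
    proof (rule free.subspaceI)
      have "lincomb vs (\<lambda>_. 0) = 0" unfolding lincomb_def by (simp add: fun_eq_iff)
      then show "0 \<in> Set.range (lincomb vs)" by (metis rangeI)
      fix x y assume "x \<in> Set.range (lincomb vs)" "y \<in> Set.range (lincomb vs)"
      then obtain s t where "x = lincomb vs s" "y = lincomb vs t" by blast
      then have "x + y = lincomb vs (s + t)" by (simp add: fun_eq_iff lincomb_add)
      then show "x + y \<in> Set.range (lincomb vs)" by blast
    next
      fix c x assume "x \<in> Set.range (lincomb vs)"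
      then obtain s where "x = lincomb vs s" by blast
      then have "scale c x = lincomb vs (scale c s)" by (simp add: fun_eq_iff lincomb_scale)
      then show "scale c x \<in> Set.range (lincomb vs)" by blast
    qed
  qed
  then show thesis using assms that by blast
qed

lemma subspace_syzygies: "free.subspace (syzygies vs)"
proof (rule free.subspaceI)
  show "0 \<in> syzygies vs" unfolding syzygies_def lincomb_def by simp
  show "x + y \<in> syzygies vs" if "x \<in> syzygies vs" "y \<in> syzygies vs" for x y
    using that unfolding syzygies_def by (simp add: lincomb_add)
  show "scale c x \<in> syzygies vs" if "x \<in> syzygies vs" for c x
    using that unfolding syzygies_def by (simp add: lincomb_scale)
qed

lemma syzygies_snoc: "s \<in> syzygies (vs @ [v]) \<and> s (length vs) = 0 \<longleftrightarrow> s \<in> syzygies vs"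
proof
  assume s: "s \<in> syzygies (vs @ [v]) \<and> s (length vs) = 0"
  then have "s j = 0" if "length vs \<le> j" for j
    using that unfolding syzygies_def by (cases "j = length vs") auto
  then show "s \<in> syzygies vs" using s unfolding syzygies_def by (simp add: lincomb_snoc)
qed (auto simp: syzygies_def lincomb_snoc)

lift_definition hom_part :: "nat \<Rightarrow> ('v, 'k::field) mpoly \<Rightarrow> ('v, 'k) mpoly" is
  "\<lambda>d f m. if mon_degree m = d then f m else 0"
  by (erule finite_subset[rotated]) auto

lemma homogeneous_hom_part: "homogeneous d (hom_part d f)"
  unfolding homogeneous_def by (auto simp: in_keys_iff hom_part.rep_eq split: if_splits)

lemma hom_part_homogeneous: "homogeneous d f \<Longrightarrow> hom_part d f = f"
  unfolding homogeneous_def by (intro poly_mapping_eqI) (auto simp: in_keys_iff hom_part.rep_eq)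

lemma hom_part_sum: "hom_part d (\<Sum>i\<in>I. f i) = (\<Sum>i\<in>I. hom_part d (f i))"
  by (intro poly_mapping_eqI) (simp add: hom_part.rep_eq lookup_sum)

text \<open>Allows the coefficients in a homogeneous relation to be replaced by their homogeneous
  parts.\<close>

lemma hom_part_mult:
  fixes p q :: "('v::finite, 'k::field) mpoly"
  assumes q: "homogeneous \<delta> q"
  shows "hom_part (e + \<delta>) (p * q) = hom_part e p * q"
proof (rule poly_mapping_eqI)
  fix m
  show "Poly_Mapping.lookup (hom_part (e + \<delta>) (p * q)) m = Poly_Mapping.lookup (hom_part e p * q) m"
  proof (cases "mon_degree m = e + \<delta>")
    case True
    have "Poly_Mapping.lookup ((p - hom_part e p) * q) m = 0"
    proof (rule lookup_mult_none)
      fix a b assume a: "a \<in> Poly_Mapping.keys (p - hom_part e p)" and b: "b \<in> Poly_Mapping.keys q"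
      have "mon_degree a \<noteq> e" using a by (auto simp: in_keys_iff lookup_minus hom_part.rep_eq)
      moreover have "mon_degree b = \<delta>" using b q unfolding homogeneous_def by blast
      ultimately show "a + b \<noteq> m" using True mon_degree_add[of a b] by auto
    qed
    moreover have "p * q = hom_part e p * q + (p - hom_part e p) * q" by (simp add: algebra_simps)
    ultimately have "Poly_Mapping.lookup (p * q) m = Poly_Mapping.lookup (hom_part e p * q) m"
      by (metis add.right_neutral lookup_add)
    then show ?thesis using True by (simp add: hom_part.rep_eq)
  next
    case False
    have "Poly_Mapping.lookup (hom_part e p * q) m = 0"
    proof (rule lookup_mult_none)
      fix a b assume a: "a \<in> Poly_Mapping.keys (hom_part e p)" and b: "b \<in> Poly_Mapping.keys q"
      have "mon_degree a = e" using a homogeneous_hom_part unfolding homogeneous_def by blast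
      moreover have "mon_degree b = \<delta>" using b q unfolding homogeneous_def by blast
      ultimately show "a + b \<noteq> m" using False mon_degree_add[of a b] by auto
    qed
    then show ?thesis using False by (simp add: hom_part.rep_eq)
  qed
qed

lemma homogeneous_var: "homogeneous 1 (var x :: ('v::finite, 'k::field) mpoly)"
  unfolding var_xpow homogeneous_def by (simp add: mon_degree_Abs)

lemma homogeneous_mult:
  fixes p q :: "('v::finite, 'k::field) mpoly"
  assumes "homogeneous e p" "homogeneous \<delta> q"
  shows "homogeneous (e + \<delta>) (p * q)"
  using hom_part_mult[OF assms(2), of e p] homogeneous_hom_part[of "e + \<delta>" "p * q"]
  by (simp add: hom_part_homogeneous[OF assms(1)])

lemma homogeneous_uminus: "homogeneous d p \<Longrightarrow> homogeneous d (- p)"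
  unfolding homogeneous_def by (simp add: in_keys_iff)

text \<open>A variable outside \<open>Y\<close> is a nonzerodivisor modulo the prime ideal generated
  by \<open>Y\<close>.\<close>

lemma var_mult_in_vars:
  fixes g :: "('v::finite, 'k::field) mpoly"
  assumes "g * var x \<in> ideal_gen (var ` Y)" "x \<notin> Y"
  shows "g \<in> ideal_gen (var ` Y)"
proof -
  define e where "e v z = (if z = v then 1 else 0 :: nat)" for v z :: 'v
  have var: "(var v :: ('v, 'k) mpoly) = xpow (e v)" for v unfolding e_def by (rule var_xpow)
  have "(var ` Y :: ('v, 'k) mpoly set) = xpow ` e ` Y" by (simp add: var image_image)
  then have "\<forall>m\<in>Poly_Mapping.keys g. \<exists>a\<in>e ` Y. \<forall>z. a z \<le> Poly_Mapping.lookup m z + e x z"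
    using assms(1) unfolding var by (simp only: mult_xpow_in_iff)
  then have *: "\<exists>y\<in>Y. \<forall>z. e y z \<le> Poly_Mapping.lookup m z + e x z" if "m \<in> Poly_Mapping.keys g" for m
    using that by blast
  have "\<exists>y\<in>Y. 0 < Poly_Mapping.lookup m y" if m: "m \<in> Poly_Mapping.keys g" for m
  proof -
    obtain y where y: "y \<in> Y" "\<And>z. e y z \<le> Poly_Mapping.lookup m z + e x z" using *[OF m] by blast
    have "y \<noteq> x" using y(1) assms(2) by blast
    then have "0 < Poly_Mapping.lookup m y" using y(2)[of y] unfolding e_def by simp
    then show ?thesis using y(1) by blast
  qed
  then show ?thesis unfolding ideal_gen_vars monomial_ideal_def by simp
qed

text \<open>The generators of the syzygies of \<open>vs\<close> are, for every \<open>v = vs ! i\<close> and every variable \<open>x\<close> in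
  the colon ideal at \<open>i\<close>, the relations expressing \<open>x v\<close> through earlier vectors. In the order of
  the pairs \<open>(i, x)\<close> their colon ideals are again generated by variables.\<close>

lemma linear_syzygies:
  fixes vs :: "(nat \<Rightarrow> ('v::finite, 'k::field) mpoly) list"
  assumes "linear_colons vs" and "\<And>f r. f \<in> set vs \<Longrightarrow> homogeneous \<delta> (f r)"
  shows "\<exists>ss. linear_colons ss \<and> (\<forall>s\<in>set ss. \<forall>r. homogeneous 1 (s r)) \<and>
    free.span (set ss) = syzygies vs"
  using assms
proof (induction vs rule: rev_induct)
  case Nil
  have "syzygies ([] :: (nat \<Rightarrow> ('v, 'k) mpoly) list) = {0}"
    unfolding syzygies_def lincomb_def by (auto simp: fun_eq_iff)
  then show ?case by (intro exI[of _ "[]"]) (simp add: linear_colons_def)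
next
  case (snoc v vs)
  let ?n = "length vs"
  have "linear_colons vs"
    unfolding linear_colons_def
  proof (intro allI impI)
    fix i assume i: "i < length vs"
    then obtain X where "{g. scale g ((vs @ [v]) ! i) \<in> free.span (set (take i (vs @ [v])))} = ideal_gen (var ` X)"
      using snoc.prems(1) unfolding linear_colons_def by fastforce
    then show "\<exists>X. {g. scale g (vs ! i) \<in> free.span (set (take i vs))} = ideal_gen (var ` X)"
      using i by (auto simp: nth_append)
  qed
  then obtain ss where ss: "linear_colons ss" "\<And>s r. s \<in> set ss \<Longrightarrow> homogeneous 1 (s r)"
    "free.span (set ss) = syzygies vs"
    using snoc.IH snoc.prems(2) by (metis UnI1 set_append)
  obtain X where X: "{g. scale g v \<in> free.span (set vs)} = ideal_gen (var ` X)"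
    using snoc.prems(1) unfolding linear_colons_def by fastforce
  have hom: "homogeneous \<delta> ((vs ! j) r)" if "j < ?n" for j r
    using snoc.prems(2)[of "vs ! j" r] that by simp
  have homv: "homogeneous \<delta> (v r)" for r using snoc.prems(2)[of v r] by simp
  have "\<exists>h. (\<forall>j\<ge>?n. h j = 0) \<and> (\<forall>j. homogeneous 1 (h j)) \<and> scale (var x) v = lincomb vs h"
    if x: "x \<in> X" for x
  proof -
    have "var x \<in> ideal_gen (var ` X)" using x unfolding ideal_gen_def by (simp add: ideal.span_base)
    then have "scale (var x) v \<in> free.span (set vs)" using X by blast
    then obtain s where s: "scale (var x) v = lincomb vs s" by (rule span_lincomb)
    \<comment> \<open>The relation lives in degree \<open>1 + \<delta>\<close>, so keeping only the
      linear part of each coefficient preserves it.\<close>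
    define h where "h j = (if j < ?n then hom_part 1 (s j) else 0)" for j
    have "var x * v r = lincomb vs h r" for r
    proof -
      have "homogeneous (1 + \<delta>) (var x * v r)" using homogeneous_mult[OF homogeneous_var homv] .
      then have "var x * v r = hom_part (1 + \<delta>) (lincomb vs s r)"
        using fun_cong[OF s, of r] hom_part_homogeneous by metis
      also have "\<dots> = (\<Sum>j<?n. hom_part (1 + \<delta>) (s j * (vs ! j) r))"
        unfolding lincomb_def hom_part_sum ..
      also have "\<dots> = (\<Sum>j<?n. hom_part 1 (s j) * (vs ! j) r)"
        by (intro sum.cong refl hom_part_mult hom) simp
      also have "\<dots> = lincomb vs h r" unfolding lincomb_def h_def by (intro sum.cong) auto
      finally show ?thesis .
    qed
    then have "scale (var x) v = lincomb vs h" by (intro ext)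
    moreover have "homogeneous 1 (h j)" for j
      unfolding h_def using homogeneous_hom_part[of 1 "s j"] by (auto simp: homogeneous_def)
    moreover have "\<forall>j\<ge>?n. h j = 0" unfolding h_def by simp
    ultimately show ?thesis by blast
  qed
  then obtain h where h0: "\<And>x j. x \<in> X \<Longrightarrow> ?n \<le> j \<Longrightarrow> h x j = 0"
    and hh: "\<And>x j. x \<in> X \<Longrightarrow> homogeneous 1 (h x j)"
    and hx: "\<And>x. x \<in> X \<Longrightarrow> scale (var x) v = lincomb vs (h x)" by metis
  \<comment> \<open>The relation for \<open>x\<close> as a syzygy, normalized so that its last
    coordinate is the variable \<open>x\<close> itself.\<close>
  define \<sigma> where "\<sigma> x j = (if j = ?n then var x else - h x j)" for x j
  have \<sigma>n: "\<sigma> x ?n = var x" for x unfolding \<sigma>_def by simp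
  have \<sigma>_syz: "\<sigma> x \<in> syzygies (vs @ [v])" if x: "x \<in> X" for x
  proof -
    have "lincomb vs (\<sigma> x) r = lincomb vs (scale (- 1) (h x)) r" for r
      by (rule lincomb_cong) (simp add: \<sigma>_def)
    then have "lincomb (vs @ [v]) (\<sigma> x) r = 0" for r
      unfolding lincomb_snoc lincomb_scale using fun_cong[OF hx[OF x], of r] \<sigma>n by simp
    then show ?thesis unfolding syzygies_def using h0[OF x] by (simp add: \<sigma>_def)
  qed
  obtain xs where xs: "distinct xs" "set xs = X" using finite_distinct_list[of X] by auto
  define ss' where "ss' = ss @ map \<sigma> xs"
  have ss_vs: "s \<in> syzygies vs" if "s \<in> set ss" for s using that ss(3) free.span_base by blast
  have ss_n: "s ?n = 0" if "s \<in> set ss" for s using ss_vs[OF that] unfolding syzygies_def by simp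
  have in_span_Un: "s \<in> free.span (set ss \<union> T)"
    if "s \<in> syzygies (vs @ [v])" "s ?n = 0" for s T
    using that syzygies_snoc[of s vs v] ss(3) free.span_mono[of "set ss" "set ss \<union> T"] by blast
  \<comment> \<open>The last coordinate kills \<open>ss\<close> and sends the syzygy of
    \<open>y\<close> to the variable \<open>y\<close>; it thus maps the new syzygies back to the
    colon ideal of \<open>v\<close>.\<close>
  have coord: "s ?n \<in> ideal_gen (var ` Y)" if s: "s \<in> free.span (set ss \<union> \<sigma> ` Y)" for s Y
  proof -
    have "free.span (set ss \<union> \<sigma> ` Y) \<subseteq> {s. s ?n \<in> ideal_gen (var ` Y)}"
    proof (rule free.span_minimal)
      show "set ss \<union> \<sigma> ` Y \<subseteq> {s. s ?n \<in> ideal_gen (var ` Y)}"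
      proof
        fix s assume "s \<in> set ss \<union> \<sigma> ` Y"
        then consider "s \<in> set ss" | y where "y \<in> Y" "s = \<sigma> y" by blast
        then show "s \<in> {s. s ?n \<in> ideal_gen (var ` Y)}"
        proof cases
          case 1
          then show ?thesis using ss_n[OF 1] by (simp add: ideal_gen_def ideal.span_zero)
        next
          case 2
          then show ?thesis using \<sigma>n[of y] by (simp add: ideal_gen_def ideal.span_base)
        qed
      qed
      show "free.subspace {s. s ?n \<in> ideal_gen (var ` Y)}"
        by (rule free.subspaceI)
          (auto simp: ideal_gen_def intro: ideal.span_zero ideal.span_add ideal.span_scale)
    qed
    then show ?thesis using s by blast
  qed
  have "linear_colons ss'"
    unfolding linear_colons_def
  proof (intro allI impI)
    fix i assume i: "i < length ss'"
    show "\<exists>X. {g. scale g (ss' ! i) \<in> free.span (set (take i ss'))} = ideal_gen (var ` X)"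
    proof (cases "i < length ss")
      case True
      then show ?thesis using ss(1) unfolding ss'_def linear_colons_def by (simp add: nth_append)
    next
      case False
      define t where "t = i - length ss"
      have t: "t < length xs" "ss' ! i = \<sigma> (xs ! t)" "set (take i ss') = set ss \<union> \<sigma> ` set (take t xs)"
        using i False unfolding ss'_def t_def by (auto simp: nth_append take_map)
      let ?Y = "set (take t xs)" and ?x = "xs ! t"
      have YX: "?Y \<subseteq> X" "?x \<in> X" using xs(2) t(1) set_take_subset[of t xs] by auto
      have xY: "?x \<notin> ?Y" using xs(1) t(1) by (auto simp: in_set_conv_nth nth_eq_iff_index_eq)
      have "{g. scale g (\<sigma> ?x) \<in> free.span (set ss \<union> \<sigma> ` ?Y)} = ideal_gen (var ` ?Y)"
      proof
        show "{g. scale g (\<sigma> ?x) \<in> free.span (set ss \<union> \<sigma> ` ?Y)} \<subseteq> ideal_gen (var ` ?Y)"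
        proof
          fix g assume "g \<in> {g. scale g (\<sigma> ?x) \<in> free.span (set ss \<union> \<sigma> ` ?Y)}"
          then have "g * var ?x \<in> ideal_gen (var ` ?Y)"
            using coord[of "scale g (\<sigma> ?x)" ?Y] by (simp add: \<sigma>n)
          then show "g \<in> ideal_gen (var ` ?Y)" using xY by (rule var_mult_in_vars)
        qed
        have "ideal.span (var ` ?Y) \<subseteq> {g. scale g (\<sigma> ?x) \<in> free.span (set ss \<union> \<sigma> ` ?Y)}"
        proof (rule ideal.span_minimal)
          show "var ` ?Y \<subseteq> {g. scale g (\<sigma> ?x) \<in> free.span (set ss \<union> \<sigma> ` ?Y)}"
          proof
            fix g :: "('v, 'k) mpoly" assume "g \<in> var ` ?Y"
            then obtain y where y: "y \<in> ?Y" "g = var y" by blast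
            \<comment> \<open>A Koszul-type combination: the last coordinates cancel, which leaves a
              syzygy of \<open>vs\<close>, and those are spanned by \<open>ss\<close>.\<close>
            let ?s = "scale (var y) (\<sigma> ?x) - scale (var ?x) (\<sigma> y)"
            have "\<sigma> y \<in> syzygies (vs @ [v])" "\<sigma> ?x \<in> syzygies (vs @ [v])" using \<sigma>_syz YX y(1) by blast+
            then have "?s \<in> syzygies (vs @ [v])"
              by (intro free.subspace_diff free.subspace_scale subspace_syzygies)
            moreover have "?s ?n = 0" by (simp add: \<sigma>n)
            ultimately have "?s \<in> free.span (set ss \<union> \<sigma> ` ?Y)" by (rule in_span_Un)
            moreover have "scale (var ?x) (\<sigma> y) \<in> free.span (set ss \<union> \<sigma> ` ?Y)"
              using y(1) by (intro free.span_scale free.span_base) blast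
            ultimately have "?s + scale (var ?x) (\<sigma> y) \<in> free.span (set ss \<union> \<sigma> ` ?Y)"
              by (rule free.span_add)
            then show "g \<in> {g. scale g (\<sigma> ?x) \<in> free.span (set ss \<union> \<sigma> ` ?Y)}"
              unfolding y(2) by simp
          qed
          show "ideal.subspace {g. scale g (\<sigma> ?x) \<in> free.span (set ss \<union> \<sigma> ` ?Y)}"
          proof (rule ideal.subspaceI)
            show "0 \<in> {g. scale g (\<sigma> ?x) \<in> free.span (set ss \<union> \<sigma> ` ?Y)}"
              using free.span_zero by (simp add: zero_fun_def)
            fix p q assume pq: "p \<in> {g. scale g (\<sigma> ?x) \<in> free.span (set ss \<union> \<sigma> ` ?Y)}"
              "q \<in> {g. scale g (\<sigma> ?x) \<in> free.span (set ss \<union> \<sigma> ` ?Y)}"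
            have "scale (p + q) (\<sigma> ?x) = scale p (\<sigma> ?x) + scale q (\<sigma> ?x)"
              by (simp add: fun_eq_iff distrib_right)
            then show "p + q \<in> {g. scale g (\<sigma> ?x) \<in> free.span (set ss \<union> \<sigma> ` ?Y)}"
              using pq free.span_add by simp
          next
            fix c q assume q: "q \<in> {g. scale g (\<sigma> ?x) \<in> free.span (set ss \<union> \<sigma> ` ?Y)}"
            have "scale (c * q) (\<sigma> ?x) = scale c (scale q (\<sigma> ?x))" by (simp add: fun_eq_iff mult.assoc)
            then show "c * q \<in> {g. scale g (\<sigma> ?x) \<in> free.span (set ss \<union> \<sigma> ` ?Y)}"
              using q free.span_scale[of "scale q (\<sigma> ?x)" _ c] by simp
          qed
        qed
        then show "ideal_gen (var ` ?Y) \<subseteq> {g. scale g (\<sigma> ?x) \<in> free.span (set ss \<union> \<sigma> ` ?Y)}"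
          unfolding ideal_gen_def .
      qed
      then show ?thesis unfolding t(2,3) by blast
    qed
  qed
  moreover have "homogeneous 1 (s r)" if "s \<in> set ss'" for s r
    using that ss(2) xs(2) hh homogeneous_var unfolding ss'_def
    by (auto simp: \<sigma>_def intro!: homogeneous_uminus)
  moreover have "free.span (set ss') = syzygies (vs @ [v])"
  proof
    show "free.span (set ss') \<subseteq> syzygies (vs @ [v])"
    proof (rule free.span_minimal[OF _ subspace_syzygies])
      show "set ss' \<subseteq> syzygies (vs @ [v])"
        using ss_vs syzygies_snoc \<sigma>_syz xs(2) unfolding ss'_def by auto
    qed
    show "syzygies (vs @ [v]) \<subseteq> free.span (set ss')"
    proof
      fix s assume s: "s \<in> syzygies (vs @ [v])"
      \<comment> \<open>Solving a syzygy for its last term shows that its last coordinate lies in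
        the colon ideal. A combination of the new syzygies matches that coordinate, and the
        difference is a syzygy of \<open>vs\<close>.\<close>
      have "scale (s ?n) v = lincomb vs (scale (- 1) s)"
      proof
        fix r
        have "lincomb vs s r + s ?n * v r = 0" using s unfolding syzygies_def by (simp add: lincomb_snoc)
        then show "s ?n * v r = lincomb vs (scale (- 1) s) r"
          unfolding lincomb_scale by (simp add: eq_neg_iff_add_eq_0 add.commute)
      qed
      then have "scale (s ?n) v \<in> free.span (set vs)" using lincomb_in_span by metis
      then have "s ?n \<in> ideal_gen (var ` X)" using X by blast
      moreover have "ideal.span (var ` X) \<subseteq> {p. \<exists>r\<in>free.span (\<sigma> ` X). r ?n = p}"
      proof (rule ideal.span_minimal)
        show "var ` X \<subseteq> {p. \<exists>r\<in>free.span (\<sigma> ` X). r ?n = p}"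
          using \<sigma>n free.span_base by blast
        show "ideal.subspace {p. \<exists>r\<in>free.span (\<sigma> ` X). r ?n = p}"
        proof (rule ideal.subspaceI)
          show "0 \<in> {p. \<exists>r\<in>free.span (\<sigma> ` X). r ?n = p}"
            using free.span_zero by (intro CollectI bexI[of _ 0]) auto
          fix p q assume "p \<in> {p. \<exists>r\<in>free.span (\<sigma> ` X). r ?n = p}" "q \<in> {p. \<exists>r\<in>free.span (\<sigma> ` X). r ?n = p}"
          then obtain r1 r2 where "r1 \<in> free.span (\<sigma> ` X)" "r1 ?n = p" "r2 \<in> free.span (\<sigma> ` X)" "r2 ?n = q"
            by blast
          then show "p + q \<in> {p. \<exists>r\<in>free.span (\<sigma> ` X). r ?n = p}"
            by (intro CollectI bexI[of _ "r1 + r2"]) (auto intro: free.span_add)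
        next
          fix c p assume "p \<in> {p. \<exists>r\<in>free.span (\<sigma> ` X). r ?n = p}"
          then obtain r where "r \<in> free.span (\<sigma> ` X)" "r ?n = p" by blast
          then show "c * p \<in> {p. \<exists>r\<in>free.span (\<sigma> ` X). r ?n = p}"
            by (intro CollectI bexI[of _ "scale c r"]) (auto intro: free.span_scale)
        qed
      qed
      ultimately obtain r where r: "r \<in> free.span (\<sigma> ` X)" "r ?n = s ?n"
        unfolding ideal_gen_def by blast
      have rs: "r \<in> free.span (set ss')"
        using r(1) free.span_mono[of "\<sigma> ` X" "set ss'"] xs(2) unfolding ss'_def by auto
      have "r \<in> syzygies (vs @ [v])"
        using r(1) free.span_minimal[OF _ subspace_syzygies, of "\<sigma> ` X"] \<sigma>_syz by blast
      then have "s - r \<in> syzygies (vs @ [v])" using s by (intro free.subspace_diff subspace_syzygies)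
      moreover have "(s - r) ?n = 0" using r(2) by simp
      ultimately have "s - r \<in> free.span (set ss \<union> \<sigma> ` X)" by (rule in_span_Un)
      then have "s - r + r \<in> free.span (set ss')"
        using rs xs(2) unfolding ss'_def by (intro free.span_add) simp_all
      then show "s \<in> free.span (set ss')" by simp
    qed
  qed
  ultimately show ?case by blast
qed

section \<open>Assembling the iterated syzygies into a matrix resolution\<close>

definition col_mat :: "nat \<Rightarrow> (nat \<Rightarrow> 'a::comm_ring_1) list \<Rightarrow> 'a mat" where
  "col_mat n vs = mat n (length vs) (\<lambda>(r, c). (vs ! c) r)"

lemma col_mat_mult:
  assumes "v \<in> carrier_vec (length vs)"
  shows "col_mat n vs *\<^sub>v v = vec n (lincomb vs (\<lambda>j. v $ j))"
proof (rule eq_vecI)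
  fix r assume r: "r < dim_vec (vec n (lincomb vs (\<lambda>j. v $ j)))"
  have "(col_mat n vs *\<^sub>v v) $ r = (\<Sum>c<length vs. col_mat n vs $$ (r, c) * v $ c)"
    by (rule mult_mat_vec_sum[OF _ assms]) (use r in \<open>auto simp: col_mat_def\<close>)
  then show "(col_mat n vs *\<^sub>v v) $ r = vec n (lincomb vs (\<lambda>j. v $ j)) $ r"
    using r by (simp add: col_mat_def lincomb_def mult.commute)
qed (simp add: col_mat_def)

lemma mat_image_col_mat: "mat_image (col_mat n vs) = vec n ` free.span (set vs)"
proof (intro equalityI subsetI)
  fix w assume "w \<in> mat_image (col_mat n vs)"
  then obtain v where v: "v \<in> carrier_vec (length vs)" "w = col_mat n vs *\<^sub>v v"
    unfolding mat_image_def by (auto simp: col_mat_def)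
  then show "w \<in> vec n ` free.span (set vs)" using lincomb_in_span by (auto simp: col_mat_mult)
next
  fix w assume "w \<in> vec n ` free.span (set vs)"
  then obtain f where f: "f \<in> free.span (set vs)" "w = vec n f" by blast
  obtain s where s: "f = lincomb vs s" using f(1) by (rule span_lincomb)
  have "lincomb vs (\<lambda>j. vec (length vs) s $ j) = f"
    unfolding s by (intro ext lincomb_cong) simp
  then have "w = col_mat n vs *\<^sub>v vec (length vs) s" by (simp add: col_mat_mult f(2))
  then show "w \<in> mat_image (col_mat n vs)"
    unfolding mat_image_def by (auto simp: col_mat_def)
qed

lemma mat_kernel_col_mat:
  assumes "\<And>f r. f \<in> set vs \<Longrightarrow> n \<le> r \<Longrightarrow> f r = 0"
  shows "mat_kernel (col_mat n vs) = vec (length vs) ` syzygies vs"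
proof (intro equalityI subsetI)
  fix v assume "v \<in> mat_kernel (col_mat n vs)"
  then have v: "v \<in> carrier_vec (length vs)" "col_mat n vs *\<^sub>v v = 0\<^sub>v n"
    unfolding mat_kernel_def by (auto simp: col_mat_def)
  define s where "s j = (if j < length vs then v $ j else 0)" for j
  have "lincomb vs s r = 0" for r
  proof (cases "r < n")
    case True
    have "lincomb vs s r = lincomb vs (\<lambda>j. v $ j) r" by (rule lincomb_cong) (simp add: s_def)
    also have "\<dots> = (col_mat n vs *\<^sub>v v) $ r" using True v(1) by (simp add: col_mat_mult)
    finally show ?thesis using True v(2) by simp
  next
    case False
    then have "(vs ! j) r = 0" if "j < length vs" for j using assms[OF nth_mem[OF that]] by simp
    then show ?thesis unfolding lincomb_def by (intro sum.neutral) simp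
  qed
  then have "s \<in> syzygies vs" unfolding syzygies_def s_def by simp
  moreover have "v = vec (length vs) s" using v(1) by (intro eq_vecI) (auto simp: s_def)
  ultimately show "v \<in> vec (length vs) ` syzygies vs" by blast
next
  fix v assume "v \<in> vec (length vs) ` syzygies vs"
  then obtain s where s: "s \<in> syzygies vs" "v = vec (length vs) s" by blast
  have "lincomb vs (\<lambda>j. v $ j) r = 0" for r
  proof -
    have "lincomb vs (\<lambda>j. v $ j) r = lincomb vs s r" by (rule lincomb_cong) (simp add: s(2))
    then show ?thesis using s(1) unfolding syzygies_def by simp
  qed
  then have "col_mat n vs *\<^sub>v v = 0\<^sub>v n" using s(2) by (simp add: col_mat_mult) (auto intro: eq_vecI)
  then show "v \<in> mat_kernel (col_mat n vs)" using s(2) unfolding mat_kernel_def by (auto simp: col_mat_def)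
qed

text \<open>Turns a polynomial into a vector of length one, so the generators of the ideal start the
  same iteration as all later syzygies.\<close>

definition embed :: "'a::comm_ring_1 \<Rightarrow> nat \<Rightarrow> 'a" where
  "embed p r = (if r = 0 then p else 0)"

lemma span_embed: "free.span (embed ` S) = embed ` ideal.span S"
proof
  show "free.span (embed ` S) \<subseteq> embed ` ideal.span S"
  proof (rule free.span_minimal)
    show "embed ` S \<subseteq> embed ` ideal.span S" using ideal.span_superset by blast
    show "free.subspace (embed ` ideal.span S)"
    proof (rule free.subspaceI)
      show "0 \<in> embed ` ideal.span S"
        by (rule image_eqI[OF _ ideal.span_zero]) (simp add: embed_def fun_eq_iff)
      fix x y assume "x \<in> embed ` ideal.span S" "y \<in> embed ` ideal.span S"
      then obtain p q where "p \<in> ideal.span S" "q \<in> ideal.span S" "x = embed p" "y = embed q" by blast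
      then show "x + y \<in> embed ` ideal.span S"
        by (intro image_eqI[OF _ ideal.span_add[of p S q]]) (auto simp: embed_def fun_eq_iff)
    next
      fix c x assume "x \<in> embed ` ideal.span S"
      then obtain p where "p \<in> ideal.span S" "x = embed p" by blast
      then show "scale c x \<in> embed ` ideal.span S"
        by (intro image_eqI[OF _ ideal.span_scale[of p S c]]) (auto simp: embed_def fun_eq_iff)
    qed
  qed
  have "ideal.span S \<subseteq> {p. embed p \<in> free.span (embed ` S)}"
  proof (rule ideal.span_minimal)
    show "S \<subseteq> {p. embed p \<in> free.span (embed ` S)}" using free.span_base by blast
    show "ideal.subspace {p. embed p \<in> free.span (embed ` S)}"
    proof (rule ideal.subspaceI)
      have "embed (0::'a) = 0" by (simp add: embed_def fun_eq_iff)
      then show "0 \<in> {p. embed p \<in> free.span (embed ` S)}" using free.span_zero by simp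
      fix p q assume pq: "p \<in> {p. embed p \<in> free.span (embed ` S)}" "q \<in> {p. embed p \<in> free.span (embed ` S)}"
      have "embed (p + q) = embed p + embed q" by (simp add: embed_def fun_eq_iff)
      then show "p + q \<in> {p. embed p \<in> free.span (embed ` S)}" using pq free.span_add by simp
    next
      fix c p assume p: "p \<in> {p. embed p \<in> free.span (embed ` S)}"
      have "embed (c * p) = scale c (embed p)" by (simp add: embed_def fun_eq_iff)
      then show "c * p \<in> {p. embed p \<in> free.span (embed ` S)}"
        using p free.span_scale[of "embed p" _ c] by simp
    qed
  qed
  then show "embed ` ideal.span S \<subseteq> free.span (embed ` S)" by blast
qed

lemma lq_linear_resolution:
  assumes "lq_order ws" and deg: "\<And>w. w \<in> set ws \<Longrightarrow> sum w UNIV = l"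
  shows "has_linear_resolution (ideal_gen (xpow ` set ws) :: ('v::finite, 'k::field) mpoly set)"
proof -
  define v0 where "v0 = map (\<lambda>w. embed (xpow w :: ('v, 'k) mpoly)) ws"
  \<comment> \<open>The generators have degree \<open>l\<close>, all later columns are linear. The
    clause for \<open>i = 0\<close> pins the start of the sequence produced by dependent
    choice.\<close>
  define P where "P i vs \<longleftrightarrow> linear_colons vs \<and>
      (\<forall>f\<in>set vs. \<forall>r. homogeneous (if i = 0 then l else 1) (f r)) \<and> (i = 0 \<longrightarrow> vs = v0)"
    for i :: nat and vs :: "(nat \<Rightarrow> ('v, 'k) mpoly) list"
  have embed_inj: "embed p = embed q \<longleftrightarrow> p = q" for p q :: "('v, 'k) mpoly"
    unfolding embed_def by (metis (full_types))
  have P0: "P 0 v0"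
    unfolding P_def
  proof (intro conjI impI ballI allI refl)
    show "linear_colons v0"
      unfolding linear_colons_def
    proof (intro allI impI)
      fix i assume i: "i < length v0"
      have "scale g (v0 ! i) = embed (g * xpow (ws ! i))" for g
        using i unfolding v0_def by (simp add: embed_def fun_eq_iff)
      moreover have "set (take i v0) = embed ` xpow ` set (take i ws)"
        unfolding v0_def by (simp add: take_map image_image)
      ultimately have "{g. scale g (v0 ! i) \<in> free.span (set (take i v0))} =
          {g. g * xpow (ws ! i) \<in> ideal_gen (xpow ` set (take i ws))}"
        unfolding ideal_gen_def by (auto simp: span_embed embed_inj)
      then show "\<exists>X. {g. scale g (v0 ! i) \<in> free.span (set (take i v0))} = ideal_gen (var ` X)"
        using lq_colon[OF assms(1), of i] i unfolding v0_def by auto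
    qed
    show "homogeneous (if (0::nat) = 0 then l else 1) (f r)" if "f \<in> set v0" for f r
    proof -
      obtain w where "w \<in> set ws" "f = embed (xpow w)" using \<open>f \<in> set v0\<close> unfolding v0_def by auto
      then show ?thesis using deg by (simp add: embed_def homogeneous_def mon_degree_Abs)
    qed
  qed
  have step: "\<exists>ss. P (Suc i) ss \<and> free.span (set ss) = syzygies vs" if "P i vs" for i vs
    using linear_syzygies[of vs "if i = 0 then l else 1"] that unfolding P_def by auto
  have "\<exists>vs. \<forall>i. P i (vs i) \<and> free.span (set (vs (Suc i))) = syzygies (vs i)"
    by (rule dependent_nat_choice) (use P0 step in blast)+
  then obtain vs where vs: "\<And>i. P i (vs i)" and syz: "\<And>i. free.span (set (vs (Suc i))) = syzygies (vs i)"
    by blast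
  have vs0: "vs 0 = v0" using vs[of 0] unfolding P_def by simp
  \<comment> \<open>The number of rows at stage \<open>i\<close>: one for the ideal, afterwards the
    number of vectors of the preceding stage.\<close>
  define N where "N i = (case i of 0 \<Rightarrow> 1 | Suc j \<Rightarrow> length (vs j))" for i
  have supp: "f r = 0" if "f \<in> set (vs i)" "N i \<le> r" for f r i
  proof (cases i)
    case 0
    then show ?thesis using that vs0 unfolding N_def v0_def by (auto simp: embed_def)
  next
    case (Suc j)
    then have "f \<in> syzygies (vs j)" using that(1) syz[of j] free.span_base by blast
    then show ?thesis using that(2) Suc unfolding N_def syzygies_def by simp
  qed
  define a where "a i = replicate (length (vs i)) (l + i)" for i
  define D where "D i = col_mat (N i) (vs i)" for i
  have hom: "homogeneous (if i = 0 then l else 1) ((vs i ! c) r)" if "c < length (vs i)" for i c r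
    using vs[of i] that unfolding P_def by auto
  have deg1: "mon_degree m = 1"
    if "r < length (a i)" "c < length (a (Suc i))" "m \<in> Poly_Mapping.keys (D (Suc i) $$ (r, c))" for i r c m
    using hom[of c "Suc i" r] that unfolding a_def D_def N_def homogeneous_def by (simp add: col_mat_def)
  have "graded_free_resolution (ideal_gen (xpow ` set ws)) a D"
    unfolding graded_free_resolution_def
  proof (intro conjI allI impI ballI)
    show "D 0 \<in> carrier_mat 1 (length (a 0))" unfolding D_def a_def N_def by (simp add: col_mat_def)
    show "D (Suc i) \<in> carrier_mat (length (a i)) (length (a (Suc i)))" for i
      unfolding D_def a_def N_def by (simp add: col_mat_def)
    show "homogeneous (a 0 ! c) (D 0 $$ (0, c))" if "c < length (a 0)" for c
      using hom[of c 0 0] that unfolding D_def a_def N_def by (simp add: col_mat_def)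
    show "a i ! r + mon_degree m = a (Suc i) ! c"
      if "r < length (a i)" "c < length (a (Suc i))" "m \<in> Poly_Mapping.keys (D (Suc i) $$ (r, c))" for i r c m
      using deg1[OF that] that(1,2) unfolding a_def by simp
    have "(\<lambda>w. w $ 0) ` mat_image (D 0) = (\<lambda>f. f 0) ` free.span (set v0)"
      unfolding D_def N_def mat_image_col_mat vs0 by (simp add: image_image)
    also have "set v0 = embed ` xpow ` set ws" unfolding v0_def by (simp add: image_image)
    finally show "(\<lambda>w. w $ 0) ` mat_image (D 0) = (ideal_gen (xpow ` set ws) :: ('v, 'k) mpoly set)"
      unfolding span_embed ideal_gen_def by (simp add: image_image embed_def)
    have "mat_kernel (D i) = vec (length (vs i)) ` syzygies (vs i)" for i
      unfolding D_def by (rule mat_kernel_col_mat) (rule supp)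
    then show "mat_kernel (D i) = mat_image (D (Suc i))" for i
      unfolding D_def mat_image_col_mat syz N_def by simp
  qed
  \<comment> \<open>Minimality is automatic: all entries of the differentials are linear
    forms.\<close>
  moreover have "Poly_Mapping.lookup (D (Suc i) $$ (r, c)) 0 = 0"
    if "r < length (a i)" "c < length (a (Suc i))" for i r c
    using deg1[OF that, of 0] by (auto simp: in_keys_iff mon_degree_def)
  moreover have "s = l + i" if "s \<in> set (a i)" for i s using that unfolding a_def by simp
  ultimately show ?thesis
    unfolding has_linear_resolution_def minimal_graded_free_resolution_def by blast
qed


section \<open>Equivalence\<close>

lemma simple_bipartite_graph:
  fixes E :: "'v::finite set set"
  assumes "simple_graph UNIV E" "bipartite UNIV E"
  shows "\<exists>A B. finite_bipartite_graph E A B"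
proof -
  obtain A B where AB: "A \<union> B = UNIV" "A \<inter> B = {}" "\<forall>e\<in>E. \<exists>a\<in>A. \<exists>b\<in>B. e = {a, b}"
    using assms(2) unfolding bipartite_def by (elim exE conjE)
  then have "finite_bipartite_graph E A B"
    unfolding finite_bipartite_graph_def using assms(1) by unfold_locales auto
  then show ?thesis by blast
qed

context finite_bipartite_graph
begin

lemma leafy_componentwise_linear:
  assumes "leafy E"
  shows "componentwise_linear (monomial_ideal {w. kcover E k w} :: ('v, 'k::field) mpoly set)"
  unfolding componentwise_linear_def
proof (intro conjI allI)
  show "homogeneous_ideal (monomial_ideal {w. kcover E k w} :: ('v, 'k) mpoly set)"
    by (rule homogeneous_monomial_ideal[OF upclosed_kcover])
  interpret leafy_graph E A B using assms by unfold_locales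
  fix l
  obtain ws where ws: "set ws = {w. kcover E k w \<and> sum w UNIV = l}" "lq_order ws"
    using lq_kcovers unfolding lq_set_def by blast
  then show "has_linear_resolution
      (ideal_gen {f \<in> monomial_ideal {w. kcover E k w}. homogeneous l f} :: ('v, 'k) mpoly set)"
    unfolding degree_component using lq_linear_resolution[OF ws(2), of l] by simp
qed

lemma componentwise_linear_leafy:
  assumes cl: "componentwise_linear (monomial_ideal {w. kcover E k w} :: ('v, 'k::field) mpoly set)"
    and k: "0 < k"
  shows "leafy E"
proof (rule linear_leafy[OF k])
  fix u v assume uv: "kcover E k u" "kcover E k v" "sum u UNIV = sum v UNIV" "u \<noteq> v"
  have "has_linear_resolution (ideal_gen {f \<in> monomial_ideal {w. kcover E k w}. homogeneous (sum v UNIV) f}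
      :: ('v, 'k) mpoly set)"
    using cl unfolding componentwise_linear_def by blast
  from linear_resolution_exchange[OF this, of u v] uv
  show "\<exists>i j. i \<noteq> j \<and> v i < u i \<and> 0 < v j \<and> kcover E k (v(i := Suc (v i), j := v j - 1))"
    by simp
qed

end

theorem theorem5p3:
  fixes E :: "'v::finite set set"
    and J :: "('v, 'k::field) mpoly set"
  assumes "simple_graph UNIV E"
    and "bipartite UNIV E"
    and "J = cover_ideal E"
  shows "(vertex_decomposable UNIV E \<longleftrightarrow> (\<forall>k\<ge>1. linear_quotients (ideal_power J k))) \<and>
         ((\<forall>k\<ge>1. linear_quotients (ideal_power J k)) \<longleftrightarrow>
            (\<forall>k\<ge>1. componentwise_linear (ideal_power J k))) \<and>
         ((\<forall>k\<ge>1. componentwise_linear (ideal_power J k)) \<longleftrightarrow>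
            (\<exists>k>1. componentwise_linear (ideal_power J k)))"
proof -
  obtain A B where "finite_bipartite_graph E A B" using simple_bipartite_graph[OF assms(1,2)] by blast
  then interpret finite_bipartite_graph E A B .
  have J: "ideal_power J k = monomial_ideal {w. kcover E k w}" for k
    unfolding assms(3) by (rule ideal_power_cover_ideal)
  have "vertex_decomposable UNIV E \<longleftrightarrow> leafy E"
    using vertex_decomposable_cover_exchange[OF _ simple] cover_exchange_leafy
      leafy_vertex_decomposable[OF _ simple] by blast
  moreover have "(\<forall>k\<ge>1. linear_quotients (ideal_power J k)) \<longleftrightarrow> leafy E"
  proof
    assume "\<forall>k\<ge>1. linear_quotients (ideal_power J k)"
    then have "linear_quotients (ideal_power J 1)" by blast
    then show "leafy E" unfolding J using linear_quotients_cover_exchange cover_exchange_leafy by blast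
  next
    assume "leafy E"
    then interpret leafy_graph E A B by unfold_locales
    show "\<forall>k\<ge>1. linear_quotients (ideal_power J k)"
      unfolding J using lq_linear_quotients[OF lq_min_kcovers] by blast
  qed
  \<comment> \<open>An equivalence for each single \<open>k\<close>, whose right side is independent
    of \<open>k\<close>; this identifies "all powers" with "some power".\<close>
  moreover have cl: "componentwise_linear (ideal_power J k) \<longleftrightarrow> leafy E" if "0 < k" for k
    unfolding J using leafy_componentwise_linear componentwise_linear_leafy that by blast
  have "(\<forall>k\<ge>1. componentwise_linear (ideal_power J k)) \<longleftrightarrow> leafy E"
    using cl[of 1] cl by (simp add: Suc_le_eq) blast
  moreover have "(\<exists>k>1. componentwise_linear (ideal_power J k)) \<longleftrightarrow> leafy E"
    using cl[of 2] cl by (auto dest: less_trans[OF zero_less_one])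
  ultimately show ?thesis by blast
qed

end
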